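(* Let $D=(X,d)$ and $\Delta=(X,\delta)$ be $\mathbb Z/2\mathbb Z$-graded Fredholm complexes over a field $\mathbb F$ such that $d_+-\delta_+:X_+\to X_-$ and $d_--\delta_-:X_-\to X_+$ have finite rank. Then the perturbation isomorphism $P(\Delta,D):|D|\to|\Delta|$ is independent of the choice of pseudo-inverses $D^\dagger$ and $\Delta^\dagger$ (with $\Delta^\dagger$ a finite rank perturbation of $D^\dagger$) and of the choice of perturbation triple $(L,M,N)$ used to define it.
   Context: All vector spaces are over a field $\mathbb F$ and may be infinite dimensional. For a finite dimensional $V$, $|V|=\Lambda^{\dim V}(V)$; linear maps induce maps on exterior powers denoted by the same symbol; for a nonzero vector $v$ of a line, $v^*$ is the dual vector with $v^*(v)=1$. A $\mathbb Z/2\mathbb Z$-graded complex $D=(X,d)$ consists of vector spaces $X_\pm$ and linear maps $d_+:X_+\to X_-$, $d_-:X_-\to X_+$ with $d_-d_+=0=d_+d_-$. Put $H_+(D)=\ker d_+/\mathrm{Im}\,d_-$, $H_-(D)=\ker d_-/\mathrm{Im}\,d_+$. $D$ is Fredholm if these are finite dimensional; then $\mathrm{Ind}(D)=\dim H_+(D)-\dim H_-(D)$ and $|D|=|H_+(D)|\otimes|H_-(D)|^*$. A pseudo-inverse of a linear map $A$ is a linear map $A^\dagger$ with $AA^\dagger A=A$, $A^\dagger AA^\dagger=A^\dagger$. A pseudo-inverse $D^\dagger$ of $D$ consists of pseudo-inverses $d_+^\dagger:X_-\to X_+$, $d_-^\dagger:X_+\to X_-$ of $d_\pm$ with $d_-^\dagger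 d_+^\dagger=0=d_+^\dagger d_-^\dagger$. An invertible $T:V\to V$ with $1-T$ of finite rank is of determinant class, and $\det T:=\det(T|_E)$ for any finite dimensional invariant $E\supseteq\mathrm{Im}(1-T)$. Perturbation isomorphism. Let $D,\Delta$ be as in the claim (then $\mathrm{Ind}(D)=\mathrm{Ind}(\Delta)$). Choose pseudo-inverses $D^\dagger,\Delta^\dagger$ with $d_\pm^\dagger-\delta_\pm^\dagger$ of finite rank. Put $\sigma_+=d_++d_-^\dagger$, $\sigma_-=d_-+d_+^\dagger$, $\tau_+=\delta_++\delta_-^\dagger$, $\tau_-=\delta_-+\delta_+^\dagger$; $\sigma_-$ (resp. $\tau_-$) is a pseudo-inverse of the Fredholm operator $\sigma_+$ (resp. $\tau_+$). Put $P_+=1-\sigma_-\sigma_+$ (idempotent onto $\ker\sigma_+$), $Q_-=1-\tau_+\tau_-$ (idempotent onto $\ker\tau_-$). The inclusions and quotient maps give canonical isomorphisms $H_+(D)\cong\ker\sigma_+$, $H_-(D)\cong\mathrm{Coker}\,\sigma_+$, $H_-(\Delta)\cong\ker\tau_-$, $H_+(\Delta)\cong\mathrm{Coker}\,\tau_-$, which are used tacitly below. If $\mathrm{Ind}(D)\le0$, a perturbation triple $(L,M,N)$ consists of linear maps $L:\ker\sigma_+\to X_-$ with $\ker\sigma_+\to\mathrm{Coker}\,\sigma_+$ injective; $M:\ker\tau_-\to X_+$ with $\ker\tau_-\to\mathrm{Coker}\,\tau_-$ surjective and $\mathrm{Im}\,M\cap\mathrm{Im}\,\tau_-=0$; $N:\ker\tau_-\to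 X_-$ inducing an isomorphism $\ker M\to X_-/(\mathrm{Im}\,\sigma_++\mathrm{Im}\,L)$ and vanishing on a complement of $\ker M$ in $\ker\tau_-$. Then $\Sigma=(\sigma_++LP_+)(\tau_-+MQ_-)+NQ_-:X_-\to X_-$ is of determinant class and $$P(\Delta,D):\ s\otimes(Ls\wedge Nt_1)^*\mapsto\det(\Sigma)^{-1}\,Mt_0\otimes(t_0\wedge t_1)^*$$ for nonzero $s\in|\ker\sigma_+|$, $t_1\in|\ker M|$, $t_0\in|\ker N|$. If $\mathrm{Ind}(D)\ge0$, a perturbation triple consists of linear maps $L:\ker\sigma_+\to X_-$ with $\ker\sigma_+\to\mathrm{Coker}\,\sigma_+$ surjective and $\mathrm{Im}\,L\cap\mathrm{Im}\,\sigma_+=0$; $M:\ker\tau_-\to X_+$ with $\ker\tau_-\to\mathrm{Coker}\,\tau_-$ injective; $N:\ker\sigma_+\to X_+$ inducing an isomorphism $\ker L\to X_+/(\mathrm{Im}\,M+\mathrm{Im}\,\tau_-)$ and vanishing on a complement of $\ker L$ in $\ker\sigma_+$. Then $\Sigma=(\tau_-+MQ_-)(\sigma_++LP_+)+NP_+:X_+\to X_+$ is of determinant class and $$P(\Delta,D):\ (s_0\wedge s_1)\otimes(Ls_1)^*\mapsto\det(\Sigma)^{-1}\,(Ns_0\wedge Mt)\otimes t^*$$ for nonzero $s_0\in|\ker L|$, $s_1\in|\ker N|$, $t\in|\ker\tau_-|$. *)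

theory Defs
  imports
    "Jordan_Normal_Form.VS_Connect"
    "HOL-Library.Poly_Mapping"
begin

section \<open>Vector spaces, subspaces and quotients\<close>

text \<open>
  The spaces \<open>X\<^sub>+\<close> and \<open>X\<^sub>-\<close> are types with a scalar multiplication satisfying
  \<^const>\<open>vector_space\<close>.  Subquotients, exterior powers, duals and tensor products cannot be types, as
  they depend on subspaces; they are structures of type \<open>('f, 'v) module\<close> over the ring
  \<^term>\<open>class_ring\<close> of the field \<open>'f\<close>.  The ring fields \<^const>\<open>mult\<close> and \<^const>\<open>one\<close> of such a structure
  play no role.
\<close>

definition space_on :: "('f::field \<Rightarrow> 'v::ab_group_add \<Rightarrow> 'v) \<Rightarrow> 'v set \<Rightarrow> ('f, 'v) module" where
  "space_on s S = \<lparr>carrier = S, mult = undefined, one = undefined, zero = 0, add = (+), smult = s\<rparr>"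

definition vcoset :: "'v::ab_group_add set \<Rightarrow> 'v \<Rightarrow> 'v set" where
  "vcoset W x = (+) x ` W"

text \<open>In the operations below the united cosets all coincide, so each union is a single coset of \<open>W\<close>.\<close>

definition quotient_space ::
  "('f::field \<Rightarrow> 'v::ab_group_add \<Rightarrow> 'v) \<Rightarrow> 'v set \<Rightarrow> 'v set \<Rightarrow> ('f, 'v set) module" where
  "quotient_space s V W =
    \<lparr>carrier = vcoset W ` V, mult = undefined, one = undefined, zero = W,
     add = (\<lambda>A B. \<Union>a\<in>A. \<Union>b\<in>B. vcoset W (a + b)),
     smult = (\<lambda>c A. \<Union>a\<in>A. vcoset W (s c a))\<rparr>"

definition ker_space ::
  "('f::field \<Rightarrow> 'v::ab_group_add \<Rightarrow> 'v) \<Rightarrow> ('v \<Rightarrow> 'w::ab_group_add) \<Rightarrow> ('f, 'v) module" where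
  "ker_space s f = space_on s {x. f x = 0}"

definition coker_space ::
  "('f::field \<Rightarrow> 'w::ab_group_add \<Rightarrow> 'w) \<Rightarrow> ('v \<Rightarrow> 'w) \<Rightarrow> ('f, 'w set) module" where
  "coker_space s f = quotient_space s UNIV (range f)"

definition vs_fin_dim :: "('f::field, 'v) module \<Rightarrow> bool" where
  "vs_fin_dim V = vectorspace.fin_dim class_ring V"

definition vs_dim :: "('f::field, 'v) module \<Rightarrow> nat" where
  "vs_dim V = vectorspace.dim class_ring V"

definition vs_hom :: "('f::field, 'v) module \<Rightarrow> ('f, 'w) module \<Rightarrow> ('v \<Rightarrow> 'w) set" where
  "vs_hom V W = LinearCombinations.module_hom class_ring V W"

definition dual_space :: "('f::field, 'v) module \<Rightarrow> ('f, 'v \<Rightarrow> 'f) module" where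
  "dual_space V =
    \<lparr>carrier = vs_hom V (space_on (*) UNIV) \<inter> extensional (carrier V),
     mult = undefined, one = undefined, zero = (\<lambda>x\<in>carrier V. 0),
     add = (\<lambda>\<phi> \<psi>. \<lambda>x\<in>carrier V. \<phi> x + \<psi> x),
     smult = (\<lambda>c \<phi>. \<lambda>x\<in>carrier V. c * \<phi> x)\<rparr>"

text \<open>The dual vector \<open>v\<^sup>*\<close> of a nonzero vector \<open>v\<close> of a line \<open>V\<close>.\<close>

definition dual_vector :: "('f::field, 'v) module \<Rightarrow> 'v \<Rightarrow> 'v \<Rightarrow> 'f" where
  "dual_vector V v = (THE \<phi>. \<phi> \<in> carrier (dual_space V) \<and> \<phi> v = 1)"

definition nonzero :: "('f, 'v) module \<Rightarrow> 'v set" where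
  "nonzero V = carrier V - {\<zero>\<^bsub>V\<^esub>}"


section \<open>Tensor products, exterior powers and determinant lines\<close>

text \<open>The free vector space on \<open>'i\<close> is the type \<open>'i \<Rightarrow>\<^sub>0 'f\<close> with the following scalar multiplication.\<close>

definition free_scale :: "'f::field \<Rightarrow> ('i \<Rightarrow>\<^sub>0 'f) \<Rightarrow> ('i \<Rightarrow>\<^sub>0 'f)" where
  "free_scale c p = Poly_Mapping.map ((*) c) p"

definition free_span :: "('i \<Rightarrow>\<^sub>0 'f::field) set \<Rightarrow> ('i \<Rightarrow>\<^sub>0 'f) set" where
  "free_span R = Modules.module.span free_scale R"

definition tensor_relations ::
  "('f::field, 'v) module \<Rightarrow> ('f, 'w) module \<Rightarrow> ('v \<times> 'w \<Rightarrow>\<^sub>0 'f) set" where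
  "tensor_relations V W = free_span (
    {Poly_Mapping.single (x \<oplus>\<^bsub>V\<^esub> y, w) 1 - Poly_Mapping.single (x, w) 1 - Poly_Mapping.single (y, w) 1
      | x y w. x \<in> carrier V \<and> y \<in> carrier V \<and> w \<in> carrier W} \<union>
    {Poly_Mapping.single (v, x \<oplus>\<^bsub>W\<^esub> y) 1 - Poly_Mapping.single (v, x) 1 - Poly_Mapping.single (v, y) 1
      | v x y. v \<in> carrier V \<and> x \<in> carrier W \<and> y \<in> carrier W} \<union>
    {Poly_Mapping.single (c \<odot>\<^bsub>V\<^esub> v, w) 1 - Poly_Mapping.single (v, w) c
      | c v w. v \<in> carrier V \<and> w \<in> carrier W} \<union>
    {Poly_Mapping.single (v, c \<odot>\<^bsub>W\<^esub> w) 1 - Poly_Mapping.single (v, w) c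
      | c v w. v \<in> carrier V \<and> w \<in> carrier W})"

definition tensor_space ::
  "('f::field, 'v) module \<Rightarrow> ('f, 'w) module \<Rightarrow> ('f, ('v \<times> 'w \<Rightarrow>\<^sub>0 'f) set) module" where
  "tensor_space V W =
    quotient_space free_scale {p. Poly_Mapping.keys p \<subseteq> carrier V \<times> carrier W} (tensor_relations V W)"

definition pure_tensor ::
  "('f::field, 'v) module \<Rightarrow> ('f, 'w) module \<Rightarrow> 'v \<Rightarrow> 'w \<Rightarrow> ('v \<times> 'w \<Rightarrow>\<^sub>0 'f) set" where
  "pure_tensor V W v w = vcoset (tensor_relations V W) (Poly_Mapping.single (v, w) 1)"

text \<open>
  \<open>\<Lambda>\<^sup>k(V)\<close> is the free vector space on the lists of \<open>k\<close> vectors of \<open>V\<close>, the list \<open>[v\<^sub>1, \<dots>, v\<^sub>k]\<close> standing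
  for \<open>v\<^sub>1 \<and> \<dots> \<and> v\<^sub>k\<close>, modulo multilinearity and the vanishing of lists with a repeated entry.
\<close>

definition ext_lists :: "nat \<Rightarrow> ('f, 'v) module \<Rightarrow> 'v list set" where
  "ext_lists k V = {xs. length xs = k \<and> set xs \<subseteq> carrier V}"

definition ext_relations :: "nat \<Rightarrow> ('f::field, 'v) module \<Rightarrow> ('v list \<Rightarrow>\<^sub>0 'f) set" where
  "ext_relations k V = free_span (
    {Poly_Mapping.single (xs[i := x \<oplus>\<^bsub>V\<^esub> y]) 1
        - Poly_Mapping.single (xs[i := x]) 1 - Poly_Mapping.single (xs[i := y]) 1
      | xs i x y. xs \<in> ext_lists k V \<and> i < k \<and> x \<in> carrier V \<and> y \<in> carrier V} \<union>
    {Poly_Mapping.single (xs[i := c \<odot>\<^bsub>V\<^esub> x]) 1 - Poly_Mapping.single (xs[i := x]) c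
      | xs i c x. xs \<in> ext_lists k V \<and> i < k \<and> x \<in> carrier V} \<union>
    {Poly_Mapping.single xs 1
      | xs i j. xs \<in> ext_lists k V \<and> i < j \<and> j < k \<and> xs ! i = xs ! j})"

definition ext_power ::
  "nat \<Rightarrow> ('f::field, 'v) module \<Rightarrow> ('f, ('v list \<Rightarrow>\<^sub>0 'f) set) module" where
  "ext_power k V =
    quotient_space free_scale {p. Poly_Mapping.keys p \<subseteq> ext_lists k V} (ext_relations k V)"

text \<open>The map \<open>\<Lambda>\<^sup>k(V) \<rightarrow> \<Lambda>\<^sup>k(W)\<close> induced by a linear map \<open>f : V \<rightarrow> W\<close>.\<close>

definition ext_map ::
  "nat \<Rightarrow> ('f::field, 'w) module \<Rightarrow> ('v \<Rightarrow> 'w) \<Rightarrow> ('v list \<Rightarrow>\<^sub>0 'f) set \<Rightarrow> ('w list \<Rightarrow>\<^sub>0 'f) set" where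
  "ext_map k W f A = (\<Union>p\<in>A. vcoset (ext_relations k W)
    (\<Sum>xs\<in>Poly_Mapping.keys p. Poly_Mapping.single (map f xs) (Poly_Mapping.lookup p xs)))"

text \<open>The wedge product \<open>\<Lambda>\<^sup>j(V) \<times> \<Lambda>\<^sup>k(V) \<rightarrow> \<Lambda>\<^sup>j\<^sup>+\<^sup>k(V)\<close>.\<close>

definition ext_wedge ::
  "nat \<Rightarrow> nat \<Rightarrow> ('f::field, 'v) module \<Rightarrow>
    ('v list \<Rightarrow>\<^sub>0 'f) set \<Rightarrow> ('v list \<Rightarrow>\<^sub>0 'f) set \<Rightarrow> ('v list \<Rightarrow>\<^sub>0 'f) set" where
  "ext_wedge j k V A B = (\<Union>p\<in>A. \<Union>q\<in>B. vcoset (ext_relations (j + k) V)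
    (\<Sum>xs\<in>Poly_Mapping.keys p. \<Sum>ys\<in>Poly_Mapping.keys q.
      Poly_Mapping.single (xs @ ys) (Poly_Mapping.lookup p xs * Poly_Mapping.lookup q ys)))"

text \<open>The line \<open>|V|\<close> of a finite dimensional space, and the map on it induced by \<open>f : V \<rightarrow> W\<close>, which
  takes values in \<open>\<Lambda>\<^sup>n(W)\<close> for \<open>n = dim V\<close>.\<close>

definition det_line :: "('f::field, 'v) module \<Rightarrow> ('f, ('v list \<Rightarrow>\<^sub>0 'f) set) module" where
  "det_line V = ext_power (vs_dim V) V"

definition det_map ::
  "('f::field, 'v) module \<Rightarrow> ('f, 'w) module \<Rightarrow> ('v \<Rightarrow> 'w) \<Rightarrow>
    ('v list \<Rightarrow>\<^sub>0 'f) set \<Rightarrow> ('w list \<Rightarrow>\<^sub>0 'f) set" where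
  "det_map V W f = ext_map (vs_dim V) W f"


section \<open>Operators of determinant class\<close>

definition finite_rank ::
  "('f::field \<Rightarrow> 'w::ab_group_add \<Rightarrow> 'w) \<Rightarrow> ('v \<Rightarrow> 'w) \<Rightarrow> bool" where
  "finite_rank s f \<longleftrightarrow> (\<exists>B. finite B \<and> range f \<subseteq> Modules.module.span s B)"

definition determinant_class ::
  "('f::field \<Rightarrow> 'v::ab_group_add \<Rightarrow> 'v) \<Rightarrow> ('v \<Rightarrow> 'v) \<Rightarrow> bool" where
  "determinant_class s T \<longleftrightarrow>
    Vector_Spaces.linear s s T \<and> bij T \<and> finite_rank s (\<lambda>x. x - T x)"

text \<open>The matrix of \<open>T\<close> on the span of the list \<open>bs\<close> of independent vectors.\<close>

definition matrix_on ::
  "('f::field \<Rightarrow> 'v::ab_group_add \<Rightarrow> 'v) \<Rightarrow> 'v list \<Rightarrow> ('v \<Rightarrow> 'v) \<Rightarrow> 'f mat" where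
  "matrix_on s bs T = mat (length bs) (length bs)
    (\<lambda>(i, j). Modules.module.representation s (set bs) (T (bs ! j)) (bs ! i))"

text \<open>Here \<open>bs\<close> is a basis of a finite dimensional \<open>T\<close>-invariant \<open>E\<close> that contains \<open>Im (1 - T)\<close>; the
  value \<open>det (T|\<^sub>E)\<close> depends neither on \<open>E\<close> nor on \<open>bs\<close>.\<close>

definition op_det ::
  "('f::field \<Rightarrow> 'v::ab_group_add \<Rightarrow> 'v) \<Rightarrow> ('v \<Rightarrow> 'v) \<Rightarrow> 'f" where
  "op_det s T = (THE c. \<exists>bs. distinct bs \<and> \<not> Modules.module.dependent s (set bs) \<and>
    range (\<lambda>x. x - T x) \<subseteq> Modules.module.span s (set bs) \<and>
    T ` Modules.module.span s (set bs) \<subseteq> Modules.module.span s (set bs) \<and>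
    c = Determinant.det (matrix_on s bs T))"


section \<open>Graded complexes\<close>

record ('f, 'a, 'b) graded_space =
  scale_plus :: "'f \<Rightarrow> 'a \<Rightarrow> 'a"
  scale_minus :: "'f \<Rightarrow> 'b \<Rightarrow> 'b"

record ('a, 'b) differential =
  d_plus :: "'a \<Rightarrow> 'b"
  d_minus :: "'b \<Rightarrow> 'a"

text \<open>A candidate \<open>D\<^sup>\<dagger>\<close>: the field \<open>dag_plus\<close> is \<open>d\<^sub>+\<^sup>\<dagger> : X\<^sub>- \<rightarrow> X\<^sub>+\<close> and \<open>dag_minus\<close> is
  \<open>d\<^sub>-\<^sup>\<dagger> : X\<^sub>+ \<rightarrow> X\<^sub>-\<close>.\<close>

record ('a, 'b) dagger =
  dag_plus :: "'b \<Rightarrow> 'a"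
  dag_minus :: "'a \<Rightarrow> 'b"

definition is_graded_space ::
  "('f::field, 'a::ab_group_add, 'b::ab_group_add) graded_space \<Rightarrow> bool" where
  "is_graded_space X \<longleftrightarrow> vector_space (scale_plus X) \<and> vector_space (scale_minus X)"

definition is_complex ::
  "('f::field, 'a::ab_group_add, 'b::ab_group_add) graded_space \<Rightarrow> ('a, 'b) differential \<Rightarrow> bool" where
  "is_complex X d \<longleftrightarrow> is_graded_space X \<and>
    Vector_Spaces.linear (scale_plus X) (scale_minus X) (d_plus d) \<and>
    Vector_Spaces.linear (scale_minus X) (scale_plus X) (d_minus d) \<and>
    (\<forall>x. d_minus d (d_plus d x) = 0) \<and> (\<forall>y. d_plus d (d_minus d y) = 0)"

definition H_plus ::
  "('f::field, 'a::ab_group_add, 'b::ab_group_add) graded_space \<Rightarrow> ('a, 'b) differential \<Rightarrow>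
    ('f, 'a set) module" where
  "H_plus X d = quotient_space (scale_plus X) {x. d_plus d x = 0} (range (d_minus d))"

definition H_minus ::
  "('f::field, 'a::ab_group_add, 'b::ab_group_add) graded_space \<Rightarrow> ('a, 'b) differential \<Rightarrow>
    ('f, 'b set) module" where
  "H_minus X d = quotient_space (scale_minus X) {y. d_minus d y = 0} (range (d_plus d))"

definition is_fredholm ::
  "('f::field, 'a::ab_group_add, 'b::ab_group_add) graded_space \<Rightarrow> ('a, 'b) differential \<Rightarrow> bool" where
  "is_fredholm X d \<longleftrightarrow> vs_fin_dim (H_plus X d) \<and> vs_fin_dim (H_minus X d)"

definition fredholm_index ::
  "('f::field, 'a::ab_group_add, 'b::ab_group_add) graded_space \<Rightarrow> ('a, 'b) differential \<Rightarrow> int" where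
  "fredholm_index X d = int (vs_dim (H_plus X d)) - int (vs_dim (H_minus X d))"

type_synonym ('f, 'a, 'b) det_vector =
  "(('a set list \<Rightarrow>\<^sub>0 'f) set \<times> (('b set list \<Rightarrow>\<^sub>0 'f) set \<Rightarrow> 'f) \<Rightarrow>\<^sub>0 'f) set"

definition complex_line ::
  "('f::field, 'a::ab_group_add, 'b::ab_group_add) graded_space \<Rightarrow> ('a, 'b) differential \<Rightarrow>
    ('f, ('f, 'a, 'b) det_vector) module" where
  "complex_line X d = tensor_space (det_line (H_plus X d)) (dual_space (det_line (H_minus X d)))"


section \<open>Pseudo-inverses\<close>

definition is_pseudo_inverse ::
  "('f::field \<Rightarrow> 'v::ab_group_add \<Rightarrow> 'v) \<Rightarrow> ('f \<Rightarrow> 'w::ab_group_add \<Rightarrow> 'w) \<Rightarrow>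
    ('v \<Rightarrow> 'w) \<Rightarrow> ('w \<Rightarrow> 'v) \<Rightarrow> bool" where
  "is_pseudo_inverse s t A B \<longleftrightarrow> Vector_Spaces.linear t s B \<and>
    (\<forall>x. A (B (A x)) = A x) \<and> (\<forall>y. B (A (B y)) = B y)"

definition is_complex_pseudo_inverse ::
  "('f::field, 'a::ab_group_add, 'b::ab_group_add) graded_space \<Rightarrow> ('a, 'b) differential \<Rightarrow>
    ('a, 'b) dagger \<Rightarrow> bool" where
  "is_complex_pseudo_inverse X d dd \<longleftrightarrow>
    is_pseudo_inverse (scale_plus X) (scale_minus X) (d_plus d) (dag_plus dd) \<and>
    is_pseudo_inverse (scale_minus X) (scale_plus X) (d_minus d) (dag_minus dd) \<and>
    (\<forall>y. dag_minus dd (dag_plus dd y) = 0) \<and> (\<forall>x. dag_plus dd (dag_minus dd x) = 0)"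

text \<open>The operators \<open>\<sigma>\<^sub>\<plusminus>\<close>; the operators \<open>\<tau>\<^sub>\<plusminus>\<close> are the same ones for \<open>\<delta>\<close> and \<open>\<delta>\<^sup>\<dagger>\<close>.\<close>

definition sigma_plus ::
  "('a, 'b::ab_group_add) differential \<Rightarrow> ('a, 'b) dagger \<Rightarrow> 'a \<Rightarrow> 'b" where
  "sigma_plus d dd = (\<lambda>x. d_plus d x + dag_minus dd x)"

definition sigma_minus ::
  "('a::ab_group_add, 'b) differential \<Rightarrow> ('a, 'b) dagger \<Rightarrow> 'b \<Rightarrow> 'a" where
  "sigma_minus d dd = (\<lambda>y. d_minus d y + dag_plus dd y)"

definition finite_rank_perturbation_diff ::
  "('f::field, 'a::ab_group_add, 'b::ab_group_add) graded_space \<Rightarrow>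
    ('a, 'b) differential \<Rightarrow> ('a, 'b) differential \<Rightarrow> bool" where
  "finite_rank_perturbation_diff X d e \<longleftrightarrow>
    finite_rank (scale_minus X) (\<lambda>x. d_plus d x - d_plus e x) \<and>
    finite_rank (scale_plus X) (\<lambda>y. d_minus d y - d_minus e y)"

definition finite_rank_perturbation_dag ::
  "('f::field, 'a::ab_group_add, 'b::ab_group_add) graded_space \<Rightarrow>
    ('a, 'b) dagger \<Rightarrow> ('a, 'b) dagger \<Rightarrow> bool" where
  "finite_rank_perturbation_dag X dd ee \<longleftrightarrow>
    finite_rank (scale_plus X) (\<lambda>y. dag_plus dd y - dag_plus ee y) \<and>
    finite_rank (scale_minus X) (\<lambda>x. dag_minus dd x - dag_minus ee x)"


section \<open>Perturbation triples\<close>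

text \<open>
  The two kinds of triples \<open>(L, M, N)\<close>, for index \<open>\<le> 0\<close> and \<open>\<ge> 0\<close>; both are allowed for index \<open>0\<close>.
  The maps \<open>L\<close>, \<open>M\<close>, \<open>N\<close> have as domain the kernel of \<open>\<sigma>\<^sub>+\<close> or \<open>\<tau>\<^sub>-\<close>; their values elsewhere are arbitrary
  and never used.
\<close>

datatype ('a, 'b) triple =
    Triple_Nonpos "'a \<Rightarrow> 'b" "'b \<Rightarrow> 'a" "'b \<Rightarrow> 'b"
  | Triple_Nonneg "'a \<Rightarrow> 'b" "'b \<Rightarrow> 'a" "'a \<Rightarrow> 'a"

definition set_sum :: "'v::ab_group_add set \<Rightarrow> 'v set \<Rightarrow> 'v set" where
  "set_sum A B = {x + y |x y. x \<in> A \<and> y \<in> B}"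

text \<open>\<open>f\<close> vanishes on some complement of \<open>U\<close> in \<open>K\<close>.\<close>

definition vanishes_on_complement ::
  "('f::field \<Rightarrow> 'v::ab_group_add \<Rightarrow> 'v) \<Rightarrow> 'v set \<Rightarrow> 'v set \<Rightarrow> ('v \<Rightarrow> 'w::zero) \<Rightarrow> bool" where
  "vanishes_on_complement s K U f \<longleftrightarrow>
    (\<exists>C. Modules.module.subspace s C \<and> C \<inter> U = {0} \<and> set_sum C U = K \<and> (\<forall>x\<in>C. f x = 0))"

definition is_triple_nonpos ::
  "('f::field, 'a::ab_group_add, 'b::ab_group_add) graded_space \<Rightarrow>
    ('a, 'b) differential \<Rightarrow> ('a, 'b) dagger \<Rightarrow> ('a, 'b) differential \<Rightarrow> ('a, 'b) dagger \<Rightarrow>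
    ('a \<Rightarrow> 'b) \<Rightarrow> ('b \<Rightarrow> 'a) \<Rightarrow> ('b \<Rightarrow> 'b) \<Rightarrow> bool" where
  "is_triple_nonpos X d dd e ee L M N \<longleftrightarrow>
    (let \<sigma> = sigma_plus d dd; \<tau> = sigma_minus e ee;
         kers = {x. \<sigma> x = 0}; kert = {y. \<tau> y = 0}; kerM = {t \<in> kert. M t = 0};
         W = set_sum (range \<sigma>) (L ` kers)
     in L \<in> vs_hom (ker_space (scale_plus X) \<sigma>) (space_on (scale_minus X) UNIV) \<and>
        inj_on (\<lambda>x. vcoset (range \<sigma>) (L x)) kers \<and>
        M \<in> vs_hom (ker_space (scale_minus X) \<tau>) (space_on (scale_plus X) UNIV) \<and>
        (\<lambda>t. vcoset (range \<tau>) (M t)) ` kert = carrier (coker_space (scale_plus X) \<tau>) \<and>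
        M ` kert \<inter> range \<tau> = {0} \<and>
        N \<in> vs_hom (ker_space (scale_minus X) \<tau>) (space_on (scale_minus X) UNIV) \<and>
        bij_betw (\<lambda>t. vcoset W (N t)) kerM (carrier (quotient_space (scale_minus X) UNIV W)) \<and>
        vanishes_on_complement (scale_minus X) kert kerM N)"

definition is_triple_nonneg ::
  "('f::field, 'a::ab_group_add, 'b::ab_group_add) graded_space \<Rightarrow>
    ('a, 'b) differential \<Rightarrow> ('a, 'b) dagger \<Rightarrow> ('a, 'b) differential \<Rightarrow> ('a, 'b) dagger \<Rightarrow>
    ('a \<Rightarrow> 'b) \<Rightarrow> ('b \<Rightarrow> 'a) \<Rightarrow> ('a \<Rightarrow> 'a) \<Rightarrow> bool" where
  "is_triple_nonneg X d dd e ee L M N \<longleftrightarrow>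
    (let \<sigma> = sigma_plus d dd; \<tau> = sigma_minus e ee;
         kers = {x. \<sigma> x = 0}; kert = {y. \<tau> y = 0}; kerL = {x \<in> kers. L x = 0};
         W = set_sum (M ` kert) (range \<tau>)
     in L \<in> vs_hom (ker_space (scale_plus X) \<sigma>) (space_on (scale_minus X) UNIV) \<and>
        (\<lambda>x. vcoset (range \<sigma>) (L x)) ` kers = carrier (coker_space (scale_minus X) \<sigma>) \<and>
        L ` kers \<inter> range \<sigma> = {0} \<and>
        M \<in> vs_hom (ker_space (scale_minus X) \<tau>) (space_on (scale_plus X) UNIV) \<and>
        inj_on (\<lambda>t. vcoset (range \<tau>) (M t)) kert \<and>
        N \<in> vs_hom (ker_space (scale_plus X) \<sigma>) (space_on (scale_plus X) UNIV) \<and>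
        bij_betw (\<lambda>x. vcoset W (N x)) kerL (carrier (quotient_space (scale_plus X) UNIV W)) \<and>
        vanishes_on_complement (scale_plus X) kers kerL N)"

definition is_triple ::
  "('f::field, 'a::ab_group_add, 'b::ab_group_add) graded_space \<Rightarrow>
    ('a, 'b) differential \<Rightarrow> ('a, 'b) dagger \<Rightarrow> ('a, 'b) differential \<Rightarrow> ('a, 'b) dagger \<Rightarrow>
    ('a, 'b) triple \<Rightarrow> bool" where
  "is_triple X d dd e ee T = (case T of
      Triple_Nonpos L M N \<Rightarrow> fredholm_index X d \<le> 0 \<and> is_triple_nonpos X d dd e ee L M N
    | Triple_Nonneg L M N \<Rightarrow> fredholm_index X d \<ge> 0 \<and> is_triple_nonneg X d dd e ee L M N)"

definition is_perturbation_choice ::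
  "('f::field, 'a::ab_group_add, 'b::ab_group_add) graded_space \<Rightarrow>
    ('a, 'b) differential \<Rightarrow> ('a, 'b) differential \<Rightarrow> ('a, 'b) dagger \<Rightarrow> ('a, 'b) dagger \<Rightarrow>
    ('a, 'b) triple \<Rightarrow> bool" where
  "is_perturbation_choice X d e dd ee T \<longleftrightarrow>
    is_complex_pseudo_inverse X d dd \<and> is_complex_pseudo_inverse X e ee \<and>
    finite_rank_perturbation_dag X dd ee \<and> is_triple X d dd e ee T"


section \<open>The perturbation isomorphism\<close>

text \<open>The map of quotients \<open>x + U \<mapsto> x + W\<close> for \<open>U \<subseteq> W\<close>.\<close>

definition coset_map :: "'v::ab_group_add set \<Rightarrow> 'v set \<Rightarrow> 'v set" where
  "coset_map W A = (\<Union>x\<in>A. vcoset W x)"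

text \<open>
  The vector \<open>s \<otimes> v\<^sup>*\<close> of \<open>|D|\<close> for \<open>s \<in> |ker \<sigma>\<^sub>+|\<close> and \<open>v \<in> |Coker \<sigma>\<^sub>+|\<close>.  The isomorphisms
  \<open>ker \<sigma>\<^sub>+ \<rightarrow> H\<^sub>+(D)\<close> and \<open>H\<^sub>-(D) \<rightarrow> Coker \<sigma>\<^sub>+\<close> are induced by the identity, and \<open>v\<^sup>*\<close> is pulled back
  along the second one.
\<close>

definition source_vector ::
  "('f::field, 'a::ab_group_add, 'b::ab_group_add) graded_space \<Rightarrow>
    ('a, 'b) differential \<Rightarrow> ('a, 'b) dagger \<Rightarrow>
    ('a list \<Rightarrow>\<^sub>0 'f) set \<Rightarrow> ('b set list \<Rightarrow>\<^sub>0 'f) set \<Rightarrow> ('f, 'a, 'b) det_vector" where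
  "source_vector X d dd s v =
    (let \<sigma> = sigma_plus d dd; K = ker_space (scale_plus X) \<sigma>; C = coker_space (scale_minus X) \<sigma>
     in pure_tensor (det_line (H_plus X d)) (dual_space (det_line (H_minus X d)))
          (det_map K (H_plus X d) (vcoset (range (d_minus d))) s)
          (\<lambda>y\<in>carrier (det_line (H_minus X d)).
             dual_vector (det_line C) v (det_map (H_minus X d) C (coset_map (range \<sigma>)) y)))"

text \<open>
  The vector \<open>v \<otimes> t\<^sup>*\<close> of \<open>|\<Delta>|\<close> for \<open>v \<in> |Coker \<tau>\<^sub>-|\<close> and \<open>t \<in> |ker \<tau>\<^sub>-|\<close>, using the isomorphisms
  \<open>H\<^sub>+(\<Delta>) \<rightarrow> Coker \<tau>\<^sub>-\<close> and \<open>ker \<tau>\<^sub>- \<rightarrow> H\<^sub>-(\<Delta>)\<close>.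
\<close>

definition target_vector ::
  "('f::field, 'a::ab_group_add, 'b::ab_group_add) graded_space \<Rightarrow>
    ('a, 'b) differential \<Rightarrow> ('a, 'b) dagger \<Rightarrow>
    ('a set list \<Rightarrow>\<^sub>0 'f) set \<Rightarrow> ('b list \<Rightarrow>\<^sub>0 'f) set \<Rightarrow> ('f, 'a, 'b) det_vector" where
  "target_vector X e ee v t =
    (let \<tau> = sigma_minus e ee; K = ker_space (scale_minus X) \<tau>; C = coker_space (scale_plus X) \<tau>
     in pure_tensor (det_line (H_plus X e)) (dual_space (det_line (H_minus X e)))
          (inv_into (carrier (det_line (H_plus X e)))
             (det_map (H_plus X e) C (coset_map (range \<tau>))) v)
          (dual_vector (det_line (H_minus X e))
             (det_map K (H_minus X e) (vcoset (range (d_plus e))) t)))"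

definition formula_nonpos ::
  "('f::field, 'a::ab_group_add, 'b::ab_group_add) graded_space \<Rightarrow>
    ('a, 'b) differential \<Rightarrow> ('a, 'b) dagger \<Rightarrow> ('a, 'b) differential \<Rightarrow> ('a, 'b) dagger \<Rightarrow>
    ('a \<Rightarrow> 'b) \<Rightarrow> ('b \<Rightarrow> 'a) \<Rightarrow> ('b \<Rightarrow> 'b) \<Rightarrow>
    (('f, 'a, 'b) det_vector \<Rightarrow> ('f, 'a, 'b) det_vector) \<Rightarrow> bool" where
  "formula_nonpos X d dd e ee L M N P \<longleftrightarrow>
    (let \<sigma> = sigma_plus d dd; \<tau> = sigma_minus e ee;
         Pp = (\<lambda>x. x - sigma_minus d dd (\<sigma> x));
         Qm = (\<lambda>y. y - sigma_plus e ee (\<tau> y));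
         \<Sigma> = (\<lambda>y. let z = \<tau> y + M (Qm y) in \<sigma> z + L (Pp z) + N (Qm y));
         kers = ker_space (scale_plus X) \<sigma>; cokers = coker_space (scale_minus X) \<sigma>;
         kert = ker_space (scale_minus X) \<tau>; cokert = coker_space (scale_plus X) \<tau>;
         kerM = space_on (scale_minus X) {t \<in> carrier kert. M t = 0};
         kerN = space_on (scale_minus X) {t \<in> carrier kert. N t = 0}
     in determinant_class (scale_minus X) \<Sigma> \<and>
        (\<forall>s \<in> nonzero (det_line kers). \<forall>t1 \<in> nonzero (det_line kerM). \<forall>t0 \<in> nonzero (det_line kerN).
           P (source_vector X d dd s
                (ext_wedge (vs_dim kers) (vs_dim kerM) cokers
                   (det_map kers cokers (\<lambda>x. vcoset (range \<sigma>) (L x)) s)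
                   (det_map kerM cokers (\<lambda>t. vcoset (range \<sigma>) (N t)) t1)))
           = inverse (op_det (scale_minus X) \<Sigma>) \<odot>\<^bsub>complex_line X e\<^esub>
             target_vector X e ee
               (det_map kerN cokert (\<lambda>t. vcoset (range \<tau>) (M t)) t0)
               (ext_wedge (vs_dim kerN) (vs_dim kerM) kert
                  (det_map kerN kert id t0) (det_map kerM kert id t1))))"

definition formula_nonneg ::
  "('f::field, 'a::ab_group_add, 'b::ab_group_add) graded_space \<Rightarrow>
    ('a, 'b) differential \<Rightarrow> ('a, 'b) dagger \<Rightarrow> ('a, 'b) differential \<Rightarrow> ('a, 'b) dagger \<Rightarrow>
    ('a \<Rightarrow> 'b) \<Rightarrow> ('b \<Rightarrow> 'a) \<Rightarrow> ('a \<Rightarrow> 'a) \<Rightarrow>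
    (('f, 'a, 'b) det_vector \<Rightarrow> ('f, 'a, 'b) det_vector) \<Rightarrow> bool" where
  "formula_nonneg X d dd e ee L M N P \<longleftrightarrow>
    (let \<sigma> = sigma_plus d dd; \<tau> = sigma_minus e ee;
         Pp = (\<lambda>x. x - sigma_minus d dd (\<sigma> x));
         Qm = (\<lambda>y. y - sigma_plus e ee (\<tau> y));
         \<Sigma> = (\<lambda>x. let z = \<sigma> x + L (Pp x) in \<tau> z + M (Qm z) + N (Pp x));
         kers = ker_space (scale_plus X) \<sigma>; cokers = coker_space (scale_minus X) \<sigma>;
         kert = ker_space (scale_minus X) \<tau>; cokert = coker_space (scale_plus X) \<tau>;
         kerL = space_on (scale_plus X) {x \<in> carrier kers. L x = 0};
         kerN = space_on (scale_plus X) {x \<in> carrier kers. N x = 0}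
     in determinant_class (scale_plus X) \<Sigma> \<and>
        (\<forall>s0 \<in> nonzero (det_line kerL). \<forall>s1 \<in> nonzero (det_line kerN). \<forall>t \<in> nonzero (det_line kert).
           P (source_vector X d dd
                (ext_wedge (vs_dim kerL) (vs_dim kerN) kers
                   (det_map kerL kers id s0) (det_map kerN kers id s1))
                (det_map kerN cokers (\<lambda>x. vcoset (range \<sigma>) (L x)) s1))
           = inverse (op_det (scale_plus X) \<Sigma>) \<odot>\<^bsub>complex_line X e\<^esub>
             target_vector X e ee
               (ext_wedge (vs_dim kerL) (vs_dim kert) cokert
                  (det_map kerL cokert (\<lambda>x. vcoset (range \<tau>) (N x)) s0)
                  (det_map kert cokert (\<lambda>y. vcoset (range \<tau>) (M y)) t))
               t))"

text \<open>Extensionality on \<open>|D|\<close> makes equality of two such \<open>P\<close> mean equality of maps \<open>|D| \<rightarrow> |\<Delta>|\<close>.\<close>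

definition is_perturbation_iso ::
  "('f::field, 'a::ab_group_add, 'b::ab_group_add) graded_space \<Rightarrow>
    ('a, 'b) differential \<Rightarrow> ('a, 'b) differential \<Rightarrow> ('a, 'b) dagger \<Rightarrow> ('a, 'b) dagger \<Rightarrow>
    ('a, 'b) triple \<Rightarrow> (('f, 'a, 'b) det_vector \<Rightarrow> ('f, 'a, 'b) det_vector) \<Rightarrow> bool" where
  "is_perturbation_iso X d e dd ee T P \<longleftrightarrow>
    P \<in> vs_hom (complex_line X d) (complex_line X e) \<and>
    P \<in> extensional (carrier (complex_line X d)) \<and>
    bij_betw P (carrier (complex_line X d)) (carrier (complex_line X e)) \<and>
    (case T of
       Triple_Nonpos L M N \<Rightarrow> formula_nonpos X d dd e ee L M N P
     | Triple_Nonneg L M N \<Rightarrow> formula_nonneg X d dd e ee L M N P)"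

definition perturbation_iso ::
  "('f::field, 'a::ab_group_add, 'b::ab_group_add) graded_space \<Rightarrow>
    ('a, 'b) differential \<Rightarrow> ('a, 'b) differential \<Rightarrow> ('a, 'b) dagger \<Rightarrow> ('a, 'b) dagger \<Rightarrow>
    ('a, 'b) triple \<Rightarrow> (('f, 'a, 'b) det_vector \<Rightarrow> ('f, 'a, 'b) det_vector)" where
  "perturbation_iso X d e dd ee T = (THE P. is_perturbation_iso X d e dd ee T P)"

end

theory Submission
  imports Defs
begin

text \<open>
  In bases, \<open>P(\<Delta>, D)\<close> is multiplication by a scalar \<open>\<kappa>\<close>: a quotient of determinants of base changes
  divided by \<open>det \<Sigma>\<close>.  Write \<open>A = \<sigma>\<^sub>+ + L P\<^sub>+\<close> and \<open>B = \<tau>\<^sub>- + M Q\<^sub>-\<close>, so that \<open>\<Sigma> = A B + N Q\<^sub>-\<close> in index \<open>\<le> 0\<close>.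

  Fix the pseudo-inverses and take two triples.  Let \<open>T, R, H, S\<close> be the operators that fix the images of
  \<open>\<sigma>\<^sub>+, \<tau>\<^sub>-, \<sigma>\<^sub>-, \<tau>\<^sub>+\<close> and move the complementary bases given by one triple to those given by the other
  one.  Then \<open>\<Sigma>\<^sub>2 = T (A\<^sub>1 H R B\<^sub>1 + N\<^sub>1 Q\<^sub>-) S\<close>, inserting \<open>H R\<close> multiplies \<open>det \<Sigma>\<^sub>1\<close> by \<open>det (H R)\<close>, and all the
  determinants cancel in \<open>\<kappa>\<close>.

  A change of the pseudo-inverses of \<open>D\<close> is realised by isomorphisms \<open>V\<close> of \<open>X\<^sub>\<plusminus>\<close>, one for \<open>\<Delta>\<close> by isomorphisms
  \<open>W\<close>; they transport triples and change \<open>det \<Sigma>\<close> by determinants of \<open>V\<^sup>-\<^sup>1 W\<close>.  Neither \<open>V\<close> nor \<open>W\<close> is of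
  determinant class in general, but both are unipotent and \<open>V - W\<close> has finite rank, whence
  \<open>det (V\<^sup>-\<^sup>1 W) = 1\<close>.

  Index \<open>\<ge> 0\<close> is index \<open>\<le> 0\<close> with parities and complexes exchanged, up to signs that depend only on
  dimensions.  In index \<open>0\<close> the two cases meet in the triples \<open>(L, M, 0)\<close>, as \<open>det (A B) = det (B A)\<close>.
\<close>

section \<open>Bases modulo a subspace and relative determinants\<close>

text \<open>The spaces and the images of the operators can be infinite dimensional, so each
  determinant is taken on a finite dimensional quotient \<open>K/U\<close>. An operator that fixes
  \<open>U\<close> pointwise has the same determinant on the whole space as on the quotient by
  \<open>U\<close>; this turns a base change in a cokernel into an operator that can be composed
  with \<Sigma>.

  The bases against which \<kappa> is computed represent the cohomology and are chosen before any
  pseudo-inverse. They are also bases of the cokernels of all four operators, whatever the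
  pseudo-inverses, and kernels are measured in the same quotients. V and W act trivially on
  cohomology, so these measurements survive a change of the pseudo-inverses, and only
  \<open>det \<Sigma>\<close> has to be followed.

  V is a fixed polynomial in the differentials and the pseudo-inverses of D, and W is the same
  polynomial for \<Delta>; this is why V - W has finite rank. In nonzero index A and B are not
  invertible, so an operator inserted between them cannot be moved out by conjugation. A left
  inverse of A, built from B and the inverse of \<Sigma>, takes over this task.\<close>

text \<open>Renaming the locale keeps the global interpretation of \<^locale>\<open>vector_space\<close> for real vector
  spaces from capturing the names below.\<close>

locale vsp = vector_space scale
  for scale :: "'a::field \<Rightarrow> 'b::ab_group_add \<Rightarrow> 'b"
begin

text \<open>Coefficients belong to positions of the list and not to vectors, which keeps the order
  that determinants depend on and allows repeated entries.\<close>

definition lcomb :: "'b list \<Rightarrow> (nat \<Rightarrow> 'a) \<Rightarrow> 'b" where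
  "lcomb bs c = (\<Sum>i<length bs. scale (c i) (bs ! i))"

text \<open>A basis of the quotient \<open>K/U\<close>, given by representatives. Kernels have
  \<open>U = {0}\<close>, cokernels have \<open>K = UNIV\<close>, cohomology lies between the two;
  \<open>U\<close> and \<open>K\<close> themselves may be infinite dimensional.\<close>

definition basis_mod :: "'b set \<Rightarrow> 'b set \<Rightarrow> 'b list \<Rightarrow> bool" where
  "basis_mod U K bs \<longleftrightarrow> subspace U \<and> subspace K \<and> U \<subseteq> K \<and> set bs \<subseteq> K \<and>
    (\<forall>x\<in>K. \<exists>c. x - lcomb bs c \<in> U) \<and>
    (\<forall>c. lcomb bs c \<in> U \<longrightarrow> (\<forall>i<length bs. c i = 0))"

text \<open>The choice is determined only at the positions of \<open>bs\<close>, hence the bound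
  \<open>i < length bs\<close> in the facts below.\<close>

definition coord :: "'b set \<Rightarrow> 'b list \<Rightarrow> 'b \<Rightarrow> nat \<Rightarrow> 'a" where
  "coord U bs x = (SOME c. x - lcomb bs c \<in> U)"

text \<open>For a basis \<open>ys\<close> of \<open>K/U\<close> this is the determinant of a base
  change, for \<open>ys = map T bs\<close> that of the endomorphism of \<open>K/U\<close> induced by
  \<open>T\<close>.\<close>

definition reldet :: "'b set \<Rightarrow> 'b list \<Rightarrow> 'b list \<Rightarrow> 'a" where
  "reldet U bs ys =
    Determinant.det (mat (length bs) (length bs) (\<lambda>(i, j). coord U bs (ys ! j) i))"

lemma lcomb_Nil [simp]: "lcomb [] c = 0"
  by (simp add: lcomb_def)

lemma lcomb_add: "lcomb bs (\<lambda>i. c i + d i) = lcomb bs c + lcomb bs d"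
  by (simp add: lcomb_def scale_left_distrib sum.distrib)

lemma lcomb_diff: "lcomb bs (\<lambda>i. c i - d i) = lcomb bs c - lcomb bs d"
  by (simp add: lcomb_def scale_left_diff_distrib sum_subtractf)

lemma lcomb_scale: "lcomb bs (\<lambda>i. a * c i) = scale a (lcomb bs c)"
  by (simp add: lcomb_def scale_sum_right)

lemma lcomb_0 [simp]: "lcomb bs (\<lambda>i. 0) = 0"
  by (simp add: lcomb_def)

lemma lcomb_sum: "lcomb bs (\<lambda>i. \<Sum>k\<in>A. f k i) = (\<Sum>k\<in>A. lcomb bs (f k))"
  by (induction A rule: infinite_finite_induct) (simp_all add: lcomb_add)

lemma lcomb_cong: "(\<And>i. i < length bs \<Longrightarrow> c i = d i) \<Longrightarrow> lcomb bs c = lcomb bs d"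
  by (simp add: lcomb_def)

lemma lcomb_unit: "i < length bs \<Longrightarrow> lcomb bs (\<lambda>k. if k = i then 1 else 0) = bs ! i"
  by (simp add: lcomb_def if_distrib[of "\<lambda>c. scale c _"] cong: if_cong)

lemma lcomb_append: "lcomb (as @ bs) c = lcomb as c + lcomb bs (\<lambda>i. c (length as + i))"
proof -
  have "{..<length as + length bs} = {..<length as} \<union> {length as..<length as + length bs}" by auto
  then have "lcomb (as @ bs) c = lcomb as c +
      (\<Sum>i\<in>{length as..<length as + length bs}. scale (c i) ((as @ bs) ! i))"
    by (simp add: lcomb_def sum.union_disjoint ivl_disj_int nth_append)
  also have "(\<Sum>i\<in>{length as..<length as + length bs}. scale (c i) ((as @ bs) ! i))
      = lcomb bs (\<lambda>i. c (length as + i))"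
    unfolding lcomb_def
    by (rule sum.reindex_bij_witness[of _ "\<lambda>i. length as + i" "\<lambda>i. i - length as"]) (auto simp: nth_append)
  finally show ?thesis .
qed

lemma lcomb_append_split:
  "lcomb as c + lcomb bs d = lcomb (as @ bs) (\<lambda>i. if i < length as then c i else d (i - length as))"
  unfolding lcomb_append by (intro arg_cong2[of _ _ _ _ "(+)"] lcomb_cong) auto

lemma lcomb_in: "subspace K \<Longrightarrow> set bs \<subseteq> K \<Longrightarrow> lcomb bs c \<in> K"
  unfolding lcomb_def by (intro subspace_sum subspace_scale) auto

lemma span_set_lcomb: "x \<in> span (set bs) \<Longrightarrow> \<exists>c. x = lcomb bs c"
proof (induction rule: span_induct_alt)
  case base
  show ?case by (rule exI[of _ "\<lambda>i. 0"]) simp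
next
  case (step a x y)
  then obtain c i where c: "y = lcomb bs c" and i: "i < length bs" "bs ! i = x"
    by (auto simp: in_set_conv_nth)
  have "scale a x + y = lcomb bs (\<lambda>k. a * (if k = i then 1 else 0) + c k)"
    using i c by (simp only: lcomb_add lcomb_scale lcomb_unit)
  then show ?case by blast
qed

lemma lcomb_in_span: "lcomb bs c \<in> span (set bs)"
  by (rule lcomb_in) (auto simp: span_base)

lemma basis_modI:
  assumes "subspace U" "subspace K" "U \<subseteq> K" "set bs \<subseteq> K"
    and "\<And>x. x \<in> K \<Longrightarrow> \<exists>c. x - lcomb bs c \<in> U"
    and "\<And>c i. lcomb bs c \<in> U \<Longrightarrow> i < length bs \<Longrightarrow> c i = 0"
  shows "basis_mod U K bs"
  using assms unfolding basis_mod_def by blast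

lemma basis_modD:
  assumes "basis_mod U K bs"
  shows "subspace U" "subspace K" "U \<subseteq> K" "set bs \<subseteq> K"
    and "\<And>x. x \<in> K \<Longrightarrow> \<exists>c. x - lcomb bs c \<in> U"
    and "\<And>c i. lcomb bs c \<in> U \<Longrightarrow> i < length bs \<Longrightarrow> c i = 0"
  using assms unfolding basis_mod_def by blast+

lemma coord_diff_in:
  assumes "basis_mod U K bs" "x \<in> K"
  shows "x - lcomb bs (coord U bs x) \<in> U"
  unfolding coord_def using basis_modD(5)[OF assms] by (rule someI_ex)

lemma coord_eqI:
  assumes b: "basis_mod U K bs" and c: "x - lcomb bs c \<in> U" and i: "i < length bs"
  shows "coord U bs x i = c i"
proof -
  have "x - lcomb bs (coord U bs x) \<in> U"
    unfolding coord_def by (rule someI[of _ c]) (rule c)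
  then have "(x - lcomb bs c) - (x - lcomb bs (coord U bs x)) \<in> U"
    using subspace_diff[OF basis_modD(1)[OF b]] c by blast
  then have "lcomb bs (\<lambda>i. coord U bs x i - c i) \<in> U"
    by (simp add: lcomb_diff algebra_simps)
  then show ?thesis using basis_modD(6)[OF b _ i] by fastforce
qed

lemma coord_add:
  assumes b: "basis_mod U K bs" and "x \<in> K" "y \<in> K" and i: "i < length bs"
  shows "coord U bs (x + y) i = coord U bs x i + coord U bs y i"
proof (rule coord_eqI[OF b _ i])
  have "(x - lcomb bs (coord U bs x)) + (y - lcomb bs (coord U bs y)) \<in> U"
    using subspace_add[OF basis_modD(1)[OF b]] coord_diff_in[OF b] assms(2,3) by blast
  then show "x + y - lcomb bs (\<lambda>i. coord U bs x i + coord U bs y i) \<in> U"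
    by (simp add: lcomb_add algebra_simps)
qed

lemma coord_scale:
  assumes b: "basis_mod U K bs" and "x \<in> K" and i: "i < length bs"
  shows "coord U bs (scale a x) i = a * coord U bs x i"
proof (rule coord_eqI[OF b _ i])
  have "scale a (x - lcomb bs (coord U bs x)) \<in> U"
    using subspace_scale[OF basis_modD(1)[OF b]] coord_diff_in[OF b] assms(2) by blast
  then show "scale a x - lcomb bs (\<lambda>i. a * coord U bs x i) \<in> U"
    by (simp add: lcomb_scale scale_right_diff_distrib)
qed

lemma coord_sub:
  assumes b: "basis_mod U K bs" and "x \<in> U" and i: "i < length bs"
  shows "coord U bs x i = 0"
  by (rule coord_eqI[OF b _ i]) (use assms in simp)

lemma coord_nth:
  assumes b: "basis_mod U K bs" and j: "j < length bs" and i: "i < length bs"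
  shows "coord U bs (bs ! j) i = (if i = j then 1 else 0)"
  by (rule coord_eqI[OF b _ i]) (use lcomb_unit[OF j] subspace_0[OF basis_modD(1)[OF b]] in simp)

lemma coord_cong_mod:
  assumes b: "basis_mod U K bs" and "x - y \<in> U" "y \<in> K" and i: "i < length bs"
  shows "coord U bs x i = coord U bs y i"
proof (rule coord_eqI[OF b _ i])
  have "(x - y) + (y - lcomb bs (coord U bs y)) \<in> U"
    using subspace_add[OF basis_modD(1)[OF b]] coord_diff_in[OF b] assms(2,3) by blast
  then show "x - lcomb bs (coord U bs y) \<in> U" by simp
qed

lemma reldet_cong:
  assumes "\<And>i j. i < length bs \<Longrightarrow> j < length bs \<Longrightarrow> coord U bs (ys ! j) i = coord U' bs' (zs ! j) i"
    and "length bs = length bs'"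
  shows "reldet U bs ys = reldet U' bs' zs"
  unfolding reldet_def assms(2)[symmetric]
  by (intro arg_cong[of _ _ Determinant.det] eq_matI) (auto simp: assms(1))

lemma reldet_cong_mod:
  assumes b: "basis_mod U K bs" and l: "length ys = length bs" "length zs = length bs"
    and "set zs \<subseteq> K" "\<And>j. j < length bs \<Longrightarrow> ys ! j - zs ! j \<in> U"
  shows "reldet U bs ys = reldet U bs zs"
  by (rule reldet_cong) (use assms coord_cong_mod[OF b] in \<open>auto simp: subset_eq\<close>)

lemma reldet_self [simp]:
  assumes "basis_mod U K bs"
  shows "reldet U bs bs = 1"
proof -
  have "mat (length bs) (length bs) (\<lambda>(i, j). coord U bs (bs ! j) i) = 1\<^sub>m (length bs)"
    by (rule eq_matI) (auto simp: coord_nth[OF assms])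
  then show ?thesis by (simp add: reldet_def)
qed

text \<open>The change of basis formula for coordinates, in the form in which it also covers the image of
  \<open>z\<close> under an endomorphism of \<open>K/U\<close> sending the basis \<open>bs\<close> to \<open>ys\<close>.\<close>

lemma coord_expand:
  assumes b: "basis_mod U K bs" and ys: "set ys \<subseteq> K" "length ys = m"
    and z: "z - lcomb ys c \<in> U" and i: "i < length bs"
  shows "coord U bs z i = (\<Sum>k<m. coord U bs (ys ! k) i * c k)"
proof (rule coord_eqI[OF b _ i])
  let ?s = "\<lambda>k. scale (c k) (ys ! k - lcomb bs (coord U bs (ys ! k)))"
  have "(\<Sum>k<m. ?s k) \<in> U"
    using ys coord_diff_in[OF b] basis_modD(1)[OF b]
    by (intro subspace_sum subspace_scale) (auto simp: subset_eq)
  moreover have "(\<Sum>k<m. ?s k) = lcomb ys c - lcomb bs (\<lambda>i. \<Sum>k<m. coord U bs (ys ! k) i * c k)"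
    unfolding lcomb_sum mult.commute[of "coord U bs _ _"] lcomb_scale
    by (simp add: lcomb_def[of ys] ys(2) scale_right_diff_distrib sum_subtractf)
  ultimately have "lcomb ys c - lcomb bs (\<lambda>i. \<Sum>k<m. coord U bs (ys ! k) i * c k) \<in> U"
    by (simp only:)
  from subspace_add[OF basis_modD(1)[OF b] z this] show "z - lcomb bs (\<lambda>i. \<Sum>k<m. coord U bs (ys ! k) i * c k) \<in> U" by simp
qed

section \<open>Change of basis and invariance of the dimension\<close>

lemma reldet_mult:
  assumes b: "basis_mod U K bs" and ys: "set ys \<subseteq> K" "length ys = length bs"
    and z: "\<And>j. j < length bs \<Longrightarrow> zs ! j - lcomb ys (\<lambda>k. C k j) \<in> U"
  shows "reldet U bs zs =
    reldet U bs ys * Determinant.det (mat (length bs) (length bs) (\<lambda>(i, j). C i j))"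
proof -
  let ?n = "length bs"
  have "mat ?n ?n (\<lambda>(i, j). coord U bs (zs ! j) i) =
      mat ?n ?n (\<lambda>(i, j). coord U bs (ys ! j) i) * mat ?n ?n (\<lambda>(i, j). C i j)"
    using coord_expand[OF b ys z]
    by (intro eq_matI) (auto simp: scalar_prod_def lessThan_atLeast0)
  then show ?thesis unfolding reldet_def by (simp add: det_mult[of _ ?n])
qed

lemma reldet_trans:
  assumes b: "basis_mod U K bs" and y: "basis_mod U K ys" "length ys = length bs"
    and z: "set zs \<subseteq> K" "length zs = length bs"
  shows "reldet U bs zs = reldet U bs ys * reldet U ys zs"
  unfolding reldet_def[of U ys] y(2)
  by (rule reldet_mult[OF b basis_modD(4)[OF y(1)] y(2)])
     (use z coord_diff_in[OF y(1)] in \<open>auto simp: subset_eq\<close>)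

lemma basis_mod_length_le:
  assumes b: "basis_mod U K bs" and y: "basis_mod U K ys"
  shows "length ys \<le> length bs"
proof (rule ccontr)
  assume "\<not> length ys \<le> length bs"
  then have lt: "length bs < length ys" by simp
  \<comment> \<open>Pad \<open>bs\<close> with zeros to a list of the length of \<open>ys\<close>: the last row of its coordinate matrix vanishes.\<close>
  let ?n = "length ys"
  let ?A = "mat ?n ?n (\<lambda>(i, k). if k < length bs then coord U ys (bs ! k) i else 0)"
  let ?B = "mat ?n ?n (\<lambda>(k, j). if k < length bs then coord U bs (ys ! j) k else 0)"
  have "?A * ?B = 1\<^sub>m ?n"
  proof (rule eq_matI)
    fix i j assume ij: "i < dim_row (1\<^sub>m ?n :: 'a mat)" "j < dim_col (1\<^sub>m ?n :: 'a mat)"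
    have "(?A * ?B) $$ (i, j) = (\<Sum>k<?n. if k < length bs then coord U ys (bs ! k) i * coord U bs (ys ! j) k else 0)"
      using ij by (auto simp: scalar_prod_def lessThan_atLeast0 intro!: sum.cong)
    also have "\<dots> = (\<Sum>k<length bs. coord U ys (bs ! k) i * coord U bs (ys ! j) k)"
      by (rule sum.mono_neutral_cong_right) (use lt in auto)
    also have "\<dots> = coord U ys (ys ! j) i"
      by (rule coord_expand[OF y basis_modD(4)[OF b] refl, symmetric])
         (use ij coord_diff_in[OF b] basis_modD(4)[OF y] in \<open>auto simp: subset_eq\<close>)
    also have "\<dots> = 1\<^sub>m ?n $$ (i, j)" using ij by (simp add: coord_nth[OF y])
    finally show "(?A * ?B) $$ (i, j) = 1\<^sub>m ?n $$ (i, j)" .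
  qed auto
  then have "Determinant.det (?A * ?B) = 1" by simp
  then have "Determinant.det ?A * Determinant.det ?B = 1"
    by (subst (asm) det_mult[of _ ?n]) auto
  moreover have "Determinant.det ?B = 0"
  proof -
    have "row ?B (length bs) = 0\<^sub>v ?n" using lt by (intro eq_vecI) auto
    then show ?thesis
    proof -
      \<comment> \<open>The row at position \<open>length bs\<close> is zero, hence unchanged by
        multiplication with 0; the determinant is then 0 times itself.\<close>
      have "?B = multrow (length bs) 0 ?B" using lt by (intro eq_matI) auto
      then have "Determinant.det ?B = 0 * Determinant.det ?B"
        using det_multrow[OF lt, of ?B 0] by (subst \<open>?B = _\<close>) simp
      then show ?thesis by simp
    qed
  qed
  ultimately show False by simp
qed

lemma basis_mod_length:
  "basis_mod U K bs \<Longrightarrow> basis_mod U K ys \<Longrightarrow> length ys = length bs"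
  using basis_mod_length_le by (simp add: le_antisym)

lemma reldet_inverse:
  assumes "basis_mod U K bs" "basis_mod U K ys"
  shows "reldet U bs ys * reldet U ys bs = 1"
  using reldet_trans[OF assms(1,2) basis_mod_length[OF assms] basis_modD(4)[OF assms(1)] refl]
    reldet_self[OF assms(1)] by simp

lemma reldet_nonzero:
  assumes "basis_mod U K bs" "basis_mod U K ys"
  shows "reldet U bs ys \<noteq> 0"
  using reldet_inverse[OF assms] by auto

text \<open>Bridge from the independent sets in the definition of \<open>op_det\<close> to the lists
  used in the computations; distinctness records what is lost in passing from a list to its
  set.\<close>

lemma basis_mod_zero_iff:
  "basis_mod {0} (span (set bs)) bs \<longleftrightarrow> distinct bs \<and> independent (set bs)" (is "?L = ?R")
proof
  assume b: ?L
  show ?R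
  proof
    show d: "distinct bs"
    proof (rule ccontr)
      assume "\<not> distinct bs"
      then obtain i j where ij: "i < length bs" "j < length bs" "i \<noteq> j" "bs ! i = bs ! j"
        by (auto simp: distinct_conv_nth)
      then show False using coord_nth[OF b ij(1,1)] coord_nth[OF b ij(2,1)] by simp
    qed
    show "independent (set bs)"
      unfolding independent_explicit_finite_subsets
    proof (intro allI impI ballI)
      fix A u v assume A: "A \<subseteq> set bs" "finite A" "(\<Sum>v\<in>A. scale (u v) v) = 0" and v: "v \<in> A"
      let ?c = "\<lambda>i. if bs ! i \<in> A then u (bs ! i) else 0"
      have "lcomb bs ?c = (\<Sum>i\<in>{..<length bs}. (\<lambda>v. if v \<in> A then scale (u v) v else 0) (bs ! i))"
        unfolding lcomb_def by (rule sum.cong) auto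
      also have "\<dots> = (\<Sum>v\<in>set bs. if v \<in> A then scale (u v) v else 0)"
        by (rule sum.reindex_bij_betw) (use d bij_betw_nth[OF d] in auto)
      also have "\<dots> = (\<Sum>v\<in>A. scale (u v) v)"
        by (rule sum.mono_neutral_cong_right) (use A in auto)
      finally have "lcomb bs ?c \<in> {0}" using A by simp
      moreover obtain i where "i < length bs" "bs ! i = v" using v A(1) by (auto simp: in_set_conv_nth subset_eq)
      ultimately show "u v = 0" using basis_modD(6)[OF b, of ?c i] v by auto
    qed
  qed
next
  assume r: ?R
  show ?L
  proof (rule basis_modI)
    fix x assume "x \<in> span (set bs)"
    then show "\<exists>c. x - lcomb bs c \<in> {0}" using span_set_lcomb by fastforce
  next
    fix c i assume c: "lcomb bs c \<in> {0}" and i: "i < length bs"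
    let ?u = "\<lambda>v. c (the_inv_into {..<length bs} ((!) bs) v)"
    have inj: "inj_on ((!) bs) {..<length bs}" using r by (simp add: inj_on_nth)
    have "(\<Sum>v\<in>set bs. scale (?u v) v) = (\<Sum>k\<in>{..<length bs}. scale (?u (bs ! k)) (bs ! k))"
      by (rule sum.reindex_bij_betw[symmetric]) (use r in \<open>auto intro: bij_betw_nth\<close>)
    also have "\<dots> = lcomb bs c"
      unfolding lcomb_def by (rule sum.cong) (use inj in \<open>auto simp: the_inv_into_f_f\<close>)
    finally have s: "(\<Sum>v\<in>set bs. scale (?u v) v) = 0" using c by simp
    have "?u (bs ! i) = 0"
      by (rule r[THEN conjunct2, unfolded independent_explicit_finite_subsets, rule_format, OF _ _ s])
         (use i in auto)
    then show "c i = 0" using inj i by (simp add: the_inv_into_f_f)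
  qed (auto simp: span_base span_zero)
qed

lemma basis_mod_zero_subset:
  assumes "basis_mod {0} K bs"
  shows "K = span (set bs)"
proof
  show "K \<subseteq> span (set bs)"
  proof
    fix x assume "x \<in> K"
    then obtain c where "x = lcomb bs c" using basis_modD(5)[OF assms] by fastforce
    then show "x \<in> span (set bs)" by (simp add: lcomb_in_span)
  qed
  show "span (set bs) \<subseteq> K" using span_minimal basis_modD[OF assms] by blast
qed

section \<open>Concatenated bases along a flag of subspaces\<close>

lemma basis_mod_Nil: "subspace U \<Longrightarrow> basis_mod U U []"
  by (rule basis_modI) auto

text \<open>The coefficients of \<open>bs\<close> are detected modulo \<open>U'\<close>; once these
  vanish, those of \<open>as\<close> are detected modulo \<open>U\<close>.\<close>

lemma basis_mod_append:
  assumes a: "basis_mod U U' as" and b: "basis_mod U' K bs"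
  shows "basis_mod U K (as @ bs)"
proof (rule basis_modI)
  note A = basis_modD[OF a] and B = basis_modD[OF b]
  show "subspace U" "subspace K" "U \<subseteq> K" "set (as @ bs) \<subseteq> K" using A B by auto
  show "\<exists>c. x - lcomb (as @ bs) c \<in> U" if x: "x \<in> K" for x
  proof -
    obtain d where d: "x - lcomb bs d \<in> U'" using B(5)[OF x] by blast
    then obtain c where "(x - lcomb bs d) - lcomb as c \<in> U" using A(5) by blast
    then have "x - (lcomb as c + lcomb bs d) \<in> U" by (simp add: algebra_simps)
    then show ?thesis unfolding lcomb_append_split by blast
  qed
  fix c i assume c: "lcomb (as @ bs) c \<in> U" and i: "i < length (as @ bs)"
  have "lcomb as c \<in> U'" using A by (simp add: lcomb_in)
  moreover have "lcomb as c + lcomb bs (\<lambda>i. c (length as + i)) \<in> U'"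
    using c A(3) by (auto simp: lcomb_append)
  ultimately have "lcomb bs (\<lambda>i. c (length as + i)) \<in> U'"
    using subspace_diff[OF B(1)] by fastforce
  then have 2: "\<And>i. i < length bs \<Longrightarrow> c (length as + i) = 0" using B(6) by blast
  then have "lcomb bs (\<lambda>i. c (length as + i)) = lcomb bs (\<lambda>i. 0)" by (intro lcomb_cong) auto
  then have "lcomb as c \<in> U" using c by (simp add: lcomb_append)
  then have 1: "\<And>i. i < length as \<Longrightarrow> c i = 0" using A(6) by blast
  show "c i = 0"
    using 1 2[of "i - length as"] i by (cases "i < length as") auto
qed

lemma coord_append_right:
  assumes a: "basis_mod U U' as" and b: "basis_mod U' K bs" and x: "x \<in> K" and i: "i < length bs"
  shows "coord U (as @ bs) x (length as + i) = coord U' bs x i"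
proof (rule coord_eqI[OF b _ i, symmetric])
  note ab = basis_mod_append[OF a b]
  have "x - lcomb (as @ bs) (coord U (as @ bs) x) \<in> U'"
    using coord_diff_in[OF ab x] basis_modD(3)[OF a] by auto
  moreover have "lcomb as (coord U (as @ bs) x) \<in> U'" using basis_modD[OF a] by (simp add: lcomb_in)
  ultimately have "x - lcomb (as @ bs) (coord U (as @ bs) x) + lcomb as (coord U (as @ bs) x) \<in> U'"
    using subspace_add[OF basis_modD(1)[OF b]] by blast
  then show "x - lcomb bs (\<lambda>i. coord U (as @ bs) x (length as + i)) \<in> U'"
    by (simp add: lcomb_append algebra_simps)
qed

lemma coord_append_left:
  assumes a: "basis_mod U U' as" and b: "basis_mod U' K bs" and x: "x \<in> U'" and i: "i < length as"
  shows "coord U (as @ bs) x i = coord U as x i"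
proof (rule trans[OF coord_eqI[OF basis_mod_append[OF a b]]])
  show "i < length (as @ bs)" using i by simp
  show "x - lcomb (as @ bs) (\<lambda>i. if i < length as then coord U as x i else 0) \<in> U"
    using coord_diff_in[OF a x] lcomb_append_split[of as "coord U as x" bs "\<lambda>i. 0"] by simp
qed (use i in simp)

text \<open>The entries of \<open>as'\<close> lie in \<open>U'\<close> and so have no
  \<open>bs\<close> coordinates: the coordinate matrix is block upper triangular.\<close>

lemma reldet_append:
  assumes a: "basis_mod U U' as" and b: "basis_mod U' K bs"
    and as': "set as' \<subseteq> U'" "length as' = length as" and bs': "set bs' \<subseteq> K" "length bs' = length bs"
  shows "reldet U (as @ bs) (as' @ bs') = reldet U as as' * reldet U' bs bs'"
proof -
  let ?m = "length as" and ?n = "length bs"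
  let ?A = "mat ?m ?m (\<lambda>(i, j). coord U as (as' ! j) i)"
  let ?B = "mat ?m ?n (\<lambda>(i, j). coord U (as @ bs) (bs' ! j) i)"
  let ?D = "mat ?n ?n (\<lambda>(i, j). coord U' bs (bs' ! j) i)"
  have as'i: "as' ! j \<in> U'" "as' ! j \<in> K" if "j < ?m" for j using that as' basis_modD(3)[OF b] by (auto simp: subset_eq)
  have bs'i: "bs' ! j \<in> K" if "j < ?n" for j using that bs' by (auto simp: subset_eq)
  have "mat (length (as @ bs)) (length (as @ bs)) (\<lambda>(i, j). coord U (as @ bs) ((as' @ bs') ! j) i)
      = four_block_mat ?A ?B (0\<^sub>m ?n ?m) ?D" (is "?M = ?F")
  proof (rule eq_matI)
    fix i j assume "i < dim_row ?F" "j < dim_col ?F"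
    then have i: "i < ?m + ?n" and j: "j < ?m + ?n" by auto
    show "?M $$ (i, j) = ?F $$ (i, j)"
    proof (cases "j < ?m")
      case True
      show ?thesis
      proof (cases "i < ?m")
        case True
        then show ?thesis using \<open>j < ?m\<close> i j as'
          by (simp add: nth_append coord_append_left[OF a b as'i(1)])
      next
        case False
        then obtain k where k: "i = ?m + k" "k < ?n" using i by (metis add_diff_inverse_nat nat_add_left_cancel_less)
        then show ?thesis using \<open>j < ?m\<close> i j as'
          by (simp add: nth_append coord_append_right[OF a b as'i(2)] coord_sub[OF b as'i(1)])
      qed
    next
      case False
      then obtain l where l: "j = ?m + l" "l < ?n" using j by (metis add_diff_inverse_nat nat_add_left_cancel_less)
      show ?thesis
      proof (cases "i < ?m")
        case True
        then show ?thesis using l i j as'(2) by (simp add: nth_append)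
      next
        case False
        then obtain k where k: "i = ?m + k" "k < ?n" using i by (metis add_diff_inverse_nat nat_add_left_cancel_less)
        then show ?thesis using l i j as'(2)
          by (simp add: nth_append coord_append_right[OF a b bs'i])
      qed
    qed
  qed auto
  moreover have "Determinant.det (four_block_mat ?A ?B (0\<^sub>m ?n ?m) ?D) = Determinant.det ?A * Determinant.det ?D"
  proof -
    let ?F = "four_block_mat ?A ?B (0\<^sub>m ?n ?m) ?D"
    \<comment> \<open>Transposition moves the zero block to the upper right corner.\<close>
    have "Determinant.det ?F = Determinant.det (?F\<^sup>T)"
      by (rule det_transpose[symmetric, of _ "?m + ?n"]) auto
    also have "?F\<^sup>T = four_block_mat (?A\<^sup>T) (0\<^sub>m ?m ?n) (?B\<^sup>T) (?D\<^sup>T)"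
      by (subst transpose_four_block_mat[of _ ?m ?m _ ?n _ ?n]) auto
    also have "Determinant.det \<dots> = Determinant.det (?A\<^sup>T) * Determinant.det (?D\<^sup>T)"
      by (rule det_four_block_mat_upper_right_zero[of _ ?m _ ?n]) auto
    also have "\<dots> = Determinant.det ?A * Determinant.det ?D"
      by (simp add: det_transpose[of _ ?m] det_transpose[of _ ?n])
    finally show ?thesis .
  qed
  ultimately show ?thesis unfolding reldet_def by simp
qed

text \<open>Only its independence of the bases matters: in the comparison of two choices it cancels.\<close>

definition blockswap_det :: "nat \<Rightarrow> nat \<Rightarrow> 'a" where
  "blockswap_det m n = Determinant.det (mat (m + n) (m + n)
    (\<lambda>(i, j). if i = (if j < n then m + j else j - n) then 1 else 0))"

lemma lcomb_append_commute:
  "lcomb (bs @ as) c = lcomb (as @ bs) (\<lambda>i. if i < length as then c (length bs + i) else c (i - length as))"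
proof -
  have "lcomb (bs @ as) c = lcomb as (\<lambda>i. c (length bs + i)) + lcomb bs c"
    by (simp only: lcomb_append add.commute)
  then show ?thesis by (simp only: lcomb_append_split)
qed

lemma basis_mod_append_commute:
  assumes b: "basis_mod U K (as @ bs)"
  shows "basis_mod U K (bs @ as)"
proof (rule basis_modI)
  note B = basis_modD[OF b]
  show "subspace U" "subspace K" "U \<subseteq> K" "set (bs @ as) \<subseteq> K" using B by auto
  show "\<exists>c. x - lcomb (bs @ as) c \<in> U" if "x \<in> K" for x
    using B(5)[OF that] unfolding lcomb_append_commute[of as bs] by blast
  fix c i assume c: "lcomb (bs @ as) c \<in> U" and i: "i < length (bs @ as)"
  then have *: "(if k < length as then c (length bs + k) else c (k - length as)) = 0"
    if "k < length (as @ bs)" for k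
    using B(6)[OF _ that] unfolding lcomb_append_commute[of bs as] by blast
  show "c i = 0"
  proof (cases "i < length bs")
    case True
    then show ?thesis using *[of "length as + i"] by simp
  next
    case False
    then obtain k where "i = length bs + k" by (metis add_diff_inverse_nat)
    then show ?thesis using *[of k] i by simp
  qed
qed

lemma reldet_append_commute:
  assumes c: "basis_mod U K cs" and b: "basis_mod U K (as @ bs)"
  shows "reldet U cs (bs @ as) = reldet U cs (as @ bs) * blockswap_det (length as) (length bs)"
proof -
  have "reldet U (as @ bs) (bs @ as) = blockswap_det (length as) (length bs)"
    unfolding reldet_def blockswap_det_def length_append
  proof (intro arg_cong[of _ _ Determinant.det] eq_matI, goal_cases)
    case (1 i j)
    \<comment> \<open>The position in \<open>as @ bs\<close> of the vector at position
      \<open>j\<close> of \<open>bs @ as\<close>.\<close>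
    let ?k = "if j < length bs then length as + j else j - length bs"
    have k: "?k < length (as @ bs)" and i: "i < length (as @ bs)" using 1 by auto
    have "(bs @ as) ! j = (as @ bs) ! ?k" using 1 by (auto simp: nth_append)
    then show ?case using coord_nth[OF b k i] 1 by simp
  qed auto
  then show ?thesis
    using reldet_trans[OF c b basis_mod_length[OF c b], of "bs @ as"] basis_modD(4)[OF b]
      basis_mod_length[OF c b] by simp
qed

text \<open>Only the part of \<open>K\<close> beyond \<open>U\<close> has to be finitely generated.
  Adjoining one vector \<open>a\<close> to the generators enlarges the intersection of
  \<open>K\<close> with their span by at most one dimension, so at most one basis vector is
  added.\<close>

lemma basis_mod_exists:
  assumes "finite S" "subspace U" "subspace K" "U \<subseteq> K" "K \<subseteq> span (U \<union> S)"
  shows "\<exists>bs. basis_mod U K bs"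
  using assms
proof (induction S arbitrary: K)
  case empty
  then have "K = U" using span_eq_iff[of U] by (metis Un_empty_right subset_antisym)
  then show ?case using basis_mod_Nil empty by blast
next
  case (insert a S)
  let ?K = "K \<inter> span (U \<union> S)"
  have sK: "subspace ?K" using insert.prems by (simp add: subspace_inter)
  have UK: "U \<subseteq> ?K" using insert.prems by (auto intro: span_base)
  obtain bs where bs: "basis_mod U ?K bs"
    using insert.IH[OF insert.prems(1) sK UK] by auto
  show ?case
  proof (cases "K = ?K")
    case True
    then show ?thesis using bs by metis
  next
    case False
    then obtain x where x: "x \<in> K" "x \<notin> span (U \<union> S)" by blast
    have ex: "\<exists>k. y - scale k a \<in> span (U \<union> S)" if "y \<in> K" for y
      using that insert.prems(4) span_breakdown_eq[of y a "U \<union> S"] by auto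
    obtain k where k: "x - scale k a \<in> span (U \<union> S)" using ex x by blast
    have k0: "k \<noteq> 0" using k x by auto
    have "basis_mod ?K K [x]"
    proof (rule basis_modI)
      fix y assume y: "y \<in> K"
      then obtain l where l: "y - scale l a \<in> span (U \<union> S)" using ex by blast
      \<comment> \<open>\<open>x\<close> has the nonzero component \<open>k\<close> along
        \<open>a\<close>, so a multiple of \<open>x\<close> removes the component \<open>l\<close>
        of \<open>y\<close>.\<close>
      have "(y - scale l a) - scale (l / k) (x - scale k a) \<in> span (U \<union> S)"
        by (rule span_diff[OF l span_scale[OF k]])
      then have "y - scale (l / k) x \<in> span (U \<union> S)"
        using k0 by (simp add: scale_right_diff_distrib)
      moreover have "y - scale (l / k) x \<in> K"
        by (rule subspace_diff[OF insert.prems(2) y subspace_scale[OF insert.prems(2) x(1)]])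
      ultimately have "y - lcomb [x] (\<lambda>i. l / k) \<in> ?K" by (simp add: lcomb_def)
      then show "\<exists>c. y - lcomb [x] c \<in> ?K" by blast
    next
      fix c i assume c: "lcomb [x] c \<in> ?K" and "i < length [x]"
      then have i: "i = 0" by simp
      show "c i = 0"
      proof (rule ccontr)
        assume "c i \<noteq> 0"
        moreover have "scale (c 0) x \<in> span (U \<union> S)" using c by (simp add: lcomb_def)
        ultimately have "scale (inverse (c 0)) (scale (c 0) x) \<in> span (U \<union> S)" "c 0 \<noteq> 0"
          using i span_scale by blast+
        then show False using x by simp
      qed
    qed (use x sK insert.prems in auto)
    then show ?thesis using basis_mod_append[OF bs] by blast
  qed
qed

end

section \<open>Linear maps and the quotients they relate\<close>

locale lin_map = Vector_Spaces.linear s1 s2 f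
  for s1 :: "'a::field \<Rightarrow> 'b::ab_group_add \<Rightarrow> 'b" and s2 :: "'a \<Rightarrow> 'c::ab_group_add \<Rightarrow> 'c" and f

sublocale lin_map \<subseteq> S: vsp s1 ..
sublocale lin_map \<subseteq> T: vsp s2 ..

context vsp
begin

text \<open>Reduces an identity of operators on an infinite dimensional space to \<open>U\<close>
  and finitely many vectors; the operators built from two triples are compared in this way.\<close>

lemma basis_mod_ext_eq:
  assumes b: "basis_mod U UNIV bs" and f: "lin_map scale s2 f" and g: "lin_map scale s2 g"
    and U: "\<And>u. u \<in> U \<Longrightarrow> f u = g u" and bs: "\<And>i. i < length bs \<Longrightarrow> f (bs ! i) = g (bs ! i)"
  shows "f x = g x"
proof -
  interpret f: lin_map scale s2 f by fact
  interpret g: lin_map scale s2 g by fact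
  let ?c = "coord U bs x"
  have "f (lcomb bs ?c) = g (lcomb bs ?c)"
    unfolding lcomb_def f.sum g.sum f.scale g.scale using bs by simp
  moreover have "f (x - lcomb bs ?c) = g (x - lcomb bs ?c)"
    using U coord_diff_in[OF b] by simp
  ultimately show ?thesis by (simp add: f.diff g.diff)
qed

end

lemma linear_lcomb:
  assumes "lin_map s1 s2 f"
  shows "f (vsp.lcomb s1 bs c) = vsp.lcomb s2 (map f bs) c"
proof -
  interpret f: lin_map s1 s2 f by fact
  show ?thesis by (simp add: f.S.lcomb_def f.T.lcomb_def f.sum f.scale)
qed

lemma coord_map:
  assumes f: "lin_map s1 s2 f" and b: "vsp.basis_mod s1 U K bs"
    and b': "vsp.basis_mod s2 U' K' (map f bs)" and U: "f ` U \<subseteq> U'" and x: "x \<in> K" and i: "i < length bs"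
  shows "vsp.coord s2 U' (map f bs) (f x) i = vsp.coord s1 U bs x i"
proof -
  interpret f: lin_map s1 s2 f by fact
  show ?thesis
  proof (rule f.T.coord_eqI[OF b'])
    have "f (x - f.S.lcomb bs (f.S.coord U bs x)) \<in> U'"
      using U f.S.coord_diff_in[OF b x] by blast
    then show "f x - f.T.lcomb (map f bs) (f.S.coord U bs x) \<in> U'"
      by (simp add: f.diff linear_lcomb[OF f])
  qed (use i in simp)
qed

lemma reldet_map:
  assumes f: "lin_map s1 s2 f" and b: "vsp.basis_mod s1 U K bs"
    and b': "vsp.basis_mod s2 U' K' (map f bs)" and U: "f ` U \<subseteq> U'"
    and ys: "set ys \<subseteq> K" "length ys = length bs"
  shows "vsp.reldet s2 U' (map f bs) (map f ys) = vsp.reldet s1 U bs ys"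
proof -
  interpret f: lin_map s1 s2 f by fact
  show ?thesis unfolding f.S.reldet_def f.T.reldet_def
    by (intro arg_cong[of _ _ Determinant.det] eq_matI)
       (use ys in \<open>auto simp: coord_map[OF f b b' U] subset_eq\<close>)
qed

text \<open>The hypotheses say that \<open>f\<close> induces an isomorphism from \<open>K/U\<close>
  to \<open>K'/U'\<close>: the last condition on \<open>U'\<close> is injectivity, the last one on
  \<open>K'\<close> surjectivity. With the identity as \<open>f\<close> it passes from a subspace to
  a quotient of the whole space.\<close>

lemma basis_mod_map:
  assumes f: "lin_map s1 s2 f" and b: "vsp.basis_mod s1 U K bs"
    and U: "module.subspace s2 U'" "f ` U \<subseteq> U'" "\<And>x. x \<in> K \<Longrightarrow> f x \<in> U' \<Longrightarrow> x \<in> U"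
    and K: "module.subspace s2 K'" "U' \<subseteq> K'" "f ` K \<subseteq> K'" "\<And>y. y \<in> K' \<Longrightarrow> \<exists>x\<in>K. y - f x \<in> U'"
  shows "vsp.basis_mod s2 U' K' (map f bs)"
proof -
  interpret f: lin_map s1 s2 f by fact
  note B = f.S.basis_modD[OF b]
  show ?thesis
  proof (rule f.T.basis_modI)
    fix y assume "y \<in> K'"
    then obtain x where x: "x \<in> K" "y - f x \<in> U'" using K by blast
    have "f (x - f.S.lcomb bs (f.S.coord U bs x)) \<in> U'"
      using U f.S.coord_diff_in[OF b x(1)] by blast
    then have "(y - f x) + (f x - f.T.lcomb (map f bs) (f.S.coord U bs x)) \<in> U'"
      by (metis f.diff linear_lcomb[OF f] f.vs2.subspace_add[OF U(1) x(2)])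
    then show "\<exists>c. y - f.T.lcomb (map f bs) c \<in> U'" by auto
  next
    fix c i assume "f.T.lcomb (map f bs) c \<in> U'" "i < length (map f bs)"
    then show "c i = 0"
      using B(6)[OF U(3)[OF f.S.lcomb_in[OF B(2) B(4)]]] by (simp add: linear_lcomb[OF f])
    next
    show "set (map f bs) \<subseteq> K'" using image_mono[OF B(4), of f] K(3) by auto
  qed (use U(1) K(1,2) in blast)+
qed

section \<open>Determinants of operators\<close>

context vsp
begin

text \<open>Applying \<open>T\<close> to the expansion of an entry of \<open>zs\<close> in
  \<open>bs\<close> expands its image in \<open>map T bs\<close> with the same coefficients. The
  lists \<open>zs\<close> and \<open>map T bs\<close> may be dependent.\<close>

lemma reldet_endo_mult:
  assumes T: "lin_map scale scale T" "T ` U \<subseteq> U" "T ` K \<subseteq> K"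
    and b: "basis_mod U K bs" and z: "set zs \<subseteq> K" "length zs = length bs"
  shows "reldet U bs (map T zs) = reldet U bs (map T bs) * reldet U bs zs"
proof -
  interpret T: lin_map scale scale T by fact
  have "set (map T bs) \<subseteq> K" using T(3) basis_modD(4)[OF b] by auto
  then show ?thesis
    unfolding reldet_def[of U bs zs]
  proof (intro reldet_mult[OF b])
    fix j assume "j < length bs"
    then have z': "zs ! j \<in> K" using z by auto
    have "T (zs ! j - lcomb bs (coord U bs (zs ! j))) \<in> U"
      using T(2) coord_diff_in[OF b z'] by auto
    then show "map T zs ! j - lcomb (map T bs) (\<lambda>k. coord U bs (zs ! j) k) \<in> U"
      using \<open>j < length bs\<close> z(2) by (simp add: T.diff linear_lcomb[OF T(1)])
  qed auto
qed

text \<open>Computing the determinant of \<open>map T cs\<close> relative to \<open>bs\<close>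
  through \<open>cs\<close> and through \<open>map T bs\<close> gives the same nonzero factor twice,
  which cancels.\<close>

lemma reldet_endo_basis:
  assumes T: "lin_map scale scale T" "T ` U \<subseteq> U" "T ` K \<subseteq> K"
    and b: "basis_mod U K bs" and c: "basis_mod U K cs"
  shows "reldet U cs (map T cs) = reldet U bs (map T bs)"
proof -
  have l: "length cs = length bs" by (rule basis_mod_length[OF b c])
  have sub: "set (map T cs) \<subseteq> K" using T(3) basis_modD(4)[OF c] by auto
  have "reldet U bs cs * reldet U cs (map T cs) = reldet U bs (map T cs)"
    by (rule reldet_trans[OF b c l sub, symmetric]) (simp add: l)
  also have "\<dots> = reldet U bs (map T bs) * reldet U bs cs"
    by (rule reldet_endo_mult[OF T b basis_modD(4)[OF c] l])
  finally show ?thesis using reldet_nonzero[OF b c] by simp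
qed

lemma reldet_endo_trivial:
  assumes b: "basis_mod U K bs" and T: "\<And>x. x \<in> K \<Longrightarrow> T x - x \<in> U"
  shows "reldet U bs (map T bs) = 1"
proof -
  have "reldet U bs (map T bs) = reldet U bs bs"
    by (rule reldet_cong_mod[OF b]) (use T basis_modD(4)[OF b] in \<open>auto simp: subset_iff\<close>)
  then show ?thesis using b by simp
qed

lemma reldet_endo_append:
  assumes T: "lin_map scale scale T" "T ` U' \<subseteq> U'" "T ` K \<subseteq> K"
    and a: "basis_mod U U' as" and b: "basis_mod U' K bs"
  shows "reldet U (as @ bs) (map T (as @ bs)) = reldet U as (map T as) * reldet U' bs (map T bs)"
  using reldet_append[OF a b, of "map T as" "map T bs"] T(2,3) basis_modD(4)[OF a] basis_modD(4)[OF b]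
  by fastforce

lemma det_matrix_on:
  assumes "distinct bs" "independent (set bs)" and T: "T ` span (set bs) \<subseteq> span (set bs)"
  shows "Determinant.det (matrix_on scale bs T) = reldet {0} bs (map T bs)"
  unfolding matrix_on_def reldet_def
proof (intro arg_cong[of _ _ Determinant.det] eq_matI, goal_cases)
  case (1 i j)
  then have j: "j < length bs" and i: "i < length bs" by auto
  have b: "basis_mod {0} (span (set bs)) bs" using assms by (simp add: basis_mod_zero_iff)
  let ?x = "T (bs ! j)"
  have x: "?x \<in> span (set bs)" using T j by (auto simp: span_base)
  have "lcomb bs (\<lambda>i. representation (set bs) ?x (bs ! i))
      = (\<Sum>v\<in>set bs. scale (representation (set bs) ?x v) v)"
    unfolding lcomb_def by (rule sum.reindex_bij_betw) (use assms(1) in \<open>auto intro: bij_betw_nth\<close>)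
  also have "\<dots> = ?x" using assms(2) x by (intro sum_representation_eq) auto
  finally have "coord {0} bs ?x i = representation (set bs) ?x (bs ! i)"
    by (intro coord_eqI[OF b _ i]) simp
  then show ?case using i j by simp
qed auto

lemma maps_to_of_range:
  assumes "subspace E" "range (\<lambda>x. x - T x) \<subseteq> E"
  shows "T ` E \<subseteq> E"
proof
  fix y assume "y \<in> T ` E"
  then obtain x where x: "x \<in> E" "y = T x" by auto
  have "x - T x \<in> E" using assms(2) by blast
  from subspace_diff[OF assms(1) x(1) this] show "y \<in> E" using x by simp
qed

text \<open>On \<open>E'/E\<close> the operator is the identity, because the image of
  \<open>1 - T\<close> lies in \<open>E\<close>; the additional block contributes 1.\<close>

lemma reldet_endo_extend:
  assumes T: "lin_map scale scale T" and e: "basis_mod {0} E es" "range (\<lambda>x. x - T x) \<subseteq> E"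
    and f: "basis_mod {0} E' fs" "E \<subseteq> E'"
  shows "reldet {0} es (map T es) = reldet {0} fs (map T fs)"
proof -
  interpret T: lin_map scale scale T by fact
  have sE: "subspace E" "subspace E'" using basis_modD(2) e f by auto
  have TE: "T ` E \<subseteq> E" by (rule maps_to_of_range[OF sE(1) e(2)])
  have TE': "T ` E' \<subseteq> E'" by (rule maps_to_of_range[OF sE(2)]) (use e f in auto)
  have "E' \<subseteq> span (E \<union> set fs)"
    using basis_mod_zero_subset[OF f(1)] span_mono[of "set fs" "E \<union> set fs"] by auto
  then obtain gs where g: "basis_mod E E' gs" using basis_mod_exists[OF _ sE f(2), of "set fs"] by auto
  have "reldet {0} fs (map T fs) = reldet {0} (es @ gs) (map T (es @ gs))"
    by (rule reldet_endo_basis[OF T _ TE' basis_mod_append[OF e(1) g] f(1)]) simp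
  also have "\<dots> = reldet {0} es (map T es) * reldet E gs (map T gs)"
    by (rule reldet_endo_append[OF T TE TE' e(1) g])
  also have "reldet E gs (map T gs) = 1"
  proof (rule reldet_endo_trivial[OF g])
    fix x
    have "- (x - T x) \<in> E" using e(2) subspace_neg[OF sE(1)] by blast
    then show "T x - x \<in> E" by simp
  qed
  finally show ?thesis by simp
qed

text \<open>Two admissible subspaces are compared inside the span of both, to which either
  determinant extends unchanged; hence the description in \<open>op_det\<close> has a unique value.
  Invariance of \<open>E\<close> follows from the condition on the range.\<close>

lemma op_det_eqI:
  assumes T: "lin_map scale scale T" and e: "basis_mod {0} E es" "range (\<lambda>x. x - T x) \<subseteq> E"
  shows "op_det scale T = reldet {0} es (map T es)"
  unfolding op_det_def
proof (rule the_equality)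
  have E: "E = span (set es)" by (rule basis_mod_zero_subset[OF e(1)])
  have di: "distinct es" "independent (set es)" using e(1) unfolding E basis_mod_zero_iff by auto
  have TE: "T ` E \<subseteq> E" by (rule maps_to_of_range[OF basis_modD(2)[OF e(1)] e(2)])
  show "\<exists>bs. distinct bs \<and> independent (set bs) \<and> range (\<lambda>x. x - T x) \<subseteq> span (set bs) \<and>
      T ` span (set bs) \<subseteq> span (set bs) \<and>
      reldet {0} es (map T es) = Determinant.det (matrix_on scale bs T)"
    using di e(2) TE det_matrix_on[OF di] unfolding E by metis
next
  fix c assume "\<exists>bs. distinct bs \<and> independent (set bs) \<and> range (\<lambda>x. x - T x) \<subseteq> span (set bs) \<and>
      T ` span (set bs) \<subseteq> span (set bs) \<and> c = Determinant.det (matrix_on scale bs T)"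
  then obtain bs where di: "distinct bs" "independent (set bs)"
    and r: "range (\<lambda>x. x - T x) \<subseteq> span (set bs)" and TB: "T ` span (set bs) \<subseteq> span (set bs)"
    and c: "c = Determinant.det (matrix_on scale bs T)" by blast
  have b: "basis_mod {0} (span (set bs)) bs" using di by (simp add: basis_mod_zero_iff)
  let ?E = "span (set es \<union> set bs)"
  obtain fs where f: "basis_mod {0} ?E fs"
    using basis_mod_exists[of "set es \<union> set bs" "{0}" ?E]
      span_mono[of "set es \<union> set bs" "{0} \<union> (set es \<union> set bs)"] span_zero[of "set es \<union> set bs"]
    by auto
  have "reldet {0} es (map T es) = reldet {0} fs (map T fs)"
    by (rule reldet_endo_extend[OF T e f])
       (use basis_mod_zero_subset[OF e(1)] span_mono[of "set es" "set es \<union> set bs"] in auto)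
  moreover have "reldet {0} bs (map T bs) = reldet {0} fs (map T fs)"
    by (rule reldet_endo_extend[OF T b r f]) (use span_mono[of "set bs" "set es \<union> set bs"] in auto)
  ultimately show "c = reldet {0} es (map T es)" using c det_matrix_on[OF di TB] by simp
qed

lemma basis_of_span:
  assumes "finite B"
  obtains es where "basis_mod {0} (span B) es"
  using basis_mod_exists[of B "{0}" "span B"] assms span_mono[of B "{0} \<union> B"] span_zero[of B] by auto

lemma finite_rank_basis:
  assumes "finite_rank scale f" "finite_rank scale g"
  obtains E es where "basis_mod {0} E es" "range f \<subseteq> E" "range g \<subseteq> E"
proof -
  obtain B C where B: "finite B" "range f \<subseteq> span B" and C: "finite C" "range g \<subseteq> span C"
    using assms unfolding finite_rank_def by blast
  obtain es where "basis_mod {0} (span (B \<union> C)) es" using basis_of_span B C by (metis finite_UnI)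
  then show ?thesis
    using that B(2) C(2) span_mono[of B "B \<union> C"] span_mono[of C "B \<union> C"] by (meson order_trans sup_ge1 sup_ge2)
qed

lemma op_det_mult:
  assumes S: "lin_map scale scale S" "finite_rank scale (\<lambda>x. x - S x)"
    and T: "lin_map scale scale T" "finite_rank scale (\<lambda>x. x - T x)"
  shows "op_det scale (\<lambda>x. S (T x)) = op_det scale S * op_det scale T"
proof -
  interpret S: lin_map scale scale S by fact
  interpret T: lin_map scale scale T by fact
  obtain E es where e: "basis_mod {0} E es"
    and rS: "range (\<lambda>x. x - S x) \<subseteq> E" and rT: "range (\<lambda>x. x - T x) \<subseteq> E"
    using finite_rank_basis[OF S(2) T(2)] by blast
  have sE: "subspace E" using basis_modD(2)[OF e] .
  have ST: "lin_map scale scale (\<lambda>x. S (T x))"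
    by unfold_locales (simp_all add: S.add T.add S.scale T.scale)
  have "range (\<lambda>x. x - S (T x)) \<subseteq> E"
  proof
    fix y assume "y \<in> range (\<lambda>x. x - S (T x))"
    then obtain x where "y = (x - T x) + (T x - S (T x))" by auto
    then show "y \<in> E" using rS rT subspace_add[OF sE] by blast
  qed
  then have "op_det scale (\<lambda>x. S (T x)) = reldet {0} es (map S (map T es))"
    using op_det_eqI[OF ST e] by (simp add: comp_def)
  also have "\<dots> = reldet {0} es (map S es) * reldet {0} es (map T es)"
    using maps_to_of_range[OF sE rS] maps_to_of_range[OF sE rT] basis_modD(4)[OF e]
    by (intro reldet_endo_mult[OF S(1) _ _ e]) fastforce+
  finally show ?thesis using op_det_eqI[OF S(1) e rS] op_det_eqI[OF T(1) e rT] by simp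
qed

text \<open>Split an admissible \<open>E\<close> along \<open>E \<inter> U\<close>: on this part
  \<open>T\<close> is the identity, and the quotient \<open>E/(E \<inter> U)\<close> is the quotient
  of the whole space by \<open>U\<close>.\<close>

lemma op_det_mod:
  assumes T: "lin_map scale scale T" and b: "basis_mod U UNIV bs" and U: "\<And>u. u \<in> U \<Longrightarrow> T u = u"
  shows "op_det scale T = reldet U bs (map T bs)"
    and "finite_rank scale (\<lambda>x. x - T x)"
proof -
  interpret T: lin_map scale scale T by fact
  let ?D = "(\<lambda>x. x - T x) ` set bs"
  \<comment> \<open>\<open>?D\<close> spans the image of \<open>1 - T\<close>, since
    \<open>T\<close> moves a vector only through its \<open>bs\<close> coordinates; adding
    \<open>bs\<close> makes \<open>?E\<close> map onto the quotient by \<open>U\<close>.\<close>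
  let ?E = "span (set bs \<union> ?D)"
  have sU: "subspace U" using basis_modD(1)[OF b] .
  have r: "range (\<lambda>x. x - T x) \<subseteq> span ?D"
  proof
    fix y assume "y \<in> range (\<lambda>x. x - T x)"
    then obtain x where x: "y = x - T x" by auto
    let ?l = "lcomb bs (coord U bs x)"
    have "T (x - ?l) = x - ?l" using coord_diff_in[OF b, of x] U by auto
    then have "y = ?l - T ?l" by (simp add: x T.diff algebra_simps)
    also have "\<dots> = lcomb (map (\<lambda>x. x - T x) bs) (coord U bs x)"
      by (simp add: linear_lcomb[OF T]) (simp add: lcomb_def scale_right_diff_distrib sum_subtractf)
    also have "\<dots> \<in> span (set (map (\<lambda>x. x - T x) bs))" by (rule lcomb_in_span)
    finally show "y \<in> span ?D" by simp
  qed
  then show fr: "finite_rank scale (\<lambda>x. x - T x)" unfolding finite_rank_def by (intro exI[of _ ?D]) auto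
  have rE: "range (\<lambda>x. x - T x) \<subseteq> ?E" using r span_mono[of ?D "set bs \<union> ?D"] by auto
  have TE: "T ` ?E \<subseteq> ?E" by (rule maps_to_of_range[OF subspace_span rE])
  have bE: "set bs \<subseteq> ?E" by (auto intro: span_base)
  obtain gs where g: "basis_mod {0} ?E gs" using basis_of_span[of "set bs \<union> ?D"] by auto
  have "?E \<inter> U \<subseteq> span ({0} \<union> (set bs \<union> ?D))" using span_mono[of "set bs \<union> ?D"] by blast
  then obtain us where u: "basis_mod {0} (?E \<inter> U) us"
    using basis_mod_exists[of "set bs \<union> ?D" "{0}" "?E \<inter> U"] sU
    by (auto simp: subspace_inter subspace_0 span_zero)
  have b': "basis_mod (?E \<inter> U) ?E bs"
  proof (rule basis_modI)
    fix x assume x: "x \<in> ?E"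
    have "x - lcomb bs (coord U bs x) \<in> ?E \<inter> U"
      using coord_diff_in[OF b, of x] span_diff[OF x] lcomb_in[OF subspace_span bE] by auto
    then show "\<exists>c. x - lcomb bs c \<in> ?E \<inter> U" by blast
  next
    fix c i assume "lcomb bs c \<in> ?E \<inter> U" "i < length bs"
    then show "c i = 0" using basis_modD(6)[OF b, of c i] by auto
  qed (use sU bE in \<open>auto simp: subspace_inter\<close>)
  have "op_det scale T = reldet {0} (us @ bs) (map T (us @ bs))"
    by (rule op_det_eqI[OF T basis_mod_append[OF u b'] rE])
  also have "\<dots> = reldet {0} us (map T us) * reldet (?E \<inter> U) bs (map T bs)"
    by (rule reldet_endo_append[OF T _ TE u b']) (use U in auto)
  also have "reldet {0} us (map T us) = 1" by (rule reldet_endo_trivial[OF u]) (use U in auto)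
  also have "reldet (?E \<inter> U) bs (map T bs) = reldet U bs (map T bs)"
  proof (rule reldet_cong)
    fix i j assume i: "i < length bs" and j: "j < length bs"
    have "bs ! j \<in> ?E" using bE nth_mem[OF j] by (rule subsetD)
    then have "T (bs ! j) \<in> ?E" using TE by (metis image_subset_iff)
    then show "coord (?E \<inter> U) bs (map T bs ! j) i = coord U bs (map T bs ! j) i"
      using coord_diff_in[OF b', of "T (bs ! j)"] j by (intro coord_eqI[OF b _ i, symmetric]) auto
  qed simp
  finally show "op_det scale T = reldet U bs (map T bs)" by simp
qed

text \<open>The linear map that is the identity on \<open>U\<close> and sends the basis \<open>bs\<close> of a complement to \<open>cs\<close>.\<close>

definition shift :: "'b set \<Rightarrow> 'b list \<Rightarrow> 'b list \<Rightarrow> 'b \<Rightarrow> 'b" where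
  "shift U bs cs x = x - lcomb bs (coord U bs x) + lcomb cs (coord U bs x)"

context
  fixes U :: "'b set" and bs cs :: "'b list"
  assumes b: "basis_mod U UNIV bs" and l: "length cs = length bs"
begin

lemma shift_fix: "u \<in> U \<Longrightarrow> shift U bs cs u = u"
  using coord_sub[OF b] l lcomb_cong[of bs "coord U bs u" "\<lambda>i. 0"] lcomb_cong[of cs "coord U bs u" "\<lambda>i. 0"]
  by (simp add: shift_def)

lemma shift_nth:
  assumes "i < length bs"
  shows "shift U bs cs (bs ! i) = cs ! i"
proof -
  have "lcomb xs (coord U bs (bs ! i)) = xs ! i" if "length xs = length bs" for xs
    using lcomb_cong[of xs "coord U bs (bs ! i)" "\<lambda>k. if k = i then 1 else 0"]
      lcomb_unit[of i xs] coord_nth[OF b assms] assms that by simp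
  then show ?thesis using l by (simp add: shift_def)
qed

lemma map_shift: "map (shift U bs cs) bs = cs"
  by (rule nth_equalityI) (simp_all add: shift_nth l)

lemma shift_linear: "lin_map scale scale (shift U bs cs)"
proof -
  have 1: "lcomb xs (coord U bs (x + y)) = lcomb xs (coord U bs x) + lcomb xs (coord U bs y)"
    if "length xs = length bs" for xs x y
    unfolding lcomb_add[symmetric] by (rule lcomb_cong) (simp add: coord_add[OF b] that)
  have 2: "lcomb xs (coord U bs (scale a x)) = scale a (lcomb xs (coord U bs x))"
    if "length xs = length bs" for xs a x
    unfolding lcomb_scale[symmetric] by (rule lcomb_cong) (simp add: coord_scale[OF b] that)
  show ?thesis
    by unfold_locales
       (simp_all add: shift_def 1 2 l scale_right_distrib scale_right_diff_distrib)
qed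

lemma shift_op_det: "op_det scale (shift U bs cs) = reldet U bs cs"
  using op_det_mod(1)[OF shift_linear b shift_fix] map_shift by simp

lemma shift_finite_rank: "finite_rank scale (\<lambda>x. x - shift U bs cs x)"
  using op_det_mod(2)[OF shift_linear b shift_fix] by simp

end

text \<open>\<open>T\<close> is the identity on the successive quotients of the flag
  \<open>ker n \<subseteq> ker n^2 \<subseteq> E\<close>. The exponent three is the one produced by
  a change of pseudo-inverses.\<close>

lemma reldet_unipotent:
  assumes T: "lin_map scale scale T" and e: "basis_mod {0} E es" and TE: "T ` E \<subseteq> E"
    and n: "\<And>x. n x = T x - x" "\<And>x. n (n (n x)) = 0"
  shows "reldet {0} es (map T es) = 1"
proof -
  interpret T: lin_map scale scale T by fact
  have nl: "n (x + y) = n x + n y" "n (scale a x) = scale a (n x)" "n 0 = 0" for x y a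
    by (simp_all add: n(1) T.add T.scale T.zero scale_right_diff_distrib)
  have sE: "subspace E" using basis_modD(2)[OF e] .
  have nE: "n x \<in> E" if "x \<in> E" for x unfolding n(1) using TE that subspace_diff[OF sE] by blast
  have Tn: "T x = x + n x" for x by (simp add: n(1))
  define K1 where "K1 = E \<inter> {x. n x = 0}"
  define K2 where "K2 = E \<inter> {x. n (n x) = 0}"
  have s: "subspace K1" "subspace K2" using sE
    unfolding K1_def K2_def by (auto simp: subspace_def nl)
  have Espan: "X \<subseteq> span (Y \<union> set es)" if "X \<subseteq> E" for X Y
    using basis_mod_zero_subset[OF e] span_mono[of "set es" "Y \<union> set es"] that by auto
  have sub: "K1 \<subseteq> K2" "K2 \<subseteq> E" "K1 \<subseteq> E" "{0} \<subseteq> K1"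
    using subspace_0[OF sE] by (auto simp: K1_def K2_def nl)
  obtain b1 where b1: "basis_mod {0} K1 b1"
    using basis_mod_exists[OF _ subspace_single_0 s(1) sub(4) Espan[OF sub(3)]] by auto
  obtain b2 where b2: "basis_mod K1 K2 b2"
    using basis_mod_exists[OF _ s sub(1) Espan[OF sub(2)]] by auto
  obtain b3 where b3: "basis_mod K2 E b3"
    using basis_mod_exists[OF _ s(2) sE sub(2) Espan[OF order_refl]] by auto
  have n1: "T x - x \<in> {0}" if "x \<in> K1" for x using that by (simp add: Tn K1_def)
  have n2: "T x - x \<in> K1" if "x \<in> K2" for x using that nE by (simp add: Tn K1_def K2_def)
  have n3: "T x - x \<in> K2" if "x \<in> E" for x using that nE n(2) by (simp add: Tn K2_def)
  have T1: "T ` K1 \<subseteq> K1" "T ` K2 \<subseteq> K2"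
    using nE sE subspace_add[OF sE] by (auto simp: K1_def K2_def Tn nl n(2))
  have "reldet {0} es (map T es) = reldet {0} ((b1 @ b2) @ b3) (map T ((b1 @ b2) @ b3))"
    by (rule reldet_endo_basis[OF T _ TE basis_mod_append[OF basis_mod_append[OF b1 b2] b3] e]) simp
  also have "\<dots> = 1"
    unfolding reldet_endo_append[OF T T1(2) TE basis_mod_append[OF b1 b2] b3]
      reldet_endo_append[OF T T1 b1 b2]
    using reldet_endo_trivial[OF b1 n1] reldet_endo_trivial[OF b2 n2] reldet_endo_trivial[OF b3 n3]
    by simp
  finally show ?thesis .
qed

text \<open>\<open>V\<close> and \<open>W\<close> need not be of determinant class, but both act unipotently on a common finite
  dimensional invariant subspace containing the image of \<open>V - W\<close>.\<close>

lemma op_det_unipotent_quotient: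
  assumes V: "lin_map scale scale V" and W: "lin_map scale scale W" and V': "lin_map scale scale V'"
    and inv: "\<And>x. V' (V x) = x" "\<And>x. V (V' x) = x"
    and n: "\<And>x. n x = V x - x" "\<And>x. n (n (n x)) = 0"
    and m: "\<And>x. m x = W x - x" "\<And>x. m (m (m x)) = 0"
    and fr: "finite_rank scale (\<lambda>x. V x - W x)"
  shows "op_det scale (\<lambda>x. V' (W x)) = 1" and "finite_rank scale (\<lambda>x. x - V' (W x))"
proof -
  interpret V: lin_map scale scale V by fact
  interpret W: lin_map scale scale W by fact
  interpret V': lin_map scale scale V' by fact
  have nlin: "lin_map scale scale n"
    by unfold_locales (simp_all add: n(1) V.add V.scale scale_right_diff_distrib)
  interpret n: lin_map scale scale n by (rule nlin)
  obtain F where F: "finite F" "range (\<lambda>x. V x - W x) \<subseteq> span F"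
    using fr unfolding finite_rank_def by blast
  \<comment> \<open>As \<open>n\<close> has cube zero, this finite set is mapped by \<open>n\<close>
    into itself and zero.\<close>
  let ?B = "F \<union> n ` F \<union> n ` n ` F"
  define E where "E = span ?B"
  have fB: "finite ?B" using F by auto
  have sE: "subspace E" by (simp add: E_def)
  have FE: "V x - W x \<in> E" for x using F(2) span_mono[of F ?B] unfolding E_def by blast
  have nE: "n x \<in> E" if "x \<in> E" for x
  proof -
    have "n ` ?B \<subseteq> ?B \<union> {0}" using n(2) by auto
    moreover have "?B \<union> {0} \<subseteq> E" using sE subspace_0 unfolding E_def by (auto intro: span_base)
    ultimately have "n ` ?B \<subseteq> E" by (rule subset_trans)
    then have "span (n ` ?B) \<subseteq> E" by (intro span_minimal sE)
    then show ?thesis using that n.span_image[of ?B] unfolding E_def by auto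
  qed
  have VE: "V x \<in> E" if "x \<in> E" for x
    using subspace_add[OF sE that nE[OF that]] by (simp add: n(1))
  have WE: "W x \<in> E" if "x \<in> E" for x
    using subspace_diff[OF sE VE[OF that] FE[of x]] by simp
  \<comment> \<open>The inverse of \<open>1 + n\<close> is the Neumann series, which stops at the
    square.\<close>
  have V'eq: "V' x = x - n x + n (n x)" for x
  proof -
    have "V (x - n x + n (n x)) = (x - n x + n (n x)) + n (x - n x + n (n x))" by (simp add: n(1))
    also have "\<dots> = x" by (simp add: n.add n.diff n(2))
    finally show ?thesis using inv(1) by metis
  qed
  have V'E: "V' x \<in> E" if "x \<in> E" for x
    unfolding V'eq using nE that sE by (intro subspace_add subspace_diff) auto
  have lin: "lin_map scale scale (\<lambda>x. V' (W x))"
    by unfold_locales (simp_all add: V'.add V'.scale W.add W.scale)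
  obtain es where e: "basis_mod {0} E es" using basis_of_span[OF fB] unfolding E_def by blast
  have r: "range (\<lambda>x. x - V' (W x)) \<subseteq> E"
  proof
    fix y assume "y \<in> range (\<lambda>x. x - V' (W x))"
    then obtain x where "y = x - V' (W x)" by (rule rangeE)
    then have "y = V' (V x - W x)" by (simp add: V'.diff inv(1))
    then show "y \<in> E" using V'E[OF FE] by simp
  qed
  show "finite_rank scale (\<lambda>x. x - V' (W x))"
    unfolding finite_rank_def using fB r[unfolded E_def] by (intro exI[of _ ?B] conjI)
  have es: "set es \<subseteq> E" using basis_modD(4)[OF e] .
  have z: "V ` {0} \<subseteq> {0}" by (simp add: V.zero)
  have VE': "V ` E \<subseteq> E" and WE': "W ` E \<subseteq> E" using VE WE by blast+
  have zE: "set (map (\<lambda>x. V' (W x)) es) \<subseteq> E" using V'E[OF WE] es by auto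
  have "reldet {0} es (map V (map (\<lambda>x. V' (W x)) es))
      = reldet {0} es (map V es) * reldet {0} es (map (\<lambda>x. V' (W x)) es)"
    by (rule reldet_endo_mult[OF V z VE' e zE]) simp
  \<comment> \<open>\<open>V\<close> composed with \<open>V' W\<close> is \<open>W\<close>; as
    \<open>V\<close> and \<open>W\<close> both have determinant 1 on \<open>E\<close>, so has
    \<open>V' W\<close>.\<close>
  moreover have "map V (map (\<lambda>x. V' (W x)) es) = map W es" by (simp add: inv(2))
  moreover have "reldet {0} es (map V es) = 1"
    by (rule reldet_unipotent[OF V e VE' n])
  moreover have "reldet {0} es (map W es) = 1"
    by (rule reldet_unipotent[OF W e WE' m])
  ultimately show "op_det scale (\<lambda>x. V' (W x)) = 1" using op_det_eqI[OF lin e r]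
    by (simp only: mult_1)
qed

end

text \<open>If \<open>E\<close> carries the determinant of \<open>R\<close>, then \<open>A\<close>
  applied to \<open>E\<close> carries that of \<open>Y\<close>, because \<open>1 - Y\<close> has its
  image in the image under \<open>A\<close> of that of \<open>1 - R\<close>. There \<open>A\<close>
  conjugates \<open>R\<close> to \<open>Y\<close>; it need not be surjective, which allows negative
  index.\<close>

lemma op_det_intertwine:
  assumes A: "lin_map s1 s2 A" "inj A" and R: "lin_map s1 s1 R" "finite_rank s1 (\<lambda>x. x - R x)"
    and Y: "lin_map s2 s2 Y" "\<And>x. Y (A x) = A (R x)"
    and r: "range (\<lambda>y. y - Y y) \<subseteq> A ` range (\<lambda>x. x - R x)"
  shows "op_det s2 Y = op_det s1 R" and "finite_rank s2 (\<lambda>y. y - Y y)"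
proof -
  interpret A: lin_map s1 s2 A by fact
  interpret R: lin_map s1 s1 R by fact
  obtain E es where e: "A.S.basis_mod {0} E es" "range (\<lambda>x. x - R x) \<subseteq> E"
    by (rule A.S.finite_rank_basis[OF R(2) R(2)])
  have sE: "A.vs1.subspace E" using A.S.basis_modD(2)[OF e(1)] .
  have sAE: "A.vs2.subspace (A ` E)" using A.subspace_image[OF sE] .
  have A0: "A x = 0 \<longleftrightarrow> x = 0" for x using A(2) A.zero by (metis injD)
  have b: "A.T.basis_mod {0} (A ` E) (map A es)"
    by (rule basis_mod_map[OF A(1) e(1)])
       (use sAE A.vs2.subspace_0[OF sAE] in \<open>auto simp: A0\<close>)
  have rE: "range (\<lambda>y. y - Y y) \<subseteq> A ` E" using r e(2) by blast
  have RE: "R ` E \<subseteq> E" by (rule A.S.maps_to_of_range[OF sE e(2)])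
  have "op_det s2 Y = A.T.reldet {0} (map A es) (map Y (map A es))"
    by (rule A.T.op_det_eqI[OF Y(1) b rE])
  also have "map Y (map A es) = map A (map R es)" by (simp add: Y(2))
  also have "A.T.reldet {0} (map A es) (map A (map R es)) = A.S.reldet {0} es (map R es)"
    by (rule reldet_map[OF A(1) e(1) b]) (use RE A.S.basis_modD(4)[OF e(1)] A.zero in auto)
  also have "\<dots> = op_det s1 R" by (rule A.S.op_det_eqI[OF R(1) e, symmetric])
  finally show "op_det s2 Y = op_det s1 R" .
  have "A ` E = A.vs2.span (set (map A es))" using A.T.basis_mod_zero_subset[OF b] .
  then show "finite_rank s2 (\<lambda>y. y - Y y)" unfolding finite_rank_def using rE by (metis finite_set)
qed

section \<open>Perturbation data for a pair of Fredholm operators\<close>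

context vsp
begin

lemma finite_rank_add:
  assumes "finite_rank scale f" "finite_rank scale g"
  shows "finite_rank scale (\<lambda>x. f x + g x)" "finite_rank scale (\<lambda>x. f x - g x)"
proof -
  obtain E es where e: "basis_mod {0} E es" and r: "range f \<subseteq> E" "range g \<subseteq> E"
    by (rule finite_rank_basis[OF assms])
  have E: "E = span (set es)" by (rule basis_mod_zero_subset[OF e])
  have "range (\<lambda>x. f x + g x) \<subseteq> span (set es)" "range (\<lambda>x. f x - g x) \<subseteq> span (set es)"
    using r unfolding E by (auto intro!: span_add span_diff)
  then show "finite_rank scale (\<lambda>x. f x + g x)" "finite_rank scale (\<lambda>x. f x - g x)"
    unfolding finite_rank_def by (meson finite_set)+
qed

lemma finite_rank_comp: "finite_rank scale f \<Longrightarrow> finite_rank scale (\<lambda>x. f (g x))"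
  unfolding finite_rank_def by blast

lemma finite_rank_zero: "finite_rank scale (\<lambda>x. 0)"
  unfolding finite_rank_def by (intro exI[of _ "{}"]) auto

end

lemma finite_rank_linear:
  assumes "lin_map s1 s2 g" "finite_rank s1 f"
  shows "finite_rank s2 (\<lambda>x. g (f x))"
proof -
  interpret g: lin_map s1 s2 g by fact
  obtain B where B: "finite B" "range f \<subseteq> g.vs1.span B" using assms(2) unfolding finite_rank_def by blast
  have "range (\<lambda>x. g (f x)) \<subseteq> g.vs2.span (g ` B)" using B(2) g.span_image[of B] by auto
  then show ?thesis unfolding finite_rank_def using B(1) by blast
qed

lemma lin_map_add:
  assumes "lin_map s1 s2 f" "lin_map s1 s2 g"
  shows "lin_map s1 s2 (\<lambda>x. f x + g x)"
proof -
  interpret f: lin_map s1 s2 f by fact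
  interpret g: lin_map s1 s2 g by fact
  show ?thesis by unfold_locales (simp_all add: f.add g.add f.scale g.scale f.vs2.scale_right_distrib)
qed

lemma lin_map_comp:
  assumes "lin_map s1 s2 f" "lin_map s2 s3 g"
  shows "lin_map s1 s3 (\<lambda>x. g (f x))"
proof -
  interpret f: lin_map s1 s2 f by fact
  interpret g: lin_map s2 s3 g by fact
  show ?thesis by unfold_locales (simp_all add: f.add g.add f.scale g.scale)
qed

lemma lin_map_diff:
  assumes "lin_map s1 s2 f" "lin_map s1 s2 g"
  shows "lin_map s1 s2 (\<lambda>x. f x - g x)"
proof -
  interpret f: lin_map s1 s2 f by fact
  interpret g: lin_map s1 s2 g by fact
  show ?thesis by unfold_locales (simp_all add: f.add g.add f.scale g.scale f.vs2.scale_right_diff_distrib)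
qed

lemma lin_map_inv:
  assumes "lin_map s1 s2 f" "bij f"
  shows "lin_map s2 s1 (inv_into UNIV f)"
proof -
  interpret f: lin_map s1 s2 f by fact
  have 1: "inv_into UNIV f (f x) = x" "f (inv_into UNIV f y) = y" for x y
    using assms(2) by (simp_all add: bij_is_inj bij_is_surj surj_f_inv_f)
  show ?thesis by unfold_locales (metis 1 f.add, metis 1 f.scale)
qed

text \<open>The complexes are forgotten: only the Fredholm operators with their pseudo-inverses are
  kept, so that the two signs of the index become one statement with the roles exchanged.
  \<open>fin_st\<close> is the source of the determinant class.\<close>

locale fred_pair =
  fixes s1 :: "'f::field \<Rightarrow> 'a::ab_group_add \<Rightarrow> 'a" and s2 :: "'f \<Rightarrow> 'b::ab_group_add \<Rightarrow> 'b"
    and \<sigma> :: "'a \<Rightarrow> 'b" and \<sigma>' :: "'b \<Rightarrow> 'a" and \<tau> :: "'b \<Rightarrow> 'a" and \<tau>' :: "'a \<Rightarrow> 'b"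
  assumes lin: "lin_map s1 s2 \<sigma>" "lin_map s2 s1 \<sigma>'" "lin_map s2 s1 \<tau>" "lin_map s1 s2 \<tau>'"
    and pinv: "\<And>x. \<sigma> (\<sigma>' (\<sigma> x)) = \<sigma> x" "\<And>y. \<sigma>' (\<sigma> (\<sigma>' y)) = \<sigma>' y"
      "\<And>y. \<tau> (\<tau>' (\<tau> y)) = \<tau> y" "\<And>x. \<tau>' (\<tau> (\<tau>' x)) = \<tau>' x"
    and fin_st: "finite_rank s2 (\<lambda>y. y - \<sigma> (\<tau> y))"
begin
sublocale V: vsp s1
proof -
  interpret lin_map s1 s2 \<sigma> by (rule lin)
  show "vsp s1" by unfold_locales
qed

sublocale W: vsp s2
proof -
  interpret lin_map s1 s2 \<sigma> by (rule lin)
  show "vsp s2" by unfold_locales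
qed

sublocale \<sigma>: lin_map s1 s2 \<sigma> by (rule lin)
sublocale \<sigma>': lin_map s2 s1 \<sigma>' by (rule lin)
sublocale \<tau>: lin_map s2 s1 \<tau> by (rule lin)
sublocale \<tau>': lin_map s1 s2 \<tau>' by (rule lin)

lemma ker_proj: "\<sigma> (x - \<sigma>' (\<sigma> x)) = 0" "\<tau> (y - \<tau>' (\<tau> y)) = 0"
  by (simp_all only: \<sigma>.diff \<tau>.diff pinv diff_self)

end

text \<open>Here \<open>L\<close>, \<open>M\<close>, \<open>N\<close> are the maps of a perturbation triple precomposed with the projections onto
  the kernels of \<open>\<sigma>\<close> and \<open>\<tau>\<close>; \<open>xs\<close>, \<open>us\<close>, \<open>ts\<close> are bases of the kernels of \<open>\<sigma>\<close>, \<open>N\<close>, \<open>M\<close>.\<close>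

locale pert = fred_pair s1 s2 \<sigma> \<sigma>' \<tau> \<tau>'
  for s1 :: "'f::field \<Rightarrow> 'a::ab_group_add \<Rightarrow> 'a" and s2 :: "'f \<Rightarrow> 'b::ab_group_add \<Rightarrow> 'b"
    and \<sigma> :: "'a \<Rightarrow> 'b" and \<sigma>' :: "'b \<Rightarrow> 'a" and \<tau> :: "'b \<Rightarrow> 'a" and \<tau>' :: "'a \<Rightarrow> 'b" +
  fixes L :: "'a \<Rightarrow> 'b" and M :: "'b \<Rightarrow> 'a" and N :: "'b \<Rightarrow> 'b"
    and xs :: "'a list" and us ts :: "'b list"
  assumes linL: "lin_map s1 s2 L" and linM: "lin_map s2 s1 M" and linN: "lin_map s2 s2 N"
    and L0: "\<And>y. L (\<sigma>' y) = 0" and M0: "\<And>x. M (\<tau>' x) = 0" and N0: "\<And>x. N (\<tau>' x) = 0"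
    and Mts: "\<And>t. t \<in> set ts \<Longrightarrow> M t = 0" and Nus: "\<And>t. t \<in> set us \<Longrightarrow> N t = 0"
    and bx: "vsp.basis_mod s1 {0} {x. \<sigma> x = 0} xs"
    and bt: "vsp.basis_mod s2 {0} {y. \<tau> y = 0} (us @ ts)"
    and bW: "vsp.basis_mod s2 (range \<sigma>) UNIV (map L xs @ map N ts)"
    and bV: "vsp.basis_mod s1 (range \<tau>) UNIV (map M us)"
begin

sublocale L: lin_map s1 s2 L by (rule linL)
sublocale M: lin_map s2 s1 M by (rule linM)
sublocale N: lin_map s2 s2 N by (rule linN)

definition A where "A v = \<sigma> v + L v"
definition B where "B y = \<tau> y + M y"
definition Sig where "Sig y = A (B y) + N y"

lemma linA: "lin_map s1 s2 A" unfolding A_def by (rule lin_map_add[OF lin(1) linL])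
lemma linB: "lin_map s2 s1 B" unfolding B_def by (rule lin_map_add[OF lin(3) linM])
lemma linSig: "lin_map s2 s2 Sig"
  unfolding Sig_def by (rule lin_map_add[OF lin_map_comp[OF linB linA] linN])

sublocale A: lin_map s1 s2 A by (rule linA)
sublocale B: lin_map s2 s1 B by (rule linB)
sublocale Sig: lin_map s2 s2 Sig by (rule linSig)

text \<open>\<open>\<sigma>' \<sigma>\<close> is a projection onto the range of
  \<open>\<sigma>'\<close> along the kernel of \<open>\<sigma>\<close>, so a basis of this kernel is
  also one modulo the range of \<open>\<sigma>'\<close>. In this form a base change of the kernel
  extends to an operator on the whole space.\<close>

lemma bx': "V.basis_mod (range \<sigma>') UNIV xs"
proof -
  have "lin_map s1 s1 (\<lambda>x. x)" by unfold_locales auto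
  from basis_mod_map[OF this bx, of "range \<sigma>'" UNIV] show ?thesis
  proof (rule back_subst[of "V.basis_mod (range \<sigma>') UNIV"])
    show "module.subspace s1 (range \<sigma>')" using \<sigma>'.subspace_image[OF W.subspace_UNIV] .
    show "x \<in> {0}" if x: "x \<in> {x. \<sigma> x = 0}" "x \<in> range \<sigma>'" for x
    proof -
      obtain y where "x = \<sigma>' y" using x by auto
      then have "x = \<sigma>' (\<sigma> x)" using pinv(2) by simp
      then show ?thesis using x \<sigma>'.zero by simp
    qed
    show "\<exists>x\<in>{x. \<sigma> x = 0}. y - x \<in> range \<sigma>'" for y
      by (rule bexI[of _ "y - \<sigma>' (\<sigma> y)"]) (simp_all add: \<sigma>.diff pinv(1))
    show "(\<lambda>x. x) ` {0} \<subseteq> range \<sigma>'" using \<sigma>'.zero by (auto intro: range_eqI[of _ _ 0])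
  qed simp_all
qed

lemma bt': "W.basis_mod (range \<tau>') UNIV (us @ ts)"
proof -
  have "lin_map s2 s2 (\<lambda>x. x)" by unfold_locales auto
  from basis_mod_map[OF this bt, of "range \<tau>'" UNIV] show ?thesis
  proof (rule back_subst[of "W.basis_mod (range \<tau>') UNIV"])
    show "module.subspace s2 (range \<tau>')" using \<tau>'.subspace_image[OF V.subspace_UNIV] .
    show "x \<in> {0}" if x: "x \<in> {x. \<tau> x = 0}" "x \<in> range \<tau>'" for x
    proof -
      obtain y where "x = \<tau>' y" using x by auto
      then have "x = \<tau>' (\<tau> x)" using pinv(4) by simp
      then show ?thesis using x \<tau>'.zero by simp
    qed
    show "\<exists>x\<in>{x. \<tau> x = 0}. y - x \<in> range \<tau>'" for y
      by (rule bexI[of _ "y - \<tau>' (\<tau> y)"]) (simp_all add: \<tau>.diff pinv(3))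
    show "(\<lambda>x. x) ` {0} \<subseteq> range \<tau>'" using \<tau>'.zero by (auto intro: range_eqI[of _ _ 0])
  qed simp_all
qed

lemma ker_nth: "i < length xs \<Longrightarrow> \<sigma> (xs ! i) = 0" "i < length us \<Longrightarrow> \<tau> (us ! i) = 0"
    "i < length ts \<Longrightarrow> \<tau> (ts ! i) = 0"
  using V.basis_modD(4)[OF bx] W.basis_modD(4)[OF bt] by (auto simp: subset_iff)

lemma \<sigma>_lcomb_xs: "\<sigma> (V.lcomb xs c) = 0"
  using V.lcomb_in[OF V.basis_modD(2,4)[OF bx]] by simp

lemma \<tau>_lcomb: "\<tau> (W.lcomb us c) = 0" "\<tau> (W.lcomb ts c) = 0"
  using W.lcomb_in[OF W.basis_modD(2)[OF bt], of us] W.lcomb_in[OF W.basis_modD(2)[OF bt], of ts]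
    W.basis_modD(4)[OF bt] by auto

lemma M_lcomb_ts: "M (W.lcomb ts c) = 0"
  by (simp add: W.lcomb_def M.sum M.scale Mts)

lemma N_lcomb_us: "N (W.lcomb us c) = 0"
  by (simp add: W.lcomb_def N.sum N.scale Nus)

lemma ker_\<sigma>_lcomb: "\<sigma> x = 0 \<Longrightarrow> \<exists>c. x = V.lcomb xs c"
  using V.basis_modD(5)[OF bx, of x] by auto

lemma ker_\<tau>_lcomb: "\<tau> y = 0 \<Longrightarrow> \<exists>a b. y = W.lcomb us a + W.lcomb ts b"
  using W.basis_modD(5)[OF bt, of y] by (auto simp: W.lcomb_append)

lemma L_proj: "L x = L (x - \<sigma>' (\<sigma> x))"
  by (simp add: L.diff L0)

lemma M_proj: "M y = M (y - \<tau>' (\<tau> y))"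
  by (simp add: M.diff M0)

lemma N_proj: "N y = N (y - \<tau>' (\<tau> y))"
  by (simp add: N.diff N0)

text \<open>\<open>bW\<close> makes the range of \<open>\<sigma>\<close>, the image of its kernel
  under \<open>L\<close> and the span of \<open>map N ts\<close> independent; the coefficients in
  this basis have to vanish.\<close>

lemma W_sum_zero:
  assumes "\<sigma> x + L v + N (W.lcomb ts b) = 0" "\<sigma> v = 0"
  shows "v = 0" "N (W.lcomb ts b) = 0" "\<And>i. i < length ts \<Longrightarrow> b i = 0"
proof -
  obtain a where a: "v = V.lcomb xs a" using ker_\<sigma>_lcomb assms(2) by blast
  let ?c = "\<lambda>i. if i < length (map L xs) then a i else b (i - length (map L xs))"
  have "W.lcomb (map L xs @ map N ts) ?c = L v + N (W.lcomb ts b)"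
    by (simp only: W.lcomb_append_split[symmetric] a linear_lcomb[OF linL] linear_lcomb[OF linN])
  also have "\<dots> = \<sigma> (- x)" using assms(1) by (simp add: \<sigma>.neg eq_neg_iff_add_eq_0 algebra_simps)
  finally have z: "i < length (map L xs @ map N ts) \<Longrightarrow> ?c i = 0" for i
    using W.basis_modD(6)[OF bW, of ?c i] by blast
  have "a i = 0" if "i < length xs" for i using z[of i] that by simp
  then show "v = 0" unfolding a using V.lcomb_cong[of xs a "\<lambda>i. 0"] by simp
  show b: "b i = 0" if "i < length ts" for i using z[of "length xs + i"] that by simp
  then have "W.lcomb ts b = 0" using W.lcomb_cong[of ts b "\<lambda>i. 0"] by simp
  then show "N (W.lcomb ts b) = 0" by (simp add: N.zero)
qed

lemma injA: "inj A"
proof (rule injI)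
  fix x y assume "A x = A y"
  then have "A (x - y) = 0" by (simp add: A.diff)
  then have 0: "\<sigma> (x - y) + L (x - y - \<sigma>' (\<sigma> (x - y))) + N (W.lcomb ts (\<lambda>i. 0)) = 0"
    by (simp add: A_def N.zero flip: L_proj)
  have "x - y - \<sigma>' (\<sigma> (x - y)) = 0" by (rule W_sum_zero(1)[OF 0 ker_proj(1)])
  moreover from this 0 have "\<sigma> (x - y) = 0" by (simp add: L.zero N.zero)
  ultimately show "x = y" by (simp add: \<sigma>'.zero)
qed

text \<open>The \<open>us\<close> part of the kernel supplies what the range of
  \<open>\<tau>\<close> misses; the \<open>ts\<close> part is invisible to \<open>B\<close> and
  serves to prescribe the value of \<open>N\<close>.\<close>

lemma B_surj: "\<exists>y. B y = v \<and> N y = N (W.lcomb ts b)"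
proof -
  obtain c where c: "v - V.lcomb (map M us) c \<in> range \<tau>" using V.basis_modD(5)[OF bV] by blast
  then obtain y where y: "v = \<tau> y + M (W.lcomb us c)" by (auto simp: linear_lcomb[OF linM] algebra_simps)
  let ?y = "\<tau>' (\<tau> y) + W.lcomb us c + W.lcomb ts b"
  have "B ?y = v" "N ?y = N (W.lcomb ts b)"
    by (simp_all add: B_def y \<tau>.add M.add N.add \<tau>_lcomb M_lcomb_ts N_lcomb_us M0 N0 pinv(3))
  then show ?thesis by blast
qed

text \<open>\<open>B\<close> is onto with kernel spanned by \<open>ts\<close>, \<open>A\<close> is
  injective, and \<open>N\<close> sends \<open>ts\<close> to a basis of a complement of the image of
  \<open>A\<close>: the last term repairs exactly the defect of the composite.\<close>

lemma bij_Sig: "bij Sig"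
proof (rule bijI)
  show "inj Sig"
  proof (rule injI)
    fix y z assume "Sig y = Sig z"
    then have "Sig (y - z) = 0" by (simp add: Sig.diff)
    then have S: "A (B (y - z)) + N (y - z) = 0" by (simp add: Sig_def)
    let ?q = "y - z - \<tau>' (\<tau> (y - z))"
    have "\<tau> ?q = 0" by (rule ker_proj)
    then obtain a b where q: "?q = W.lcomb us a + W.lcomb ts b" using ker_\<tau>_lcomb by blast
    have Nq: "N (y - z) = N (W.lcomb ts b)"
      using q N_proj[of "y - z"] by (simp add: N.add N_lcomb_us)
    let ?v = "B (y - z) - \<sigma>' (\<sigma> (B (y - z)))"
    have 0: "\<sigma> (B (y - z)) + L ?v + N (W.lcomb ts b) = 0"
      using S by (simp add: A_def Nq flip: L_proj)
    have v: "\<sigma> ?v = 0" by (rule ker_proj)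
    have b0: "W.lcomb ts b = 0" using W_sum_zero(3)[OF 0 v] W.lcomb_cong[of ts b "\<lambda>i. 0"] by simp
    then have "A (B (y - z)) = A 0" using S Nq by (simp add: N.zero A.zero)
    then have B0: "B (y - z) = 0" using injA by (blast dest: injD)
    then have "\<tau> (y - z) + M (W.lcomb us a) = 0"
      using M_proj[of "y - z"] q by (simp add: B_def b0)
    then have "V.lcomb (map M us) a = - \<tau> (y - z)"
      unfolding linear_lcomb[OF linM] by (rule minus_unique[symmetric])
    then have "V.lcomb (map M us) a = \<tau> (- (y - z))" by (simp only: \<tau>.neg)
    then have "a i = 0" if "i < length us" for i
      using V.basis_modD(6)[OF bV, of a i] that by simp
    then have a0: "W.lcomb us a = 0" using W.lcomb_cong[of us a "\<lambda>i. 0"] by simp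
    have "\<tau> (y - z) = 0" using \<open>\<tau> (y - z) + M (W.lcomb us a) = 0\<close> a0 by (simp add: M.zero)
    then show "y = z" using q a0 b0 by (simp add: \<tau>'.zero)
  qed
  show "surj Sig"
    unfolding surj_def
  proof
    fix w
    obtain c where "w - W.lcomb (map L xs @ map N ts) c \<in> range \<sigma>" using W.basis_modD(5)[OF bW] by blast
    then obtain v a b where w: "w = \<sigma> v + L (V.lcomb xs a) + N (W.lcomb ts b)"
      by (auto simp: W.lcomb_append linear_lcomb[OF linL] linear_lcomb[OF linN] algebra_simps)
    obtain y where "B y = \<sigma>' (\<sigma> v) + V.lcomb xs a" "N y = N (W.lcomb ts b)" using B_surj by blast
    then have "Sig y = w"
      by (simp add: Sig_def A_def w \<sigma>.add L.add L0 pinv(1) \<sigma>_lcomb_xs)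
    then show "\<exists>y. w = Sig y" by blast
  qed
qed

lemma finite_rank_LMN: "finite_rank s2 L" "finite_rank s1 M" "finite_rank s2 N"
proof -
  have "range L \<subseteq> W.span (set (map L xs))"
  proof safe
    fix x
    obtain c where "x - \<sigma>' (\<sigma> x) = V.lcomb xs c" using ker_\<sigma>_lcomb[OF ker_proj(1)] by blast
    then have "L x = W.lcomb (map L xs) c" using L_proj[of x] linear_lcomb[OF linL] by simp
    then show "L x \<in> W.span (set (map L xs))" by (simp only: W.lcomb_in_span)
  qed
  then show "finite_rank s2 L" unfolding finite_rank_def by blast
  have q: "\<exists>c. y - \<tau>' (\<tau> y) = W.lcomb (us @ ts) c" for y
    using W.basis_modD(5)[OF bt, of "y - \<tau>' (\<tau> y)"] ker_proj(2)[of y] by simp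
  have "range M \<subseteq> V.span (set (map M (us @ ts)))"
  proof safe
    fix y
    obtain c where "y - \<tau>' (\<tau> y) = W.lcomb (us @ ts) c" using q by blast
    then have "M y = V.lcomb (map M (us @ ts)) c" using M_proj[of y] linear_lcomb[OF linM] by simp
    then show "M y \<in> V.span (set (map M (us @ ts)))" by (simp only: V.lcomb_in_span)
  qed
  then show "finite_rank s1 M" unfolding finite_rank_def by blast
  have "range N \<subseteq> W.span (set (map N (us @ ts)))"
  proof safe
    fix y
    obtain c where "y - \<tau>' (\<tau> y) = W.lcomb (us @ ts) c" using q by blast
    then have "N y = W.lcomb (map N (us @ ts)) c" using N_proj[of y] linear_lcomb[OF linN] by simp
    then show "N y \<in> W.span (set (map N (us @ ts)))" by (simp only: W.lcomb_in_span)
  qed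
  then show "finite_rank s2 N" unfolding finite_rank_def by blast
qed

lemma finite_rank_Sig: "finite_rank s2 (\<lambda>y. y - Sig y)"
proof -
  have "finite_rank s2 (\<lambda>y. (y - \<sigma> (\<tau> y)) - (\<sigma> (M y) + (L (B y) + N y)))"
    by (intro W.finite_rank_add fin_st finite_rank_linear[OF lin(1)] finite_rank_LMN
        W.finite_rank_comp[of L B])
  then show ?thesis by (simp add: Sig_def A_def B_def \<sigma>.add algebra_simps)
qed

lemma det_class_Sig: "determinant_class s2 Sig"
  unfolding determinant_class_def
  using bij_Sig finite_rank_Sig linSig unfolding lin_map_def by blast

text \<open>With \<open>B' = B \<Sigma>\<^sup>-\<^sup>1\<close> one has \<open>B' A = 1\<close>, so inserting \<open>R\<close> between \<open>A\<close> and \<open>B\<close> amounts to composing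
  \<open>\<Sigma>\<close> with \<open>Y = 1 + A (R - 1) B'\<close>, and \<open>Y A = A R\<close>.\<close>

lemma insert_op_det:
  assumes R: "lin_map s1 s1 R" and fR: "finite_rank s1 (\<lambda>x. x - R x)"
  shows "op_det s2 (\<lambda>y. A (R (B y)) + N y) = op_det s1 R * op_det s2 Sig"
    and "finite_rank s2 (\<lambda>y. y - (A (R (B y)) + N y))"
    and "lin_map s2 s2 (\<lambda>y. A (R (B y)) + N y)"
proof -
  interpret R: lin_map s1 s1 R by fact
  have inv: "inv_into UNIV Sig (Sig y) = y" for y using bij_Sig by (simp add: bij_is_inj)
  interpret I: lin_map s2 s2 "inv_into UNIV Sig" by (rule lin_map_inv[OF linSig bij_Sig])
  define B' where "B' = (\<lambda>w. B (inv_into UNIV Sig w))"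
  have linB': "lin_map s2 s1 B'" unfolding B'_def by (rule lin_map_comp[OF I.lin_map_axioms linB])
  interpret B': lin_map s2 s1 B' by (rule linB')
  have B'A: "B' (A v) = v" for v
  proof -
    \<comment> \<open>Among the preimages under \<open>B\<close> one with \<open>N y = 0\<close> is
      taken, so that \<open>Sig y\<close> is \<open>A v\<close> without a correction.\<close>
    obtain y where y: "B y = v" "N y = N (W.lcomb ts (\<lambda>i. 0))" using B_surj by blast
    then have "Sig y = A v" by (simp add: Sig_def N.zero)
    then have "inv_into UNIV Sig (A v) = y" using inv by metis
    then show ?thesis by (simp add: B'_def y)
  qed
  define Y where "Y = (\<lambda>w. w + A (R (B' w) - B' w))"
  have linY: "lin_map s2 s2 Y"
    unfolding Y_def by unfold_locales
      (simp_all add: B'.add B'.scale R.add R.scale A.add A.diff A.scale W.scale_right_distrib W.scale_right_diff_distrib)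
  have YA: "Y (A x) = A (R x)" for x by (simp add: Y_def B'A A.diff)
  have rY: "range (\<lambda>y. y - Y y) \<subseteq> A ` range (\<lambda>x. x - R x)"
  proof safe
    fix y
    have "y - Y y = A (B' y - R (B' y))" by (simp add: Y_def A.diff)
    then show "y - Y y \<in> A ` range (\<lambda>x. x - R x)" by blast
  qed
  note det = op_det_intertwine[OF linA injA R fR linY YA rY]
  \<comment> \<open>\<open>B' Sig = B\<close>, so composing with \<open>Y\<close> replaces
    \<open>A B\<close> by \<open>A R B\<close> and leaves the term \<open>N\<close> in
    place.\<close>
  have eq: "Y (Sig y) = A (R (B y)) + N y" for y
    by (simp add: Y_def B'_def inv A.diff) (simp add: Sig_def)
  show "op_det s2 (\<lambda>y. A (R (B y)) + N y) = op_det s1 R * op_det s2 Sig"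
    using W.op_det_mult[OF linY det(2) linSig finite_rank_Sig] by (simp add: eq det(1))
  have "finite_rank s2 (\<lambda>y. (y - Sig y) + (Sig y - Y (Sig y)))"
    by (intro W.finite_rank_add finite_rank_Sig W.finite_rank_comp[OF det(2)])
  moreover have "(\<lambda>y. (y - Sig y) + (Sig y - Y (Sig y))) = (\<lambda>y. y - (A (R (B y)) + N y))"
    unfolding eq by (simp add: fun_eq_iff algebra_simps)
  ultimately show "finite_rank s2 (\<lambda>y. y - (A (R (B y)) + N y))" by (simp only:)
  show "lin_map s2 s2 (\<lambda>y. A (R (B y)) + N y)"
    by (rule lin_map_add[OF lin_map_comp[OF lin_map_comp[OF linB R] linA] linN])
qed

end

section \<open>Two triples for the same pseudo-inverses\<close>

lemma pert_op_det_change: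
  assumes "pert s1 s2 \<sigma> \<sigma>' \<tau> \<tau>' L1 M1 N1 xs1 us1 ts1" "pert s1 s2 \<sigma> \<sigma>' \<tau> \<tau>' L2 M2 N2 xs2 us2 ts2"
  shows "op_det s2 (pert.Sig \<sigma> \<tau> L2 M2 N2) =
      vsp.reldet s2 (range \<sigma>) (map L1 xs1 @ map N1 ts1) (map L2 xs2 @ map N2 ts2) *
      (vsp.reldet s1 (range \<sigma>') xs2 xs1 * vsp.reldet s1 (range \<tau>) (map M1 us1) (map M2 us2)) *
      op_det s2 (pert.Sig \<sigma> \<tau> L1 M1 N1) * vsp.reldet s2 (range \<tau>') (us2 @ ts2) (us1 @ ts1)"
    and "length xs1 = length xs2" "length us1 = length us2" "length ts1 = length ts2"
proof -
  interpret p1: pert s1 s2 \<sigma> \<sigma>' \<tau> \<tau>' L1 M1 N1 xs1 us1 ts1 by fact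
  interpret p2: pert s1 s2 \<sigma> \<sigma>' \<tau> \<tau>' L2 M2 N2 xs2 us2 ts2 by fact
  show lx: "length xs1 = length xs2" using p1.V.basis_mod_length[OF p2.bx p1.bx] .
  show lu: "length us1 = length us2" using p1.V.basis_mod_length[OF p2.bV p1.bV] by simp
  show lt: "length ts1 = length ts2" using p1.W.basis_mod_length[OF p2.bt p1.bt] lu by simp
  \<comment> \<open>\<open>T\<close> and \<open>R\<close> act after the maps and lead from the
    values of the first triple to those of the second; \<open>H\<close> and \<open>S\<close> act
    before them and lead from the kernel bases of the second triple back to those of the
    first.\<close>
  define T where "T = p1.W.shift (range \<sigma>) (map L1 xs1 @ map N1 ts1) (map L2 xs2 @ map N2 ts2)"
  define R where "R = p1.V.shift (range \<tau>) (map M1 us1) (map M2 us2)"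
  define H where "H = p1.V.shift (range \<sigma>') xs2 xs1"
  define S where "S = p1.W.shift (range \<tau>') (us2 @ ts2) (us1 @ ts1)"
  have lT: "length (map L2 xs2 @ map N2 ts2) = length (map L1 xs1 @ map N1 ts1)"
    and lR: "length (map M2 us2) = length (map M1 us1)" and lS: "length (us1 @ ts1) = length (us2 @ ts2)"
    using lx lu lt by simp_all
  note T = p1.W.shift_linear[OF p1.bW lT, folded T_def] p1.W.shift_finite_rank[OF p1.bW lT, folded T_def]
    and R = p1.V.shift_linear[OF p1.bV lR, folded R_def] p1.V.shift_finite_rank[OF p1.bV lR, folded R_def]
    and H = p1.V.shift_linear[OF p2.bx' lx, folded H_def] p1.V.shift_finite_rank[OF p2.bx' lx, folded H_def]
    and S = p1.W.shift_linear[OF p2.bt' lS, folded S_def] p1.W.shift_finite_rank[OF p2.bt' lS, folded S_def]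
  interpret T: lin_map s2 s2 T by (rule T)
  interpret R: lin_map s1 s1 R by (rule R)
  interpret H: lin_map s1 s1 H by (rule H)
  interpret S: lin_map s2 s2 S by (rule S)
  have Tfix: "T (\<sigma> x) = \<sigma> x" for x
    unfolding T_def by (rule p1.W.shift_fix[OF p1.bW lT]) simp
  have Txs: "T (L1 (xs1 ! i)) = L2 (xs2 ! i)" if "i < length xs2" for i
    using p1.W.shift_nth[OF p1.bW lT, of i] that lx unfolding T_def by (simp add: nth_append)
  have Tts: "T (N1 (ts1 ! i)) = N2 (ts2 ! i)" if "i < length ts2" for i
    using p1.W.shift_nth[OF p1.bW lT, of "length xs1 + i"] that lx lt unfolding T_def by (simp add: nth_append)
  have Rfix: "R (\<tau> y) = \<tau> y" for y
    unfolding R_def by (rule p1.V.shift_fix[OF p1.bV lR]) simp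
  have Rus: "R (M1 (us1 ! i)) = M2 (us2 ! i)" if "i < length us2" for i
    using p1.V.shift_nth[OF p1.bV lR, of i] that lu unfolding R_def by simp
  have Hfix: "H (\<sigma>' y) = \<sigma>' y" for y
    unfolding H_def by (rule p1.V.shift_fix[OF p2.bx' lx]) simp
  have Hxs: "H (xs2 ! i) = xs1 ! i" if "i < length xs2" for i
    using p1.V.shift_nth[OF p2.bx' lx, of i] that unfolding H_def by simp
  have Sfix: "S (\<tau>' x) = \<tau>' x" for x
    unfolding S_def by (rule p1.W.shift_fix[OF p2.bt' lS]) simp
  have Sus: "S (us2 ! i) = us1 ! i" if "i < length us2" for i
    using p1.W.shift_nth[OF p2.bt' lS, of i] that lu unfolding S_def by (simp add: nth_append)
  have Sts: "S (ts2 ! i) = ts1 ! i" if "i < length ts2" for i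
    using p1.W.shift_nth[OF p2.bt' lS, of "length us2 + i"] that lu unfolding S_def by (simp add: nth_append)
  \<comment> \<open>On the range of \<open>\<sigma>'\<close> both \<open>L1\<close> and
    \<open>L2\<close> vanish and all shifts act trivially; on \<open>xs2\<close> only the
    \<open>L\<close> terms remain.\<close>
  have TA: "T (p1.A (H v)) = p2.A v" for v
  proof (rule p1.V.basis_mod_ext_eq[OF p2.bx', where f = "\<lambda>v. T (p1.A (H v))" and g = p2.A])
    show "lin_map s1 s2 (\<lambda>v. T (p1.A (H v)))"
      by (rule lin_map_comp[OF lin_map_comp[OF H(1) p1.linA] T(1)])
    show "T (p1.A (H u)) = p2.A u" if "u \<in> range \<sigma>'" for u
      using that by (auto simp: Hfix p1.A_def p2.A_def p1.L0 p2.L0 Tfix)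
    show "T (p1.A (H (xs2 ! i))) = p2.A (xs2 ! i)" if "i < length xs2" for i
      using that lx by (simp add: Hxs p1.A_def p2.A_def p1.ker_nth p2.ker_nth Txs)
  qed (rule p2.linA)
  have HR: "lin_map s1 s1 (\<lambda>v. H (R v))" by (rule lin_map_comp[OF R(1) H(1)])
  have fHR: "finite_rank s1 (\<lambda>v. v - H (R v))"
  proof -
    have "finite_rank s1 (\<lambda>v. (v - R v) + (R v - H (R v)))"
      by (intro p1.V.finite_rank_add R(2) p1.V.finite_rank_comp[OF H(2)])
    then show ?thesis by simp
  qed
  note ins = p1.insert_op_det[OF HR fHR]
  let ?Z = "\<lambda>y. p1.A (H (R (p1.B y))) + N1 y"
  \<comment> \<open>Three cases: on the range of \<open>\<tau>'\<close> the maps \<open>M\<close>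
    and \<open>N\<close> vanish, on \<open>us2\<close> only the \<open>M\<close> term survives, on
    \<open>ts2\<close> only the \<open>N\<close> term.\<close>
  have eq: "p2.Sig y = T (?Z (S y))" for y
  proof (rule p1.W.basis_mod_ext_eq[OF p2.bt', symmetric, where f = "\<lambda>y. T (?Z (S y))" and g = p2.Sig])
    show "lin_map s2 s2 (\<lambda>y. T (?Z (S y)))" by (rule lin_map_comp[OF lin_map_comp[OF S(1) ins(3)] T(1)])
    show "T (?Z (S u)) = p2.Sig u" if "u \<in> range \<tau>'" for u
      using that by (auto simp: Sfix p1.B_def p2.B_def p2.Sig_def p1.M0 p1.N0 p2.M0 p2.N0 Rfix TA)
    show "T (?Z (S ((us2 @ ts2) ! i))) = p2.Sig ((us2 @ ts2) ! i)" if "i < length (us2 @ ts2)" for i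
    proof (cases "i < length us2")
      case True
      then show ?thesis using lu
        by (simp add: nth_append Sus p1.B_def p2.B_def p2.Sig_def p1.ker_nth p2.ker_nth p1.Nus p2.Nus Rus TA)
    next
      case False
      define k where "k = i - length us2"
      have k: "k < length ts2" "(us2 @ ts2) ! i = ts2 ! k" using False that by (auto simp: nth_append k_def)
      then show ?thesis using lt
        by (simp add: Sts p1.B_def p2.B_def p2.Sig_def p1.ker_nth p2.ker_nth p1.Mts p2.Mts Tts
            R.zero H.zero p1.A.zero p2.A.zero)
    qed
  qed (rule p2.linSig)
  have fZS: "finite_rank s2 (\<lambda>y. y - ?Z (S y))"
  proof -
    have "finite_rank s2 (\<lambda>v. (v - S v) + (S v - ?Z (S v)))"
      by (intro p1.W.finite_rank_add S(2) p1.W.finite_rank_comp[OF ins(2)])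
    then show ?thesis by (simp add: algebra_simps)
  qed
  have "op_det s2 p2.Sig = op_det s2 (\<lambda>y. T (?Z (S y)))" by (simp add: eq[abs_def])
  also have "\<dots> = op_det s2 T * (op_det s2 ?Z * op_det s2 S)"
    using p1.W.op_det_mult[OF T lin_map_comp[OF S(1) ins(3)] fZS] p1.W.op_det_mult[OF ins(3,2) S] by simp
  also have "op_det s2 ?Z = op_det s1 H * op_det s1 R * op_det s2 p1.Sig"
    using ins(1) p1.V.op_det_mult[OF H R] by simp
  also have "op_det s2 T = p1.W.reldet (range \<sigma>) (map L1 xs1 @ map N1 ts1) (map L2 xs2 @ map N2 ts2)"
    unfolding T_def by (rule p1.W.shift_op_det[OF p1.bW lT])
  also have "op_det s1 H = p1.V.reldet (range \<sigma>') xs2 xs1"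
    unfolding H_def by (rule p1.V.shift_op_det[OF p2.bx' lx])
  also have "op_det s1 R = p1.V.reldet (range \<tau>) (map M1 us1) (map M2 us2)"
    unfolding R_def by (rule p1.V.shift_op_det[OF p1.bV lR])
  also have "op_det s2 S = p1.W.reldet (range \<tau>') (us2 @ ts2) (us1 @ ts1)"
    unfolding S_def by (rule p1.W.shift_op_det[OF p2.bt' lS])
  finally show "op_det s2 p2.Sig = p1.W.reldet (range \<sigma>) (map L1 xs1 @ map N1 ts1) (map L2 xs2 @ map N2 ts2) *
      (p1.V.reldet (range \<sigma>') xs2 xs1 * p1.V.reldet (range \<tau>) (map M1 us1) (map M2 us2)) *
      op_det s2 p1.Sig * p1.W.reldet (range \<tau>') (us2 @ ts2) (us1 @ ts1)" by (simp only: mult.assoc)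
qed

text \<open>The scalar of the perturbation isomorphism with respect to bases \<open>gs\<close>, \<open>hs\<close> of the cokernels of
  \<open>\<sigma>'\<close>, \<open>\<sigma>\<close> and \<open>gs'\<close>, \<open>hs'\<close> of the cokernels of \<open>\<tau>\<close>, \<open>\<tau>'\<close>.\<close>

definition pert_scalar where
  "pert_scalar s1 s2 \<sigma> \<sigma>' \<tau> \<tau>' L M N xs us ts gs hs gs' hs' =
    vsp.reldet s1 (range \<tau>) gs' (map M us) * vsp.reldet s2 (range \<sigma>) hs (map L xs @ map N ts) /
    (vsp.reldet s2 (range \<tau>') hs' (us @ ts) * vsp.reldet s1 (range \<sigma>') gs xs *
      op_det s2 (pert.Sig \<sigma> \<tau> L M N))"

text \<open>Common reference bases, attached to the four operators and not to a triple; scalars of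
  different triples become comparable.\<close>

locale coker_bases = fred_pair +
  fixes gs hs gs' hs'
  assumes bg: "vsp.basis_mod s1 (range \<sigma>') UNIV gs" and bh: "vsp.basis_mod s2 (range \<sigma>) UNIV hs"
    and bg': "vsp.basis_mod s1 (range \<tau>) UNIV gs'" and bh': "vsp.basis_mod s2 (range \<tau>') UNIV hs'"

lemma (in vsp) reldet_basis_trans:
  assumes "basis_mod U K bs" "basis_mod U K ys" "basis_mod U K zs"
  shows "reldet U bs zs = reldet U bs ys * reldet U ys zs"
  by (rule reldet_trans[OF assms(1,2) basis_mod_length[OF assms(1,2)] basis_modD(4)[OF assms(3)]
        basis_mod_length[OF assms(1,3)]])

lemma pert_scalar_same_daggers:
  assumes p: "pert s1 s2 \<sigma> \<sigma>' \<tau> \<tau>' L1 M1 N1 xs1 us1 ts1" "pert s1 s2 \<sigma> \<sigma>' \<tau> \<tau>' L2 M2 N2 xs2 us2 ts2"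
    and c: "coker_bases s1 s2 \<sigma> \<sigma>' \<tau> \<tau>' gs hs gs' hs'"
  shows "pert_scalar s1 s2 \<sigma> \<sigma>' \<tau> \<tau>' L1 M1 N1 xs1 us1 ts1 gs hs gs' hs' =
    pert_scalar s1 s2 \<sigma> \<sigma>' \<tau> \<tau>' L2 M2 N2 xs2 us2 ts2 gs hs gs' hs'"
proof -
  interpret p1: pert s1 s2 \<sigma> \<sigma>' \<tau> \<tau>' L1 M1 N1 xs1 us1 ts1 by fact
  interpret p2: pert s1 s2 \<sigma> \<sigma>' \<tau> \<tau>' L2 M2 N2 xs2 us2 ts2 by fact
  interpret c: coker_bases s1 s2 \<sigma> \<sigma>' \<tau> \<tau>' gs hs gs' hs' by fact
  \<comment> \<open>A plain letter is a determinant relative to the reference bases, the same letter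
    with \<open>x\<close> the base change between the triples, and \<open>d\<close> the first
    determinant of \<Sigma>. The factors \<open>bx\<close> and \<open>cx\<close> of the target bases
    cancel, \<open>ax\<close> and \<open>ex\<close> stand in both denominators.\<close>
  have algebra: "c * b / (e * ex * (a * ax) * d) = (c * cx) * (b * bx) / (e * a * (bx * (ax * cx) * d * ex))"
    if "bx \<noteq> 0" "cx \<noteq> 0" for a ax b bx c cx d e ex :: 'a
  proof -
    have "(c * cx) * (b * bx) / (e * a * (bx * (ax * cx) * d * ex)) =
        ((bx * cx) * (c * b)) / ((bx * cx) * (e * ex * (a * ax) * d))" by (simp add: mult_ac)
    also have "\<dots> = c * b / (e * ex * (a * ax) * d)" using that by (intro mult_divide_mult_cancel_left) simp
    finally show ?thesis by simp
  qed
  show ?thesis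
    unfolding pert_scalar_def pert_op_det_change(1)[OF p]
      p1.V.reldet_basis_trans[OF c.bg' p1.bV p2.bV] p1.W.reldet_basis_trans[OF c.bh p1.bW p2.bW]
      p1.V.reldet_basis_trans[OF c.bg p2.bx' p1.bx'] p1.W.reldet_basis_trans[OF c.bh' p2.bt' p1.bt']
    by (rule algebra[OF p1.W.reldet_nonzero[OF p1.bW p2.bW] p1.V.reldet_nonzero[OF p1.bV p2.bV]])
qed

section \<open>Changing the pseudo-inverses\<close>

lemma basis_mod_bij:
  assumes F: "lin_map s1 s2 F" and inj: "inj F" and b: "vsp.basis_mod s1 U K bs"
  shows "vsp.basis_mod s2 (F ` U) (F ` K) (map F bs)"
proof -
  interpret F: lin_map s1 s2 F by fact
  note B = F.S.basis_modD[OF b]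
  have s: "F.vs2.subspace (F ` U)" "F.vs2.subspace (F ` K)" using F.subspace_image B(1,2) by blast+
  show ?thesis
  proof (rule basis_mod_map[OF F b s(1) order_refl _ s(2) _ order_refl])
    show "x \<in> U" if "F x \<in> F ` U" for x using that inj by (simp add: inj_image_mem_iff)
    show "F ` U \<subseteq> F ` K" using B(3) by (rule image_mono)
    show "\<exists>x\<in>K. y - F x \<in> F ` U" if "y \<in> F ` K" for y
    proof -
      obtain x where "x \<in> K" "y = F x" using \<open>y \<in> F ` K\<close> by blast
      moreover have "0 \<in> F ` U" using F.vs2.subspace_0[OF s(1)] .
      ultimately show ?thesis by (intro bexI[of _ x]) simp_all
    qed
  qed
qed

lemma range_intertwine:
  assumes "surj F" "\<And>x. g (F x) = G (h x)"
  shows "range g = G ` range h"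
proof -
  have "range g = g ` F ` UNIV" using assms(1) by simp
  then show ?thesis by (simp add: image_image assms(2))
qed

text \<open>\<open>F\<close> keeps coordinates if the reference basis is moved along, and the moved
  basis agrees with \<open>gs\<close> modulo \<open>U'\<close>. Here it enters that a change of
  pseudo-inverses acts trivially on cohomology.\<close>

lemma reldet_transport:
  assumes F: "lin_map s s F" and inj: "inj F" and U': "U' = F ` U" and sF: "surj F"
    and g: "vsp.basis_mod s U UNIV gs" "vsp.basis_mod s U' UNIV gs"
    and c: "\<And>g. g \<in> set gs \<Longrightarrow> F g - g \<in> U'" and z: "vsp.basis_mod s U UNIV zs"
  shows "vsp.reldet s U' gs (map F zs) = vsp.reldet s U gs zs"
proof -
  interpret F: lin_map s s F by fact
  have Fg: "F.S.basis_mod U' UNIV (map F gs)"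
    using basis_mod_bij[OF F inj g(1)] sF unfolding U' by simp
  have Fz: "F.S.basis_mod U' UNIV (map F zs)"
    using basis_mod_bij[OF F inj z] sF unfolding U' by simp
  have "F.S.reldet U' gs (map F zs) = F.S.reldet U' gs (map F gs) * F.S.reldet U' (map F gs) (map F zs)"
    by (rule F.S.reldet_basis_trans[OF g(2) Fg Fz])
  also have "F.S.reldet U' gs (map F gs) = F.S.reldet U' gs gs"
    by (rule F.S.reldet_cong_mod[OF g(2)]) (use c in auto)
  also have "F.S.reldet U' (map F gs) (map F zs) = F.S.reldet U gs zs"
    by (rule reldet_map[OF F g(1) Fg]) (use U' F.S.basis_mod_length[OF g(1) z] in auto)
  finally show ?thesis using F.S.reldet_self[OF g(2)] by simp
qed

text \<open>The new \<Sigma> is \<open>Vm A Vp' Wp B Wm' + Vm N Wm'\<close>, the conjugate by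
  \<open>Wm\<close> of the product of \<open>Wm' Vm\<close> and \<open>A (Vp' Wp) B + N\<close>. Its
  determinant thus differs from the old one by the determinants of \<open>Vp' Wp\<close> and
  \<open>Wm' Vm\<close>, which are 1.\<close>

lemma pert_transport:
  assumes p: "pert s1 s2 \<sigma>1 \<sigma>1' \<tau>1 \<tau>1' L M N xs us ts" and f: "fred_pair s1 s2 \<sigma>2 \<sigma>2' \<tau>2 \<tau>2'"
    and c: "coker_bases s1 s2 \<sigma>1 \<sigma>1' \<tau>1 \<tau>1' gs hs gs' hs'" "coker_bases s1 s2 \<sigma>2 \<sigma>2' \<tau>2 \<tau>2' gs hs gs' hs'"
    and l: "lin_map s1 s1 Vp" "lin_map s1 s1 Vp'" "lin_map s2 s2 Vm" "lin_map s2 s2 Vm'"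
      "lin_map s1 s1 Wp" "lin_map s1 s1 Wp'" "lin_map s2 s2 Wm" "lin_map s2 s2 Wm'"
    and inv: "\<And>x. Vp (Vp' x) = x" "\<And>x. Vp' (Vp x) = x" "\<And>y. Vm (Vm' y) = y" "\<And>y. Vm' (Vm y) = y"
      "\<And>x. Wp (Wp' x) = x" "\<And>x. Wp' (Wp x) = x" "\<And>y. Wm (Wm' y) = y" "\<And>y. Wm' (Wm y) = y"
    and i: "\<And>x. \<sigma>2 (Vp x) = Vm (\<sigma>1 x)" "\<And>y. \<sigma>2' (Vm y) = Vp (\<sigma>1' y)"
      "\<And>y. \<tau>2 (Wm y) = Wp (\<tau>1 y)" "\<And>x. \<tau>2' (Wp x) = Wm (\<tau>1' x)"
    and dets: "op_det s1 (\<lambda>x. Vp' (Wp x)) = 1" "finite_rank s1 (\<lambda>x. x - Vp' (Wp x))"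
      "op_det s2 (\<lambda>x. Wm' (Vm x)) = 1" "finite_rank s2 (\<lambda>x. x - Wm' (Vm x))"
    and cg: "\<And>g. g \<in> set gs \<Longrightarrow> Vp g - g \<in> range \<sigma>2'" "\<And>g. g \<in> set hs \<Longrightarrow> Vm g - g \<in> range \<sigma>2"
      "\<And>g. g \<in> set gs' \<Longrightarrow> Wp g - g \<in> range \<tau>2" "\<And>g. g \<in> set hs' \<Longrightarrow> Wm g - g \<in> range \<tau>2'"
  shows "pert s1 s2 \<sigma>2 \<sigma>2' \<tau>2 \<tau>2' (\<lambda>x. Vm (L (Vp' x))) (\<lambda>y. Wp (M (Wm' y))) (\<lambda>y. Vm (N (Wm' y)))
      (map Vp xs) (map Wm us) (map Wm ts)" (is ?pert)
    and "pert_scalar s1 s2 \<sigma>2 \<sigma>2' \<tau>2 \<tau>2' (\<lambda>x. Vm (L (Vp' x))) (\<lambda>y. Wp (M (Wm' y))) (\<lambda>y. Vm (N (Wm' y)))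
      (map Vp xs) (map Wm us) (map Wm ts) gs hs gs' hs' =
      pert_scalar s1 s2 \<sigma>1 \<sigma>1' \<tau>1 \<tau>1' L M N xs us ts gs hs gs' hs'" (is ?scal)
proof -
  interpret p: pert s1 s2 \<sigma>1 \<sigma>1' \<tau>1 \<tau>1' L M N xs us ts by fact
  interpret f: fred_pair s1 s2 \<sigma>2 \<sigma>2' \<tau>2 \<tau>2' by fact
  interpret c1: coker_bases s1 s2 \<sigma>1 \<sigma>1' \<tau>1 \<tau>1' gs hs gs' hs' by fact
  interpret c2: coker_bases s1 s2 \<sigma>2 \<sigma>2' \<tau>2 \<tau>2' gs hs gs' hs' by fact
  interpret Vp: lin_map s1 s1 Vp by fact
  interpret Vp': lin_map s1 s1 Vp' by fact
  interpret Vm: lin_map s2 s2 Vm by fact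
  interpret Vm': lin_map s2 s2 Vm' by fact
  interpret Wp: lin_map s1 s1 Wp by fact
  interpret Wp': lin_map s1 s1 Wp' by fact
  interpret Wm: lin_map s2 s2 Wm by fact
  interpret Wm': lin_map s2 s2 Wm' by fact
  have inj: "inj Vp" "inj Vm" "inj Wp" "inj Wm" by (metis inv injI)+
  have surj: "surj Vp" "surj Vm" "surj Wp" "surj Wm" by (metis inv surjI)+
  have r: "range \<sigma>2 = Vm ` range \<sigma>1" "range \<sigma>2' = Vp ` range \<sigma>1'"
      "range \<tau>2 = Wp ` range \<tau>1" "range \<tau>2' = Wm ` range \<tau>1'"
    by (rule range_intertwine[where F = Vp, OF surj(1)] range_intertwine[where F = Vm, OF surj(2)]
        range_intertwine[where F = Wm, OF surj(4)] range_intertwine[where F = Wp, OF surj(3)], rule i)+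
  have inv0: "Vp x = 0 \<longleftrightarrow> x = 0" "Vm y = 0 \<longleftrightarrow> y = 0" "Wp x = 0 \<longleftrightarrow> x = 0" "Wm y = 0 \<longleftrightarrow> y = 0" for x y
    using inv Vp.zero Vm.zero Wp.zero Wm.zero Vp'.zero Vm'.zero Wp'.zero Wm'.zero by metis+
  have k: "{x. \<sigma>2 x = 0} = Vp ` {x. \<sigma>1 x = 0}" "{y. \<tau>2 y = 0} = Wm ` {y. \<tau>1 y = 0}"
  proof -
    have "x \<in> Vp ` {x. \<sigma>1 x = 0}" if "\<sigma>2 x = 0" for x
      by (rule image_eqI[of _ _ "Vp' x"]) (use that i(1)[of "Vp' x"] in \<open>simp_all add: inv inv0\<close>)
    then show "{x. \<sigma>2 x = 0} = Vp ` {x. \<sigma>1 x = 0}" by (auto simp: i inv0)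
    have "y \<in> Wm ` {y. \<tau>1 y = 0}" if "\<tau>2 y = 0" for y
      by (rule image_eqI[of _ _ "Wm' y"]) (use that i(3)[of "Wm' y"] in \<open>simp_all add: inv inv0\<close>)
    then show "{y. \<tau>2 y = 0} = Wm ` {y. \<tau>1 y = 0}" by (auto simp: i inv0)
  qed
  have i': "Vp' (\<sigma>2' y) = \<sigma>1' (Vm' y)" "Wm' (\<tau>2' x) = \<tau>1' (Wp' x)" for x y
    using i(2)[of "Vm' y"] i(4)[of "Wp' x"] by (metis inv)+
  let ?L = "\<lambda>x. Vm (L (Vp' x))" and ?M = "\<lambda>y. Wp (M (Wm' y))" and ?N = "\<lambda>y. Vm (N (Wm' y))"
  have m: "map ?L (map Vp xs) @ map ?N (map Wm ts) = map Vm (map L xs @ map N ts)"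
    "map ?M (map Wm us) = map Wp (map M us)"
    by (simp_all add: inv)
  show pert2: ?pert
  proof unfold_locales
    show "p.V.basis_mod {0} {x. \<sigma>2 x = 0} (map Vp xs)"
      using basis_mod_bij[OF l(1) inj(1) p.bx] by (simp add: k Vp.zero)
    show "p.W.basis_mod {0} {y. \<tau>2 y = 0} (map Wm us @ map Wm ts)"
      using basis_mod_bij[OF l(7) inj(4) p.bt] by (simp add: k Wm.zero)
    show "p.W.basis_mod (range \<sigma>2) UNIV (map ?L (map Vp xs) @ map ?N (map Wm ts))"
      unfolding m r using basis_mod_bij[OF l(3) inj(2) p.bW] surj by simp
    show "p.V.basis_mod (range \<tau>2) UNIV (map ?M (map Wm us))"
      unfolding m r using basis_mod_bij[OF l(5) inj(3) p.bV] surj by simp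
  qed (auto simp: i' inv inv0 p.L0 p.M0 p.N0 p.Mts p.Nus Vm.zero Wp.zero
      Vm.add Vm.scale Vp'.add Vp'.scale Wp.add Wp.scale Wm'.add Wm'.scale
      p.L.add p.L.scale p.M.add p.M.scale p.N.add p.N.scale)
  interpret p2: pert s1 s2 \<sigma>2 \<sigma>2' \<tau>2 \<tau>2' ?L ?M ?N "map Vp xs" "map Wm us" "map Wm ts" by (rule pert2)
  let ?S = "\<lambda>y. p.A (Vp' (Wp (p.B y))) + N y"
  note ins = p.insert_op_det[OF lin_map_comp[OF l(5) l(2)] dets(2)]
  have A2: "p2.A x = Vm (p.A (Vp' x))" for x
    using i(1)[of "Vp' x"] by (simp add: p2.A_def p.A_def Vm.add inv)
  have B2: "p2.B y = Wp (p.B (Wm' y))" for y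
    using i(3)[of "Wm' y"] by (simp add: p2.B_def p.B_def Wp.add inv)
  have Sig2: "p2.Sig (Wm y) = Wm (Wm' (Vm (?S y)))" for y
    by (simp add: p2.Sig_def A2 B2 Vm.add inv)
  note WV = lin_map_comp[OF l(3) l(8)]
  have fS: "finite_rank s2 (\<lambda>y. y - Wm' (Vm (?S y)))"
  proof -
    have "finite_rank s2 (\<lambda>y. (y - ?S y) + (?S y - Wm' (Vm (?S y))))"
      by (intro p.W.finite_rank_add ins(2) p.W.finite_rank_comp[OF dets(4)])
    then show ?thesis by (simp add: algebra_simps)
  qed
  have rS: "range (\<lambda>y. y - p2.Sig y) \<subseteq> Wm ` range (\<lambda>y. y - Wm' (Vm (?S y)))"
  proof safe
    fix y
    have "y - p2.Sig y = Wm (Wm' y - Wm' (Vm (?S (Wm' y))))"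
      using Sig2[of "Wm' y"] by (simp add: Wm.diff inv)
    then show "y - p2.Sig y \<in> Wm ` range (\<lambda>y. y - Wm' (Vm (?S y)))" by blast
  qed
  have "op_det s2 p2.Sig = op_det s2 (\<lambda>y. Wm' (Vm (?S y)))"
    by (rule op_det_intertwine(1)[OF l(7) inj(4) lin_map_comp[OF ins(3) WV] fS p2.linSig Sig2 rS])
  also have "\<dots> = op_det s2 p.Sig"
    using p.W.op_det_mult[OF WV dets(4) ins(3,2)] ins(1) dets(1,3) by simp
  finally have det: "op_det s2 p2.Sig = op_det s2 p.Sig" .
  have "p.V.reldet (range \<tau>2) gs' (map ?M (map Wm us)) = p.V.reldet (range \<tau>1) gs' (map M us)"
    unfolding m by (rule reldet_transport[OF l(5) inj(3) r(3) surj(3) c1.bg' c2.bg' cg(3) p.bV])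
  moreover have "p.W.reldet (range \<sigma>2) hs (map ?L (map Vp xs) @ map ?N (map Wm ts)) =
      p.W.reldet (range \<sigma>1) hs (map L xs @ map N ts)"
    unfolding m by (rule reldet_transport[OF l(3) inj(2) r(1) surj(2) c1.bh c2.bh cg(2) p.bW])
  moreover have "p.W.reldet (range \<tau>2') hs' (map Wm us @ map Wm ts) = p.W.reldet (range \<tau>1') hs' (us @ ts)"
    unfolding map_append[symmetric]
    by (rule reldet_transport[OF l(7) inj(4) r(4) surj(4) c1.bh' c2.bh' cg(4) p.bt'])
  moreover have "p.V.reldet (range \<sigma>2') gs (map Vp xs) = p.V.reldet (range \<sigma>1') gs xs"
    by (rule reldet_transport[OF l(1) inj(1) r(2) surj(1) c1.bg c2.bg cg(1) p.bx'])
  ultimately show ?scal unfolding pert_scalar_def det by (simp only:)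
qed

section \<open>Complexes with a pseudo-inverse and the change of the pseudo-inverse\<close>

locale cpx =
  fixes s1 :: "'f::field \<Rightarrow> 'a::ab_group_add \<Rightarrow> 'a" and s2 :: "'f \<Rightarrow> 'b::ab_group_add \<Rightarrow> 'b"
    and dp :: "'a \<Rightarrow> 'b" and dm :: "'b \<Rightarrow> 'a" and dp' :: "'b \<Rightarrow> 'a" and dm' :: "'a \<Rightarrow> 'b"
  assumes lin: "lin_map s1 s2 dp" "lin_map s2 s1 dm" "lin_map s2 s1 dp'" "lin_map s1 s2 dm'"
    and cc: "\<And>x. dm (dp x) = 0" "\<And>y. dp (dm y) = 0" "\<And>y. dm' (dp' y) = 0" "\<And>x. dp' (dm' x) = 0"
    and pinv: "\<And>x. dp (dp' (dp x)) = dp x" "\<And>y. dm (dm' (dm y)) = dm y"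
      "\<And>y. dp' (dp (dp' y)) = dp' y" "\<And>x. dm' (dm (dm' x)) = dm' x"
begin

lemma swap: "cpx s2 s1 dm dp dm' dp'"
  by (rule cpx.intro) (simp_all add: lin cc pinv)

sublocale V: vsp s1
proof -
  interpret lin_map s1 s2 dp by (rule lin)
  show "vsp s1" by unfold_locales
qed

sublocale W: vsp s2
proof -
  interpret lin_map s1 s2 dp by (rule lin)
  show "vsp s2" by unfold_locales
qed

sublocale dp: lin_map s1 s2 dp by (rule lin)
sublocale dm: lin_map s2 s1 dm by (rule lin)
sublocale dp': lin_map s2 s1 dp' by (rule lin)
sublocale dm': lin_map s1 s2 dm' by (rule lin)

lemmas expand = dp.add dp.diff dp.zero dm.add dm.diff dm.zero
  dp'.add dp'.diff dp'.zero dm'.add dm'.diff dm'.zero cc pinv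

definition sg where "sg x = dp x + dm' x"
definition sg' where "sg' y = dm y + dp' y"

lemma lin_sg: "lin_map s1 s2 sg" "lin_map s2 s1 sg'"
  unfolding sg_def sg'_def by (intro lin_map_add lin)+

lemma sg_pinv: "sg (sg' (sg x)) = sg x" "sg' (sg (sg' y)) = sg' y"
  by (simp_all add: sg_def sg'_def expand)

text \<open>The range of \<open>sg'\<close> consists of the range of \<open>dm\<close>, which lies
  in the kernel of \<open>dp\<close>, and the range of \<open>dp'\<close>, which is a complement of
  that kernel. Representatives of the cohomology are therefore a basis of the cokernel for every
  pseudo-inverse.\<close>

lemma basis_coker:
  assumes b: "V.basis_mod (range dm) {x. dp x = 0} gs"
  shows "V.basis_mod (range sg') UNIV gs"
proof -
  have "lin_map s1 s1 (\<lambda>x. x)" by unfold_locales auto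
  from basis_mod_map[OF this b, of "range sg'" UNIV] show ?thesis
  proof (rule back_subst[of "V.basis_mod (range sg') UNIV"])
    interpret sg': lin_map s2 s1 sg' by (rule lin_sg)
    show "module.subspace s1 (range sg')" using sg'.subspace_image[OF W.subspace_UNIV] .
    show "(\<lambda>x. x) ` range dm \<subseteq> range sg'"
    proof safe
      fix y
      have "dm y = sg' (dm' (dm y))" by (simp add: sg'_def expand)
      then show "dm y \<in> range sg'" by blast
    qed
    show "x \<in> range dm" if x: "x \<in> {x. dp x = 0}" "x \<in> range sg'" for x
    proof -
      obtain y where y: "x = dm y + dp' y" using x by (auto simp: sg'_def)
      then have "dp (dp' y) = 0" using x by (simp add: expand)
      then have "dp' y = 0" using pinv(3)[of y] by (simp add: dp'.zero)
      then show ?thesis using y by simp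
    qed
    show "\<exists>x\<in>{x. dp x = 0}. y - x \<in> range sg'" for y
    proof (rule bexI)
      show "y - (y - sg' (sg y)) \<in> range sg'" by simp
      show "y - sg' (sg y) \<in> {x. dp x = 0}" by (simp add: sg_def sg'_def expand)
    qed
  qed simp_all
qed

end

text \<open>The projection \<open>1 - sg' sg\<close> onto the kernel of \<open>sg\<close>, with the
  products that vanish omitted.\<close>

definition harm where "harm dp dm dp' dm' x = x - dm (dm' x) - dp' (dp x)"

text \<open>This carries the decomposition \<open>Im d\<^sub>- \<oplus> ker \<sigma>\<^sub>+ \<oplus> Im d\<^sub>+\<^sup>\<dagger>\<close> for the first pseudo-inverse to the one
  for the second.  It preserves the flag \<open>Im d\<^sub>- \<subseteq> ker d\<^sub>+ \<subseteq> X\<^sub>+\<close> and acts trivially on its quotients.\<close>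

definition chg where
  "chg dp dm dp1 dm1 dp2 dm2 x =
    dm (dm1 x) + harm dp dm dp2 dm2 (harm dp dm dp1 dm1 x) + dp2 (dp x)"

locale cpx_two = c1: cpx s1 s2 dp dm dp1 dm1 + c2: cpx s1 s2 dp dm dp2 dm2
  for s1 :: "'f::field \<Rightarrow> 'a::ab_group_add \<Rightarrow> 'a" and s2 :: "'f \<Rightarrow> 'b::ab_group_add \<Rightarrow> 'b"
    and dp :: "'a \<Rightarrow> 'b" and dm :: "'b \<Rightarrow> 'a" and dp1 :: "'b \<Rightarrow> 'a" and dm1 :: "'a \<Rightarrow> 'b"
    and dp2 :: "'b \<Rightarrow> 'a" and dm2 :: "'a \<Rightarrow> 'b"
begin

abbreviation "V12 \<equiv> chg dp dm dp1 dm1 dp2 dm2"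
abbreviation "V21 \<equiv> chg dp dm dp2 dm2 dp1 dm1"

text \<open>With the projections multiplied out, the inverse, the nilpotency and the finite rank of
  differences can be read off from a polynomial.\<close>

lemma chg_eq: "V12 x = x + dm (dm1 x) - dm (dm2 x) - dp1 (dp x) + dp2 (dp x) + dm (dm2 (dp1 (dp x)))"
  unfolding chg_def harm_def by (simp add: c1.expand c2.expand algebra_simps)

lemma linear_chg: "lin_map s1 s1 V12"
  unfolding chg_eq[abs_def]
  by (intro lin_map_add lin_map_diff lin_map_comp[OF _ c1.lin(1)] lin_map_comp[OF _ c1.lin(2)]
      lin_map_comp[OF _ c1.lin(3)] lin_map_comp[OF _ c2.lin(3)] lin_map_comp[OF _ c2.lin(4)] c1.lin c2.lin)
     (unfold_locales, auto)

lemma chg_inverse: "V21 (V12 x) = x"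
proof -
  interpret r: cpx_two s1 s2 dp dm dp2 dm2 dp1 dm1 by unfold_locales
  show ?thesis unfolding chg_eq r.chg_eq by (simp add: c1.expand c2.expand algebra_simps)
qed

text \<open>\<open>V12 - 1\<close> maps the whole space into the kernel of \<open>dp\<close>, that
  kernel into the range of \<open>dm\<close>, and this range to zero.\<close>

lemma chg_nilpotent:
  assumes "\<And>x. n x = V12 x - x"
  shows "n (n (n x)) = 0"
  unfolding assms chg_eq by (simp add: c1.expand c2.expand algebra_simps)

text \<open>Both sides are \<open>dp x + dm2 (dm (dm1 x))\<close>, since the harmonic summands are
  killed.\<close>

lemma chg_intertwine: "c2.sg (V12 x) = chg dm dp dm1 dp1 dm2 dp2 (c1.sg x)"
proof -
  interpret r: cpx_two s2 s1 dm dp dm1 dp1 dm2 dp2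
    unfolding cpx_two_def using c1.swap c2.swap by simp
  show ?thesis unfolding r.chg_eq chg_eq c1.sg_def c2.sg_def
    by (simp add: c1.expand c2.expand algebra_simps)
qed

lemma chg_cong:
  assumes "dp g = 0"
  shows "V12 g - g \<in> range c2.sg'"
proof -
  \<comment> \<open>The displacement of a cocycle is \<open>dm (dm1 g) - dm (dm2 g)\<close>.
    Rewriting \<open>dm1 g\<close> as \<open>dm2 (dm (dm1 g))\<close> puts the argument into the
    range of \<open>dm2\<close>, where \<open>dp2\<close> vanishes and \<open>sg'\<close> acts as
    \<open>dm\<close>.\<close>
  have "V12 g - g = c2.sg' (dm2 (dm (dm1 g)) - dm2 g)"
    unfolding chg_eq c2.sg'_def by (simp add: assms c1.expand c2.expand algebra_simps)
  then show ?thesis by blast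
qed

end

text \<open>A congruence for sums and composites, so that equal polynomials in congruent operators
  are congruent.\<close>

definition fr_eq where "fr_eq s f g \<longleftrightarrow> finite_rank s (\<lambda>x. f x - g x)"

lemma (in vsp) fr_eq_add:
  assumes "fr_eq scale f g" "fr_eq scale h k"
  shows "fr_eq scale (\<lambda>x. f x + h x) (\<lambda>x. g x + k x)" "fr_eq scale (\<lambda>x. f x - h x) (\<lambda>x. g x - k x)"
proof -
  have "(\<lambda>x. f x + h x - (g x + k x)) = (\<lambda>x. (f x - g x) + (h x - k x))"
    "(\<lambda>x. f x - h x - (g x - k x)) = (\<lambda>x. (f x - g x) - (h x - k x))"
    by (simp_all add: fun_eq_iff algebra_simps)
  then show "fr_eq scale (\<lambda>x. f x + h x) (\<lambda>x. g x + k x)" "fr_eq scale (\<lambda>x. f x - h x) (\<lambda>x. g x - k x)"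
    using assms finite_rank_add unfolding fr_eq_def by simp_all
qed

lemma (in vsp) fr_eq_refl: "fr_eq scale f f"
  by (simp add: fr_eq_def finite_rank_zero)

lemma fr_eq_comp:
  assumes h: "lin_map s1 s2 h" and hk: "fr_eq s2 h k" and fg: "fr_eq s1 f g"
  shows "fr_eq s2 (\<lambda>x. h (f x)) (\<lambda>x. k (g x))"
proof -
  interpret h: lin_map s1 s2 h by fact
  have "finite_rank s2 (\<lambda>x. h (f x - g x) + (h (g x) - k (g x)))"
    using h.T.finite_rank_add(1)[OF finite_rank_linear[OF h fg[unfolded fr_eq_def]]
        h.T.finite_rank_comp[OF hk[unfolded fr_eq_def]]] .
  then show ?thesis unfolding fr_eq_def by (simp add: h.diff)
qed

text \<open>\<open>sg sg'\<close> fixes the range of \<open>sg\<close>, whose cokernel has the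
  finite basis \<open>hs\<close>; so it is the identity up to finite rank. The second factor may
  then be replaced by the congruent one of the other complex.\<close>

lemma cpx_fred_pair:
  assumes d: "cpx s1 s2 dp dm dp' dm'" and e: "cpx s1 s2 ep em ep' em'"
    and fr: "fr_eq s1 dm em" "fr_eq s1 dp' ep'"
    and b: "vsp.basis_mod s2 (range dp) {y. dm y = 0} hs"
  shows "fred_pair s1 s2 (cpx.sg dp dm') (cpx.sg' dm dp') (cpx.sg' em ep') (cpx.sg ep em')"
proof -
  interpret d: cpx s1 s2 dp dm dp' dm' by fact
  interpret e: cpx s1 s2 ep em ep' em' by fact
  interpret ds: cpx s2 s1 dm dp dm' dp' by (rule d.swap)
  have h: "d.W.basis_mod (range d.sg) UNIV hs"
    using ds.basis_coker[OF b] unfolding ds.sg'_def[abs_def] d.sg_def[abs_def] .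
  have 1: "finite_rank s2 (\<lambda>y. y - d.sg (d.sg' y))"
    by (rule d.W.op_det_mod(2)[OF lin_map_comp[OF d.lin_sg(2,1)] h]) (auto simp: d.sg_pinv)
  have "fr_eq s1 d.sg' e.sg'"
    unfolding d.sg'_def[abs_def] e.sg'_def[abs_def] by (intro d.V.fr_eq_add fr)
  then have 2: "fr_eq s2 (\<lambda>y. d.sg (d.sg' y)) (\<lambda>y. d.sg (e.sg' y))"
    by (rule fr_eq_comp[OF d.lin_sg(1) d.W.fr_eq_refl, of d.sg' e.sg'])
  have "finite_rank s2 (\<lambda>y. (y - d.sg (d.sg' y)) + (d.sg (d.sg' y) - d.sg (e.sg' y)))"
    using 1 2 unfolding fr_eq_def by (rule d.W.finite_rank_add(1))
  then have 3: "finite_rank s2 (\<lambda>y. y - d.sg (e.sg' y))" by (simp add: algebra_simps)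
  show ?thesis
    by (rule fred_pair.intro) (simp_all add: d.lin_sg e.lin_sg d.sg_pinv e.sg_pinv 3)
qed

text \<open>The first triple is transported to the second pair of pseudo-inverses without changing
  its scalar; there it is compared with the second triple.\<close>

lemma pert_scalar_unique:
  assumes d: "cpx s1 s2 dp dm dp1 dm1" "cpx s1 s2 dp dm dp2 dm2"
    and e: "cpx s1 s2 ep em ep1 em1" "cpx s1 s2 ep em ep2 em2"
    and fr: "fr_eq s2 dp ep" "fr_eq s1 dm em" "fr_eq s1 dp1 ep1" "fr_eq s2 dm1 em1"
      "fr_eq s1 dp2 ep2" "fr_eq s2 dm2 em2"
    and b: "vsp.basis_mod s1 (range dm) {x. dp x = 0} gs" "vsp.basis_mod s2 (range dp) {y. dm y = 0} hs"
      "vsp.basis_mod s1 (range em) {x. ep x = 0} gs'" "vsp.basis_mod s2 (range ep) {y. em y = 0} hs'"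
    and p: "pert s1 s2 (cpx.sg dp dm1) (cpx.sg' dm dp1) (cpx.sg' em ep1) (cpx.sg ep em1) L1 M1 N1 xs1 us1 ts1"
      "pert s1 s2 (cpx.sg dp dm2) (cpx.sg' dm dp2) (cpx.sg' em ep2) (cpx.sg ep em2) L2 M2 N2 xs2 us2 ts2"
  shows "pert_scalar s1 s2 (cpx.sg dp dm1) (cpx.sg' dm dp1) (cpx.sg' em ep1) (cpx.sg ep em1)
      L1 M1 N1 xs1 us1 ts1 gs hs gs' hs' =
    pert_scalar s1 s2 (cpx.sg dp dm2) (cpx.sg' dm dp2) (cpx.sg' em ep2) (cpx.sg ep em2)
      L2 M2 N2 xs2 us2 ts2 gs hs gs' hs'"
proof -
  have dd: "cpx_two s1 s2 dp dm dp1 dm1 dp2 dm2" "cpx_two s1 s2 dp dm dp2 dm2 dp1 dm1"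
      "cpx_two s1 s2 ep em ep1 em1 ep2 em2" "cpx_two s1 s2 ep em ep2 em2 ep1 em1"
    unfolding cpx_two_def using d e by blast+
  have ss: "cpx_two s2 s1 dm dp dm1 dp1 dm2 dp2" "cpx_two s2 s1 dm dp dm2 dp2 dm1 dp1"
      "cpx_two s2 s1 em ep em1 ep1 em2 ep2" "cpx_two s2 s1 em ep em2 ep2 em1 ep1"
    unfolding cpx_two_def using d e cpx.swap by blast+
  interpret D: cpx_two s1 s2 dp dm dp1 dm1 dp2 dm2 by (rule dd)
  interpret D': cpx_two s1 s2 dp dm dp2 dm2 dp1 dm1 by (rule dd)
  interpret E: cpx_two s1 s2 ep em ep1 em1 ep2 em2 by (rule dd)
  interpret E': cpx_two s1 s2 ep em ep2 em2 ep1 em1 by (rule dd)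
  interpret Ds: cpx_two s2 s1 dm dp dm1 dp1 dm2 dp2 by (rule ss)
  interpret Ds': cpx_two s2 s1 dm dp dm2 dp2 dm1 dp1 by (rule ss)
  interpret Es: cpx_two s2 s1 em ep em1 ep1 em2 ep2 by (rule ss)
  interpret Es': cpx_two s2 s1 em ep em2 ep2 em1 ep1 by (rule ss)
  have sg: "Ds.c1.sg = D.c1.sg'" "Ds.c2.sg = D.c2.sg'" "Es.c1.sg = E.c1.sg'" "Es.c2.sg = E.c2.sg'"
    "Ds.c1.sg' = D.c1.sg" "Ds.c2.sg' = D.c2.sg" "Es.c1.sg' = E.c1.sg" "Es.c2.sg' = E.c2.sg"
    unfolding Ds.c1.sg_def[abs_def] Ds.c2.sg_def[abs_def] Es.c1.sg_def[abs_def] Es.c2.sg_def[abs_def]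
      Ds.c1.sg'_def[abs_def] Ds.c2.sg'_def[abs_def] Es.c1.sg'_def[abs_def] Es.c2.sg'_def[abs_def]
      D.c1.sg_def[abs_def] D.c2.sg_def[abs_def] E.c1.sg_def[abs_def] E.c2.sg_def[abs_def]
      D.c1.sg'_def[abs_def] D.c2.sg'_def[abs_def] E.c1.sg'_def[abs_def] E.c2.sg'_def[abs_def]
    by (rule refl)+
  have f2: "fred_pair s1 s2 D.c2.sg D.c2.sg' E.c2.sg' E.c2.sg"
    using p(2) unfolding pert_def by blast
  have f1: "fred_pair s1 s2 D.c1.sg D.c1.sg' E.c1.sg' E.c1.sg"
    using p(1) unfolding pert_def by blast
  have c1: "coker_bases s1 s2 D.c1.sg D.c1.sg' E.c1.sg' E.c1.sg gs hs gs' hs'"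
    unfolding coker_bases_def coker_bases_axioms_def
    using f1 D.c1.basis_coker[OF b(1)] Ds.c1.basis_coker[OF b(2)] E.c1.basis_coker[OF b(3)]
      Es.c1.basis_coker[OF b(4)] by (simp add: sg)
  have c2: "coker_bases s1 s2 D.c2.sg D.c2.sg' E.c2.sg' E.c2.sg gs hs gs' hs'"
    unfolding coker_bases_def coker_bases_axioms_def
    using f2 D.c2.basis_coker[OF b(1)] Ds.c2.basis_coker[OF b(2)] E.c2.basis_coker[OF b(3)]
      Es.c2.basis_coker[OF b(4)] by (simp add: sg)
  have gk: "dp g = 0" if "g \<in> set gs" for g using D.c1.V.basis_modD(4)[OF b(1)] that by auto
  have hk: "dm g = 0" if "g \<in> set hs" for g using D.c1.W.basis_modD(4)[OF b(2)] that by auto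
  have gk': "ep g = 0" if "g \<in> set gs'" for g using D.c1.V.basis_modD(4)[OF b(3)] that by auto
  have hk': "em g = 0" if "g \<in> set hs'" for g using D.c1.W.basis_modD(4)[OF b(4)] that by auto
  \<comment> \<open>Both operators are the polynomial of \<open>chg_eq\<close>, evaluated at
    operators that agree up to finite rank.\<close>
  have cong: "fr_eq s1 D.V12 E.V12"
    unfolding D.chg_eq[abs_def] E.chg_eq[abs_def]
    by (intro D.c1.V.fr_eq_add D.c1.V.fr_eq_refl fr
        fr_eq_comp[OF D.c1.lin(2) fr(2)] fr_eq_comp[OF D.c1.lin(3) fr(3)]
        fr_eq_comp[OF D.c2.lin(3) fr(5)] fr_eq_comp[OF D.c2.lin(4) fr(6)])
  have cong': "fr_eq s2 Es.V12 Ds.V12"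
  proof -
    have "fr_eq s2 Ds.V12 Es.V12"
      unfolding Ds.chg_eq[abs_def] Es.chg_eq[abs_def]
      by (intro D.c1.W.fr_eq_add D.c1.W.fr_eq_refl fr
          fr_eq_comp[OF Ds.c1.lin(2) fr(1)] fr_eq_comp[OF Ds.c1.lin(3) fr(4)]
          fr_eq_comp[OF Ds.c2.lin(3) fr(6)] fr_eq_comp[OF Ds.c2.lin(4) fr(5)])
    then have "finite_rank s2 (\<lambda>x. 0 - (Ds.V12 x - Es.V12 x))"
      unfolding fr_eq_def by (rule D.c1.W.finite_rank_add(2)[OF D.c1.W.finite_rank_zero])
    then show ?thesis unfolding fr_eq_def by simp
  qed
  have nil: "D.V12 (D.V12 (D.V12 x - x) - (D.V12 x - x)) - (D.V12 (D.V12 x - x) - (D.V12 x - x)) = 0"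
    "E.V12 (E.V12 (E.V12 x - x) - (E.V12 x - x)) - (E.V12 (E.V12 x - x) - (E.V12 x - x)) = 0" for x
    by (rule D.chg_nilpotent[of "\<lambda>x. D.V12 x - x", OF refl])
       (rule E.chg_nilpotent[of "\<lambda>x. E.V12 x - x", OF refl])
  have nil': "Ds.V12 (Ds.V12 (Ds.V12 x - x) - (Ds.V12 x - x)) - (Ds.V12 (Ds.V12 x - x) - (Ds.V12 x - x)) = 0"
    "Es.V12 (Es.V12 (Es.V12 x - x) - (Es.V12 x - x)) - (Es.V12 (Es.V12 x - x) - (Es.V12 x - x)) = 0" for x
    by (rule Ds.chg_nilpotent[of "\<lambda>x. Ds.V12 x - x", OF refl])
       (rule Es.chg_nilpotent[of "\<lambda>x. Es.V12 x - x", OF refl])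
  note det1 = D.c1.V.op_det_unipotent_quotient[where V = D.V12 and V' = D.V21 and W = E.V12
      and n = "\<lambda>x. D.V12 x - x" and m = "\<lambda>x. E.V12 x - x",
      OF D.linear_chg E.linear_chg D'.linear_chg D.chg_inverse D'.chg_inverse refl nil(1) refl nil(2)
        cong[unfolded fr_eq_def]]
  \<comment> \<open>On the other parity the two complexes exchange roles, because the transported
    \<Sigma> contains \<open>Wm' Vm\<close>, with the inverse on the side of \<Delta>.\<close>
  note det2 = D.c1.W.op_det_unipotent_quotient[where V = Es.V12 and V' = Es.V21 and W = Ds.V12
      and n = "\<lambda>x. Es.V12 x - x" and m = "\<lambda>x. Ds.V12 x - x",
      OF Es.linear_chg Ds.linear_chg Es'.linear_chg Es.chg_inverse Es'.chg_inverse refl nil'(2) refl nil'(1)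
        cong'[unfolded fr_eq_def]]
  note tr = pert_transport[where Vp = D.V12 and Vp' = D.V21 and Vm = Ds.V12 and Vm' = Ds.V21
      and Wp = E.V12 and Wp' = E.V21 and Wm = Es.V12 and Wm' = Es.V21,
      OF p(1) f2 c1 c2 D.linear_chg D'.linear_chg Ds.linear_chg Ds'.linear_chg
      E.linear_chg E'.linear_chg Es.linear_chg Es'.linear_chg
      D'.chg_inverse D.chg_inverse Ds'.chg_inverse Ds.chg_inverse
      E'.chg_inverse E.chg_inverse Es'.chg_inverse Es.chg_inverse
      D.chg_intertwine Ds.chg_intertwine[unfolded sg] Es.chg_intertwine[unfolded sg] E.chg_intertwine
      det1 det2 D.chg_cong[OF gk] Ds.chg_cong[OF hk, unfolded sg] E.chg_cong[OF gk'] Es.chg_cong[OF hk', unfolded sg]]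
  show ?thesis
    using tr(2) pert_scalar_same_daggers[OF tr(1) p(2) c2] by simp
qed

text \<open>\<open>A\<close> conjugates \<open>B A\<close> to \<open>A B\<close>.\<close>

lemma op_det_commute:
  assumes A: "lin_map s1 s2 A" "bij A" and B: "lin_map s2 s1 B"
    and fr: "finite_rank s1 (\<lambda>x. x - B (A x))"
  shows "op_det s2 (\<lambda>y. A (B y)) = op_det s1 (\<lambda>x. B (A x))"
proof (rule op_det_intertwine(1)[OF A(1) bij_is_inj[OF A(2)] lin_map_comp[OF A(1) B] fr lin_map_comp[OF B A(1)] refl])
  interpret A: lin_map s1 s2 A by (rule A(1))
  show "range (\<lambda>y. y - A (B y)) \<subseteq> A ` range (\<lambda>x. x - B (A x))"
  proof safe
    fix y
    obtain x where "y = A x" using A(2) by (auto simp: bij_def surj_def)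
    then have "y - A (B y) = A (x - B (A x))" by (simp add: A.diff)
    then show "y - A (B y) \<in> A ` range (\<lambda>x. x - B (A x))" by blast
  qed
qed

text \<open>In index \<open>0\<close> the two kinds of data have the operators \<open>\<Sigma> = AB\<close> and \<open>\<Sigma> = BA\<close>.\<close>

lemma pert_scalar_index_zero:
  assumes p: "pert s1 s2 \<sigma> \<sigma>' \<tau> \<tau>' L M N xs us []" and f: "fred_pair s2 s1 \<tau> \<tau>' \<sigma> \<sigma>'"
  shows "pert s2 s1 \<tau> \<tau>' \<sigma> \<sigma>' M L (\<lambda>_. 0) us xs []"
    and "pert_scalar s2 s1 \<tau> \<tau>' \<sigma> \<sigma>' M L (\<lambda>_. 0) us xs [] hs' gs' hs gs =
      pert_scalar s1 s2 \<sigma> \<sigma>' \<tau> \<tau>' L M N xs us [] gs hs gs' hs'"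
proof -
  interpret p: pert s1 s2 \<sigma> \<sigma>' \<tau> \<tau>' L M N xs us "[]" by fact
  interpret f: fred_pair s2 s1 \<tau> \<tau>' \<sigma> \<sigma>' by fact
  show p': "pert s2 s1 \<tau> \<tau>' \<sigma> \<sigma>' M L (\<lambda>_. 0) us xs []"
    by unfold_locales
       (use p.bx p.bt p.bV p.bW in \<open>simp_all add: p.M0 p.L0 p.L.add p.L.scale p.M.add p.M.scale\<close>)
  interpret q: pert s2 s1 \<tau> \<tau>' \<sigma> \<sigma>' M L "\<lambda>_. 0" us xs "[]" by (rule p')
  have N: "N y = 0" for y
    using p.ker_\<tau>_lcomb[OF p.ker_proj(2)[of y]] p.N_proj[of y] p.N_lcomb_us by auto
  have q: "q.A = p.B" "q.B = p.A" unfolding q.A_def[abs_def] q.B_def[abs_def] p.A_def[abs_def] p.B_def[abs_def]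
    by simp_all
  have Sp: "p.Sig y = p.A (p.B y)" for y by (simp add: p.Sig_def N)
  have Sq: "q.Sig x = p.B (p.A x)" for x by (simp only: q.Sig_def q add_0_right)
  have "bij p.A"
    using p.injA p.bij_Sig unfolding bij_def surj_def Sp by metis
  then have "op_det s2 (\<lambda>y. p.A (p.B y)) = op_det s1 (\<lambda>x. p.B (p.A x))"
    using op_det_commute[OF p.linA _ p.linB] q.finite_rank_Sig unfolding Sq by blast
  then have "op_det s2 p.Sig = op_det s1 q.Sig"
    unfolding Sp[abs_def] Sq[abs_def] .
  then show "pert_scalar s2 s1 \<tau> \<tau>' \<sigma> \<sigma>' M L (\<lambda>_. 0) us xs [] hs' gs' hs gs =
      pert_scalar s1 s2 \<sigma> \<sigma>' \<tau> \<tau>' L M N xs us [] gs hs gs' hs'"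
    unfolding pert_scalar_def by (simp only: mult_ac list.map append_Nil2)
qed

section \<open>Modules presented as subquotients of a vector space\<close>

lemma vcoset_0 [simp]: "vcoset W 0 = W"
  by (simp add: vcoset_def)

context vsp
begin

lemma mem_vcoset_iff: "y \<in> vcoset W x \<longleftrightarrow> y - x \<in> W"
proof
  assume "y - x \<in> W"
  then have "x + (y - x) \<in> vcoset W x" unfolding vcoset_def by blast
  then show "y \<in> vcoset W x" by simp
qed (auto simp: vcoset_def)

lemma vcoset_eq_iff:
  assumes "subspace W"
  shows "vcoset W x = vcoset W y \<longleftrightarrow> x - y \<in> W"
proof
  assume "vcoset W x = vcoset W y"
  moreover have "x \<in> vcoset W x" using subspace_0[OF assms] by (simp add: mem_vcoset_iff)
  ultimately show "x - y \<in> W" by (simp add: mem_vcoset_iff)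
next
  assume xy: "x - y \<in> W"
  have "z - x \<in> W \<longleftrightarrow> z - y \<in> W" for z
    using subspace_add[OF assms xy, of "z - x"] subspace_diff[OF assms _ xy, of "z - y"] by auto
  then show "vcoset W x = vcoset W y" by (auto simp: mem_vcoset_iff)
qed

lemma vcoset_nonempty: "subspace W \<Longrightarrow> x \<in> vcoset W x"
  using subspace_0 by (simp add: mem_vcoset_iff)

end

lemma UN_const_on: "(\<And>x. x \<in> A \<Longrightarrow> f x = C) \<Longrightarrow> a \<in> A \<Longrightarrow> (\<Union>x\<in>A. f x) = C"
  by blast

text \<open>\<open>V\<close> is presented as \<open>K/U\<close> with class map \<open>\<pi>\<close>.
  One interface serves kernels, cokernels and cohomology as well as tensor products and exterior
  powers, which are quotients of free spaces; bases of \<open>V\<close> are then lists in the sense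
  of \<open>basis_mod\<close>.\<close>

locale pres = vsp s
  for s :: "'f::field \<Rightarrow> 'x::ab_group_add \<Rightarrow> 'x" +
  fixes U K :: "'x set" and V :: "('f, 'v) module" and \<pi> :: "'x \<Rightarrow> 'v"
  assumes sU: "subspace U" and sK: "subspace K" and UK: "U \<subseteq> K"
    and carrier_eq: "carrier V = \<pi> ` K"
    and \<pi>_add: "\<And>x y. x \<in> K \<Longrightarrow> y \<in> K \<Longrightarrow> \<pi> x \<oplus>\<^bsub>V\<^esub> \<pi> y = \<pi> (x + y)"
    and \<pi>_smult: "\<And>c x. x \<in> K \<Longrightarrow> c \<odot>\<^bsub>V\<^esub> \<pi> x = \<pi> (s c x)"
    and \<pi>_zero: "\<zero>\<^bsub>V\<^esub> = \<pi> 0"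
    and \<pi>_eq_iff: "\<And>x y. x \<in> K \<Longrightarrow> y \<in> K \<Longrightarrow> \<pi> x = \<pi> y \<longleftrightarrow> x - y \<in> U"

lemma (in vsp) pres_quotient:
  assumes W: "subspace W" and K: "subspace K" "W \<subseteq> K"
  shows "pres scale W K (quotient_space scale K W) (vcoset W)"
proof unfold_locales
  have sub: "x \<in> vcoset W a \<longleftrightarrow> x - a \<in> W" for x a by (rule mem_vcoset_iff)
  show "vcoset W x \<oplus>\<^bsub>quotient_space scale K W\<^esub> vcoset W y = vcoset W (x + y)" for x y
  proof -
    have 1: "vcoset W (a + b) = vcoset W (x + y)" if "a \<in> vcoset W x" "b \<in> vcoset W y" for a b
      using subspace_add[OF W, of "a - x" "b - y"] that by (simp add: sub vcoset_eq_iff[OF W] algebra_simps)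
    have "(\<Union>a\<in>vcoset W x. \<Union>b\<in>vcoset W y. vcoset W (a + b)) = vcoset W (x + y)"
      by (intro UN_const_on[OF _ vcoset_nonempty[OF W]] 1)
    then show ?thesis by (simp add: quotient_space_def)
  qed
  show "c \<odot>\<^bsub>quotient_space scale K W\<^esub> vcoset W x = vcoset W (scale c x)" for c x
  proof -
    have 1: "vcoset W (scale c a) = vcoset W (scale c x)" if "a \<in> vcoset W x" for a
      using subspace_scale[OF W, of "a - x" c] that by (simp add: sub vcoset_eq_iff[OF W] scale_right_diff_distrib)
    have "(\<Union>a\<in>vcoset W x. vcoset W (scale c a)) = vcoset W (scale c x)"
      by (intro UN_const_on[OF _ vcoset_nonempty[OF W]] 1)
    then show ?thesis by (simp add: quotient_space_def)
  qed
  show "vcoset W x = vcoset W y \<longleftrightarrow> x - y \<in> W" for x y by (rule vcoset_eq_iff[OF W])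
qed (use assms in \<open>simp_all add: quotient_space_def\<close>)

lemma (in vsp) pres_space:
  assumes "subspace K"
  shows "pres scale {0} K (space_on scale K) (\<lambda>x. x)"
  using assms subspace_0[OF assms] by unfold_locales (simp_all add: space_on_def)

context pres
begin

lemma \<pi>_in: "x \<in> K \<Longrightarrow> \<pi> x \<in> carrier V"
  by (simp add: carrier_eq)

lemma carrierE: assumes "v \<in> carrier V" obtains x where "x \<in> K" "v = \<pi> x"
  using assms carrier_eq by auto

lemma vectorspace_V: "vectorspace class_ring V"
proof -
  note K = subspace_0[OF sK] subspace_add[OF sK] subspace_scale[OF sK] subspace_neg[OF sK]
  have "abelian_group V"
  proof (rule abelian_groupI)
    show "\<exists>y\<in>carrier V. y \<oplus>\<^bsub>V\<^esub> x = \<zero>\<^bsub>V\<^esub>" if xV: "x \<in> carrier V" for x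
    proof -
      obtain y where y: "y \<in> K" "x = \<pi> y" using xV by (rule carrierE)
      then have "\<pi> (- y) \<oplus>\<^bsub>V\<^esub> x = \<zero>\<^bsub>V\<^esub>" by (simp add: \<pi>_add \<pi>_zero K)
      then show ?thesis using \<pi>_in K(4)[OF y(1)] by blast
    qed
  qed (auto elim!: carrierE simp: \<pi>_add \<pi>_zero \<pi>_in K add_ac)
  then have "Module.module class_ring V"
    by (rule moduleI[OF class_cring.is_cring])
       (auto elim!: carrierE simp: class_ring_simps \<pi>_add \<pi>_smult \<pi>_in K scale_left_distrib scale_right_distrib)
  then show ?thesis unfolding vectorspace_def using class_field by blast
qed

interpretation VV: vectorspace class_ring V by (rule vectorspace_V)

lemma lincomb_image:
  assumes "finite B" "B \<subseteq> K" "inj_on \<pi> B"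
  shows "VV.lincomb a (\<pi> ` B) = \<pi> (\<Sum>b\<in>B. s (a (\<pi> b)) b)"
  using assms
proof (induction B rule: finite_induct)
  case empty
  then show ?case by (simp add: VV.lincomb_def \<pi>_zero)
next
  case (insert b B)
  have sK': "(\<Sum>b\<in>B. s (a (\<pi> b)) b) \<in> K" "s (a (\<pi> b)) b \<in> K"
    using insert.prems sK by (auto intro!: subspace_sum subspace_scale)
  have "\<pi> b \<notin> \<pi> ` B" using insert by (auto simp: inj_on_def)
  then have "VV.lincomb a (\<pi> ` insert b B) = a (\<pi> b) \<odot>\<^bsub>V\<^esub> \<pi> b \<oplus>\<^bsub>V\<^esub> VV.lincomb a (\<pi> ` B)"
    using insert.prems insert.hyps \<pi>_in unfolding VV.lincomb_def image_insert
    by (subst VV.M.finsum_insert) (auto simp: class_ring_simps)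
  also have "\<dots> = \<pi> (\<Sum>b\<in>insert b B. s (a (\<pi> b)) b)"
    using insert sK' by (simp add: \<pi>_add \<pi>_smult)
  finally show ?case .
qed

lemma vs_dim_eq:
  assumes b: "basis_mod U K bs"
  shows "vs_dim V = length bs" "vs_fin_dim V"
proof -
  note B = basis_modD[OF b]
  have inj: "inj_on \<pi> (set bs)" and dist: "distinct bs"
  proof -
    have *: "i = j" if "i < length bs" "j < length bs" "bs ! i - bs ! j \<in> U" for i j
    proof (rule ccontr)
      assume "i \<noteq> j"
      then show False
        using coord_nth[OF b that(1,1)] coord_nth[OF b that(2,1)]
          coord_cong_mod[OF b that(3) _ that(1)] B(4) that by (auto simp: subset_iff)
    qed
    then show "distinct bs" by (auto simp: distinct_conv_nth subspace_0[OF sU])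
    show "inj_on \<pi> (set bs)"
    proof (rule inj_onI)
      fix x y assume xy: "x \<in> set bs" "y \<in> set bs" "\<pi> x = \<pi> y"
      then have "x - y \<in> U" using B(4) \<pi>_eq_iff by auto
      then show "x = y" using * xy by (metis in_set_conv_nth)
    qed
  qed
  have lc: "VV.lincomb a (\<pi> ` set bs) = \<pi> (lcomb bs (\<lambda>i. a (\<pi> (bs ! i))))" for a
  proof -
    have "(\<Sum>b\<in>set bs. s (a (\<pi> b)) b) = lcomb bs (\<lambda>i. a (\<pi> (bs ! i)))"
      unfolding lcomb_def by (rule sum.reindex_bij_betw[symmetric]) (use dist in \<open>auto intro: bij_betw_nth\<close>)
    then show ?thesis using lincomb_image[OF _ B(4) inj] by simp
  qed
  have sub: "\<pi> ` set bs \<subseteq> carrier V" using B(4) \<pi>_in by auto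
  have gen: "VV.span (\<pi> ` set bs) = carrier V"
  proof
    show "VV.span (\<pi> ` set bs) \<subseteq> carrier V" using VV.span_is_subset2[OF sub] .
    show "carrier V \<subseteq> VV.span (\<pi> ` set bs)"
    proof
      fix v assume "v \<in> carrier V"
      then obtain x where x: "x \<in> K" "v = \<pi> x" by (rule carrierE)
      \<comment> \<open>\<open>lincomb\<close> reads its coefficients off vectors, so the position
        is recovered from the class; distinct positions have distinct classes.\<close>
      let ?a = "\<lambda>v. coord U bs x (inv_into {..<length bs} (\<lambda>i. \<pi> (bs ! i)) v)"
      have inj': "inj_on (\<lambda>i. \<pi> (bs ! i)) {..<length bs}"
        by (rule inj_onI) (metis dist inj inj_onD lessThan_iff nth_eq_iff_index_eq nth_mem)
      have "VV.lincomb ?a (\<pi> ` set bs) = \<pi> (lcomb bs (coord U bs x))"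
        unfolding lc by (intro arg_cong[of _ _ \<pi>] lcomb_cong) (simp add: inv_into_f_f[OF inj'])
      also have "\<dots> = v"
      proof -
        have "\<pi> x = \<pi> (lcomb bs (coord U bs x))"
          unfolding \<pi>_eq_iff[OF x(1) lcomb_in[OF sK B(4)]] by (rule coord_diff_in[OF b x(1)])
        then show ?thesis using x by simp
      qed
      finally show "v \<in> VV.span (\<pi> ` set bs)"
        using VV.finite_span[OF _ sub] by (auto simp: class_ring_simps)
    qed
  qed
  have "VV.lin_indpt (\<pi> ` set bs)"
  proof (rule VV.finite_lin_indpt2[OF _ sub])
    fix a assume a: "VV.lincomb a (\<pi> ` set bs) = \<zero>\<^bsub>V\<^esub>"
    have "lcomb bs (\<lambda>i. a (\<pi> (bs ! i))) \<in> U"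
      using a \<pi>_eq_iff[OF lcomb_in[OF sK B(4)] subspace_0[OF sK]] unfolding lc \<pi>_zero by simp
    then have "a (\<pi> (bs ! i)) = 0" if "i < length bs" for i
      using B(6)[of "\<lambda>i. a (\<pi> (bs ! i))" i] that by simp
    then show "\<forall>v\<in>\<pi> ` set bs. a v = \<zero>\<^bsub>class_ring\<^esub>" by (auto simp: in_set_conv_nth)
  qed simp
  then have "VV.basis (\<pi> ` set bs)" unfolding VV.basis_def using gen sub by blast
  then show "vs_dim V = length bs"
    unfolding vs_dim_def using VV.dim_basis[of "\<pi> ` set bs"] inj dist by (simp add: card_image distinct_card)
  show "vs_fin_dim V" unfolding vs_fin_dim_def VV.fin_dim_def using gen sub by blast
qed

text \<open>One representative for each element of a finite spanning set suffices: together with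
  \<open>U\<close> these span \<open>K\<close>.\<close>

lemma basis_of_fin_dim:
  assumes "vs_fin_dim V"
  obtains bs where "basis_mod U K bs"
proof -
  obtain A where A: "finite A" "A \<subseteq> carrier V" "VV.span A = carrier V"
    using assms unfolding vs_fin_dim_def VV.fin_dim_def by blast
  obtain B where B: "B \<subseteq> K" "A = \<pi> ` B" "inj_on \<pi> B"
    using subset_image_inj[of A \<pi> K] A(2) unfolding carrier_eq by blast
  have fB: "finite B" using A(1) B(2,3) finite_image_iff by blast
  have "K \<subseteq> span (U \<union> B)"
  proof
    fix x assume x: "x \<in> K"
    then have "\<pi> x \<in> VV.span A" using A(3) \<pi>_in by simp
    then obtain a where "\<pi> x = VV.lincomb a A" using VV.finite_span[OF A(1,2)] by auto
    then have "\<pi> x = \<pi> (\<Sum>b\<in>B. s (a (\<pi> b)) b)" using lincomb_image[OF fB B(1,3)] B(2) by simp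
    moreover have "(\<Sum>b\<in>B. s (a (\<pi> b)) b) \<in> K" using B(1) sK by (auto intro!: subspace_sum subspace_scale)
    ultimately have "x - (\<Sum>b\<in>B. s (a (\<pi> b)) b) \<in> U" using \<pi>_eq_iff x by blast
    then have "x - (\<Sum>b\<in>B. s (a (\<pi> b)) b) \<in> span (U \<union> B)" by (simp add: span_base)
    moreover have "(\<Sum>b\<in>B. s (a (\<pi> b)) b) \<in> span (U \<union> B)" by (intro span_sum span_scale) (simp add: span_base)
    ultimately have "x - (\<Sum>b\<in>B. s (a (\<pi> b)) b) + (\<Sum>b\<in>B. s (a (\<pi> b)) b) \<in> span (U \<union> B)" by (rule span_add)
    then show "x \<in> span (U \<union> B)" by simp
  qed
  then show ?thesis using basis_mod_exists[OF fB sU sK UK] that by blast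
qed

end

section \<open>Lines\<close>

text \<open>Elements are multiples of one generator, so that a linear map between lines amounts to
  one scalar.\<close>

definition is_line :: "('f::field, 'v) module \<Rightarrow> 'v \<Rightarrow> bool" where
  "is_line L g \<longleftrightarrow> carrier L = range (\<lambda>c. c \<odot>\<^bsub>L\<^esub> g) \<and> inj (\<lambda>c. c \<odot>\<^bsub>L\<^esub> g) \<and>
    (\<forall>a b. (a \<odot>\<^bsub>L\<^esub> g) \<oplus>\<^bsub>L\<^esub> (b \<odot>\<^bsub>L\<^esub> g) = (a + b) \<odot>\<^bsub>L\<^esub> g) \<and>
    (\<forall>a b. a \<odot>\<^bsub>L\<^esub> (b \<odot>\<^bsub>L\<^esub> g) = (a * b) \<odot>\<^bsub>L\<^esub> g) \<and>
    \<zero>\<^bsub>L\<^esub> = 0 \<odot>\<^bsub>L\<^esub> g \<and> 1 \<odot>\<^bsub>L\<^esub> g = g"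

lemma is_lineD:
  assumes "is_line L g"
  shows "carrier L = range (\<lambda>c. c \<odot>\<^bsub>L\<^esub> g)" "c \<odot>\<^bsub>L\<^esub> g \<in> carrier L"
    "c \<odot>\<^bsub>L\<^esub> g = d \<odot>\<^bsub>L\<^esub> g \<longleftrightarrow> c = d"
    "(c \<odot>\<^bsub>L\<^esub> g) \<oplus>\<^bsub>L\<^esub> (d \<odot>\<^bsub>L\<^esub> g) = (c + d) \<odot>\<^bsub>L\<^esub> g" "c \<odot>\<^bsub>L\<^esub> (d \<odot>\<^bsub>L\<^esub> g) = (c * d) \<odot>\<^bsub>L\<^esub> g"
    "\<zero>\<^bsub>L\<^esub> = 0 \<odot>\<^bsub>L\<^esub> g" "1 \<odot>\<^bsub>L\<^esub> g = g"
  using assms unfolding is_line_def by (auto dest: injD)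

lemma is_line_carrierE:
  assumes "is_line L g" "v \<in> carrier L"
  obtains c where "v = c \<odot>\<^bsub>L\<^esub> g"
  using assms is_lineD(1)[OF assms(1)] by auto

lemma nonzero_line_iff:
  assumes "is_line L g"
  shows "nonzero L = {c \<odot>\<^bsub>L\<^esub> g |c. c \<noteq> 0}"
  unfolding nonzero_def is_lineD(1)[OF assms] is_lineD(6)[OF assms] using is_lineD(3)[OF assms] by auto

lemma (in pres) is_line_basis:
  assumes b: "basis_mod U K [g]"
  shows "is_line V (\<pi> g)" and "x \<in> K \<Longrightarrow> \<pi> x = coord U [g] x 0 \<odot>\<^bsub>V\<^esub> \<pi> g"
proof -
  have g: "g \<in> K" "s c g \<in> K" for c using basis_modD[OF b] by (auto intro: subspace_scale)
  have *: "\<pi> x = coord U [g] x 0 \<odot>\<^bsub>V\<^esub> \<pi> g" if x: "x \<in> K" for x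
    using coord_diff_in[OF b x] \<pi>_eq_iff[OF x g(2)] by (simp add: \<pi>_smult g lcomb_def)
  then show "x \<in> K \<Longrightarrow> \<pi> x = coord U [g] x 0 \<odot>\<^bsub>V\<^esub> \<pi> g" .
  have ex: "\<exists>c. x - s c g \<in> U" if "x \<in> K" for x
    using coord_diff_in[OF b that] by (auto simp: lcomb_def)
  have "c = d" if "s c g - s d g \<in> U" for c d
    using basis_modD(6)[OF b, of "\<lambda>i. c - d" 0] that by (simp add: lcomb_def scale_left_diff_distrib)
  then show "is_line V (\<pi> g)"
    unfolding is_line_def carrier_eq using ex g
    by (auto simp: \<pi>_smult \<pi>_add \<pi>_zero \<pi>_eq_iff inj_def scale_left_distrib image_iff)
qed

definition lcoef :: "('f::field, 'v) module \<Rightarrow> 'v \<Rightarrow> 'v \<Rightarrow> 'f" where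
  "lcoef L g = inv_into UNIV (\<lambda>c. c \<odot>\<^bsub>L\<^esub> g)"

lemma lcoef_smult:
  assumes "is_line L g"
  shows "lcoef L g (c \<odot>\<^bsub>L\<^esub> g) = c"
  unfolding lcoef_def using inv_into_f_f[of "\<lambda>c. c \<odot>\<^bsub>L\<^esub> g" UNIV c] is_lineD(3)[OF assms] by (simp add: inj_def)

lemma line_closed:
  assumes l: "is_line L g" and x: "x \<in> carrier L"
  shows "c \<odot>\<^bsub>L\<^esub> x \<in> carrier L" "lcoef L g (c \<odot>\<^bsub>L\<^esub> x) = c * lcoef L g x"
    and "y \<in> carrier L \<Longrightarrow> x \<oplus>\<^bsub>L\<^esub> y \<in> carrier L"
    and "y \<in> carrier L \<Longrightarrow> lcoef L g (x \<oplus>\<^bsub>L\<^esub> y) = lcoef L g x + lcoef L g y"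
  using x by (auto elim!: is_line_carrierE[OF l] simp: is_lineD(2,4,5)[OF l] lcoef_smult[OF l])

text \<open>A functional on a line is fixed by its value at the generator, and extensionality turns
  agreement on the carrier into equality. Dualising inverts scalars, which is where the denominators
  of \<open>pert_scalar\<close> come from.\<close>

lemma dual_line:
  assumes l: "is_line L g"
  defines "g' \<equiv> dual_vector L g"
  shows "is_line (dual_space L) g'"
    and "\<And>a. c \<noteq> 0 \<Longrightarrow> dual_vector L (c \<odot>\<^bsub>L\<^esub> g) = inverse c \<odot>\<^bsub>dual_space L\<^esub> g'"
    and "\<And>a. (c \<odot>\<^bsub>dual_space L\<^esub> g') (a \<odot>\<^bsub>L\<^esub> g) = c * a"
    and "\<And>\<phi>. \<phi> \<in> extensional (carrier L) \<Longrightarrow> (\<And>a. \<phi> (a \<odot>\<^bsub>L\<^esub> g) = c * a) \<Longrightarrow> \<phi> = c \<odot>\<^bsub>dual_space L\<^esub> g'"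
proof -
  note D = is_lineD[OF l]
  define f where "f c = (\<lambda>v\<in>carrier L. c * lcoef L g v)" for c
  have f: "f c (a \<odot>\<^bsub>L\<^esub> g) = c * a" for c a
    unfolding f_def using D(2) by (simp add: lcoef_smult[OF l])
  have ext: "\<phi> = f c" if "\<phi> \<in> extensional (carrier L)" "\<And>a. \<phi> (a \<odot>\<^bsub>L\<^esub> g) = c * a" for \<phi> c
  proof (rule extensionalityI[OF that(1)])
    show "f c \<in> extensional (carrier L)" by (simp add: f_def)
    show "\<phi> x = f c x" if "x \<in> carrier L" for x
      using \<open>x \<in> carrier L\<close> \<open>\<And>a. \<phi> (a \<odot>\<^bsub>L\<^esub> g) = c * a\<close> f by (auto elim!: is_line_carrierE[OF l])
  qed
  have carr: "carrier (dual_space L) = range f"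
  proof
    show "range f \<subseteq> carrier (dual_space L)"
      unfolding dual_space_def vs_hom_def LinearCombinations.module_hom_def space_on_def
      by (auto simp: f_def class_ring_simps line_closed[OF l] algebra_simps)
    show "carrier (dual_space L) \<subseteq> range f"
    proof
      fix \<phi> assume \<phi>: "\<phi> \<in> carrier (dual_space L)"
      have "\<phi> (a \<odot>\<^bsub>L\<^esub> g) = \<phi> g * a" for a
        using \<phi> D(2)[of 1] D(7)
        by (simp add: dual_space_def vs_hom_def LinearCombinations.module_hom_def space_on_def class_ring_simps)
      moreover have "\<phi> \<in> extensional (carrier L)" using \<phi> by (simp add: dual_space_def)
      ultimately show "\<phi> \<in> range f" using ext by blast
    qed
  qed
  have sm: "c \<odot>\<^bsub>dual_space L\<^esub> f d = f (c * d)" for c d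
    by (rule ext) (simp_all add: dual_space_def f D(2))
  have dv: "dual_vector L (c \<odot>\<^bsub>L\<^esub> g) = f (inverse c)" if "c \<noteq> 0" for c
    unfolding dual_vector_def
  proof (rule the_equality)
    show "f (inverse c) \<in> carrier (dual_space L) \<and> f (inverse c) (c \<odot>\<^bsub>L\<^esub> g) = 1"
      using that by (simp add: carr f)
    fix \<phi> assume "\<phi> \<in> carrier (dual_space L) \<and> \<phi> (c \<odot>\<^bsub>L\<^esub> g) = 1"
    then obtain d where "\<phi> = f d" "d * c = 1" using carr f by auto
    then show "\<phi> = f (inverse c)" using inverse_unique[of c d] by (simp add: mult.commute)
  qed
  have g': "g' = f 1" using dv[of 1] D(7) by (simp add: g'_def)
  have sm1: "c \<odot>\<^bsub>dual_space L\<^esub> g' = f c" for c by (simp add: g' sm)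
  have inj: "f c = f d \<longleftrightarrow> c = d" for c d
    using fun_cong[of "f c" "f d" "1 \<odot>\<^bsub>L\<^esub> g"] unfolding f by fastforce
  have add: "f c \<oplus>\<^bsub>dual_space L\<^esub> f d = f (c + d)" for c d
    by (rule ext) (simp_all add: dual_space_def f D(2) algebra_simps)
  have zero: "\<zero>\<^bsub>dual_space L\<^esub> = f 0"
    by (rule ext) (simp_all add: dual_space_def D(2))
  show "is_line (dual_space L) g'"
    unfolding is_line_def sm1 by (simp add: carr inj_def inj add sm zero g')
  show "c \<noteq> 0 \<Longrightarrow> dual_vector L (c \<odot>\<^bsub>L\<^esub> g) = inverse c \<odot>\<^bsub>dual_space L\<^esub> g'" by (simp add: dv sm1)
  show "(c \<odot>\<^bsub>dual_space L\<^esub> g') (a \<odot>\<^bsub>L\<^esub> g) = c * a" for a by (simp add: sm1 f)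
  show "\<phi> = c \<odot>\<^bsub>dual_space L\<^esub> g'" if "\<phi> \<in> extensional (carrier L)" "\<And>a. \<phi> (a \<odot>\<^bsub>L\<^esub> g) = c * a" for \<phi>
    unfolding sm1 by (rule ext[OF that])
qed

section \<open>Free vector spaces and tensor products of lines\<close>

lemma lookup_free_scale: "Poly_Mapping.lookup (free_scale c p) i = c * Poly_Mapping.lookup p i"
  unfolding free_scale_def by (simp add: Poly_Mapping.map.rep_eq when_def)

interpretation free: vsp "free_scale :: 'f::field \<Rightarrow> ('i \<Rightarrow>\<^sub>0 'f) \<Rightarrow> _"
  by unfold_locales (auto intro!: poly_mapping_eqI simp: lookup_free_scale lookup_add algebra_simps)

lemma free_span_eq: "free_span = free.span"
  by (simp add: free_span_def fun_eq_iff)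

lemma free_scale_single: "free_scale c (Poly_Mapping.single i a) = Poly_Mapping.single i (c * a)"
  by (rule poly_mapping_eqI) (simp add: lookup_free_scale lookup_single when_def)

lemma single_eq_scale: "Poly_Mapping.single i c = free_scale c (Poly_Mapping.single i 1)"
  by (simp add: free_scale_single)

definition free_ext where
  "free_ext t g p = (\<Sum>i\<in>Poly_Mapping.keys p. t (Poly_Mapping.lookup p i) (g i))"

lemma free_ext_linear:
  fixes t :: "'f::field \<Rightarrow> 'w::ab_group_add \<Rightarrow> 'w" and g :: "'i \<Rightarrow> 'w"
  assumes "vsp t"
  shows "lin_map free_scale t (free_ext t g)"
proof -
  interpret T: vsp t by fact
  have sup: "free_ext t g p = (\<Sum>i\<in>A. t (Poly_Mapping.lookup p i) (g i))"
    if "finite A" "Poly_Mapping.keys p \<subseteq> A" for p A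
    unfolding free_ext_def by (rule sum.mono_neutral_left) (use that in \<open>auto simp: in_keys_iff\<close>)
  show ?thesis
  proof unfold_locales
    fix p q :: "'i \<Rightarrow>\<^sub>0 'f"
    let ?A = "Poly_Mapping.keys p \<union> Poly_Mapping.keys q"
    show "free_ext t g (p + q) = free_ext t g p + free_ext t g q"
      using sup[of ?A p] sup[of ?A q] sup[of ?A "p + q"] Poly_Mapping.keys_add[of p q]
      by (simp add: lookup_add T.scale_left_distrib sum.distrib)
  next
    fix c :: 'f and p :: "'i \<Rightarrow>\<^sub>0 'f"
    have "Poly_Mapping.keys (free_scale c p) \<subseteq> Poly_Mapping.keys p"
      by (auto simp: in_keys_iff lookup_free_scale)
    then show "free_ext t g (free_scale c p) = t c (free_ext t g p)"
      using sup[of "Poly_Mapping.keys p" "free_scale c p"]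
      by (simp add: lookup_free_scale free_ext_def T.scale_sum_right)
  qed
qed

lemma free_ext_single:
  assumes "vsp t"
  shows "free_ext t g (Poly_Mapping.single i c) = t c (g i)"
proof -
  interpret T: vsp t by fact
  show ?thesis by (simp add: free_ext_def)
qed

lemma vsp_mult: "vsp ((*) :: 'f::field \<Rightarrow> 'f \<Rightarrow> 'f)"
  by unfold_locales (simp_all add: algebra_simps)

lemma keys_subspace: "free.subspace {p :: 'i \<Rightarrow>\<^sub>0 'f::field. Poly_Mapping.keys p \<subseteq> A}"
proof (rule free.subspaceI)
  fix c :: 'f and p :: "'i \<Rightarrow>\<^sub>0 'f" assume "p \<in> {p. Poly_Mapping.keys p \<subseteq> A}"
  then show "free_scale c p \<in> {p. Poly_Mapping.keys p \<subseteq> A}"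
    by (auto simp: in_keys_iff lookup_free_scale)
qed (use Poly_Mapping.keys_add in fastforce)+

lemma keys_in_span:
  fixes p :: "'i \<Rightarrow>\<^sub>0 'f::field"
  shows "p \<in> free.span ((\<lambda>i. Poly_Mapping.single i 1) ` Poly_Mapping.keys p)"
proof -
  have "p = (\<Sum>i\<in>Poly_Mapping.keys p. Poly_Mapping.single i (Poly_Mapping.lookup p i))"
    by (rule poly_mapping_eqI)
       (simp add: Poly_Mapping.lookup_sum lookup_single when_def sum.delta in_keys_iff)
  also have "\<dots> \<in> free.span ((\<lambda>i. Poly_Mapping.single i 1) ` Poly_Mapping.keys p)"
    unfolding single_eq_scale[of _ "Poly_Mapping.lookup p _"]
    by (intro free.span_sum free.span_scale free.span_base) auto
  finally show ?thesis .
qed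

text \<open>A functional separates the generator from the relations, and the singletons show that there is
  nothing else.\<close>

lemma free_line_basis:
  fixes \<phi> :: "'i \<Rightarrow> 'f::field"
  assumes R: "R \<subseteq> {p. Poly_Mapping.keys p \<subseteq> A}" and g: "g \<in> A" "\<phi> g = 1"
    and rel: "\<And>r. r \<in> R \<Longrightarrow> free_ext (*) \<phi> r = 0"
    and gen: "\<And>a. a \<in> A \<Longrightarrow> Poly_Mapping.single a 1 \<in> free.span (R \<union> {Poly_Mapping.single g 1})"
  shows "free.basis_mod (free.span R) {p. Poly_Mapping.keys p \<subseteq> A} [Poly_Mapping.single g 1]"
    and "a \<in> A \<Longrightarrow> free.coord (free.span R) [Poly_Mapping.single g 1] (Poly_Mapping.single a 1) 0 = \<phi> a"
proof -
  let ?E = "{p :: 'i \<Rightarrow>\<^sub>0 'f. Poly_Mapping.keys p \<subseteq> A}" and ?g = "Poly_Mapping.single g (1 :: 'f)"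
  interpret \<phi>: lin_map free_scale "(*)" "free_ext (*) \<phi>" by (rule free_ext_linear[OF vsp_mult])
  have \<phi>1: "free_ext (*) \<phi> (Poly_Mapping.single a c) = c * \<phi> a" for a c by (rule free_ext_single[OF vsp_mult])
  have rel': "free_ext (*) \<phi> r = 0" if "r \<in> free.span R" for r
    using that by (induction rule: free.span_induct_alt) (simp_all add: \<phi>.zero \<phi>.add \<phi>.scale rel)
  show b: "free.basis_mod (free.span R) ?E [?g]"
  proof (rule free.basis_modI)
    show "free.span R \<subseteq> ?E" by (rule free.span_minimal[OF R keys_subspace])
    show "set [?g] \<subseteq> ?E" using g by simp
    show "free.subspace ?E" by (rule keys_subspace)
    fix p assume "p \<in> ?E"
    then have "(\<lambda>i. Poly_Mapping.single i 1) ` Poly_Mapping.keys p \<subseteq> free.span (R \<union> {?g})" using gen by auto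
    then have "p \<in> free.span (R \<union> {?g})"
      using keys_in_span[of p] free.span_minimal[OF _ free.subspace_span] by blast
    then obtain c where "p - free_scale c ?g \<in> free.span R" using free.span_breakdown_eq[of p ?g R] by auto
    then have "p - free.lcomb [?g] (\<lambda>_. c) \<in> free.span R" by (simp add: free.lcomb_def)
    then show "\<exists>c. p - free.lcomb [?g] c \<in> free.span R" by blast
  next
    fix c i assume "free.lcomb [?g] c \<in> free.span R" "i < length [?g]"
    then have "free_ext (*) \<phi> (free_scale (c 0) ?g) = 0" "i = 0" using rel' by (simp_all add: free.lcomb_def)
    then show "c i = 0" by (simp add: free_scale_single \<phi>1 g)
  qed simp
  assume a: "a \<in> A"
  have "Poly_Mapping.single a 1 - free.lcomb [?g] (free.coord (free.span R) [?g] (Poly_Mapping.single a 1)) \<in> free.span R"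
    by (rule free.coord_diff_in[OF b]) (use a in simp)
  from rel'[OF this] show "free.coord (free.span R) [?g] (Poly_Mapping.single a 1) 0 = \<phi> a"
    by (simp add: free.lcomb_def \<phi>.diff free_scale_single \<phi>1 g)
qed

text \<open>The product of the two coefficients is bilinear and separates the generator from the
  relations; scaling one factor at a time reduces every pure tensor to it.\<close>

lemma tensor_line:
  fixes L1 :: "('f::field, 'v) module"
  assumes l1: "is_line L1 g1" and l2: "is_line L2 g2"
  shows "is_line (tensor_space L1 L2) (pure_tensor L1 L2 g1 g2)"
    and "pure_tensor L1 L2 (a \<odot>\<^bsub>L1\<^esub> g1) (b \<odot>\<^bsub>L2\<^esub> g2) = (a * b) \<odot>\<^bsub>tensor_space L1 L2\<^esub> pure_tensor L1 L2 g1 g2"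
proof -
  note D1 = is_lineD[OF l1] and D2 = is_lineD[OF l2]
  define i1 where "i1 = lcoef L1 g1"
  define i2 where "i2 = lcoef L2 g2"
  have i1: "i1 (c \<odot>\<^bsub>L1\<^esub> g1) = c" and i2: "i2 (c \<odot>\<^bsub>L2\<^esub> g2) = c" for c
    unfolding i1_def i2_def by (rule lcoef_smult[OF l1] lcoef_smult[OF l2])+
  have g: "g1 \<in> carrier L1" "g2 \<in> carrier L2" "i1 g1 = 1" "i2 g2 = 1"
    using D1(2,7) D2(2,7) i1 i2 by metis+
  let ?sg = "\<lambda>v w c. Poly_Mapping.single (v, w) (c::'f)"
  define R where "R =
    {?sg (x \<oplus>\<^bsub>L1\<^esub> y) w 1 - ?sg x w 1 - ?sg y w 1
      | x y w. x \<in> carrier L1 \<and> y \<in> carrier L1 \<and> w \<in> carrier L2} \<union>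
    {?sg v (x \<oplus>\<^bsub>L2\<^esub> y) 1 - ?sg v x 1 - ?sg v y 1
      | v x y. v \<in> carrier L1 \<and> x \<in> carrier L2 \<and> y \<in> carrier L2} \<union>
    {?sg (c \<odot>\<^bsub>L1\<^esub> v) w 1 - ?sg v w c | c v w. v \<in> carrier L1 \<and> w \<in> carrier L2} \<union>
    {?sg v (c \<odot>\<^bsub>L2\<^esub> w) 1 - ?sg v w c | c v w. v \<in> carrier L1 \<and> w \<in> carrier L2}"
  have rels: "tensor_relations L1 L2 = free.span R"
    unfolding tensor_relations_def R_def free_span_eq ..
  let ?A = "carrier L1 \<times> carrier L2"
  let ?\<phi> = "\<lambda>(v, w). i1 v * i2 w"
  interpret \<phi>: lin_map free_scale "(*)" "free_ext (*) ?\<phi>" by (rule free_ext_linear[OF vsp_mult])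
  have \<phi>1: "free_ext (*) ?\<phi> (?sg v w c) = c * (i1 v * i2 w)" for v w c by (simp add: free_ext_single[OF vsp_mult])
  note cl1 = line_closed[OF l1, folded i1_def] and cl2 = line_closed[OF l2, folded i2_def]
  define E where "E = {p :: _ \<Rightarrow>\<^sub>0 'f. Poly_Mapping.keys p \<subseteq> ?A}"
  have sE: "?sg v w c \<in> E" if "v \<in> carrier L1" "w \<in> carrier L2" for v w c
    using that by (simp add: E_def)
  have dE: "p - q \<in> E" if "p \<in> E" "q \<in> E" for p q
    unfolding E_def using free.subspace_diff[OF keys_subspace] that[unfolded E_def] by blast
  have "R \<subseteq> E" unfolding R_def using cl1 cl2 by (auto intro!: dE sE)
  then have RE: "R \<subseteq> {p. Poly_Mapping.keys p \<subseteq> ?A}" by (simp only: E_def)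
  have rels0: "free_ext (*) ?\<phi> (?sg (x \<oplus>\<^bsub>L1\<^esub> y) w 1 - ?sg x w 1 - ?sg y w 1) = 0"
      "free_ext (*) ?\<phi> (?sg (c \<odot>\<^bsub>L1\<^esub> x) w 1 - ?sg x w c) = 0"
    if "x \<in> carrier L1" "y \<in> carrier L1" for x y w c
    using cl1(2,4)[OF that(1)] that(2) by (simp_all add: \<phi>.diff \<phi>1 distrib_right)
  have rels1: "free_ext (*) ?\<phi> (?sg v (x \<oplus>\<^bsub>L2\<^esub> y) 1 - ?sg v x 1 - ?sg v y 1) = 0"
      "free_ext (*) ?\<phi> (?sg v (c \<odot>\<^bsub>L2\<^esub> x) 1 - ?sg v x c) = 0"
    if "x \<in> carrier L2" "y \<in> carrier L2" for x y v c
    using cl2(2,4)[OF that(1)] that(2) by (simp_all add: \<phi>.diff \<phi>1 distrib_left)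
  have rel: "free_ext (*) ?\<phi> r = 0" if "r \<in> R" for r
    using that unfolding R_def
    by (elim UnE CollectE exE conjE) (metis rels0 rels1)+
  have gen: "?sg (a \<odot>\<^bsub>L1\<^esub> g1) (b \<odot>\<^bsub>L2\<^esub> g2) 1 \<in> free.span (R \<union> {?sg g1 g2 1})" for a b
  proof -
    let ?S = "R \<union> {?sg g1 g2 1}"
    have "?sg g1 (b \<odot>\<^bsub>L2\<^esub> g2) 1 - ?sg g1 g2 b \<in> R" unfolding R_def using g by blast
    then have "(?sg g1 (b \<odot>\<^bsub>L2\<^esub> g2) 1 - ?sg g1 g2 b) + free_scale b (?sg g1 g2 1) \<in> free.span ?S"
      by (intro free.span_add free.span_scale free.span_base) auto
    then have 1: "?sg g1 (b \<odot>\<^bsub>L2\<^esub> g2) 1 \<in> free.span ?S" by (simp add: free_scale_single)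
    have "?sg (a \<odot>\<^bsub>L1\<^esub> g1) (b \<odot>\<^bsub>L2\<^esub> g2) 1 - ?sg g1 (b \<odot>\<^bsub>L2\<^esub> g2) a \<in> R" unfolding R_def using g D2(2) by blast
    then have "(?sg (a \<odot>\<^bsub>L1\<^esub> g1) (b \<odot>\<^bsub>L2\<^esub> g2) 1 - ?sg g1 (b \<odot>\<^bsub>L2\<^esub> g2) a) +
        free_scale a (?sg g1 (b \<odot>\<^bsub>L2\<^esub> g2) 1) \<in> free.span ?S"
      using 1 by (intro free.span_add free.span_scale) (auto intro: free.span_base)
    then show ?thesis by (simp add: free_scale_single)
  qed
  have gen': "Poly_Mapping.single a 1 \<in> free.span (R \<union> {?sg g1 g2 1})" if "a \<in> ?A" for a
    using that gen by (auto elim!: is_line_carrierE[OF l1] is_line_carrierE[OF l2])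
  note b = free_line_basis[OF RE, of "(g1, g2)" ?\<phi>, OF _ _ rel gen']
  have b1: "free.basis_mod (free.span R) {p. Poly_Mapping.keys p \<subseteq> ?A} [?sg g1 g2 1]"
    by (rule b(1)) (use g in simp_all)
  interpret T: pres free_scale "free.span R" "{p. Poly_Mapping.keys p \<subseteq> ?A}" "tensor_space L1 L2" "vcoset (free.span R)"
    unfolding tensor_space_def rels by (rule free.pres_quotient) (use free.basis_modD[OF b1] in simp_all)
  show "is_line (tensor_space L1 L2) (pure_tensor L1 L2 g1 g2)"
    unfolding pure_tensor_def rels by (rule T.is_line_basis(1)[OF b1])
  show "pure_tensor L1 L2 (a \<odot>\<^bsub>L1\<^esub> g1) (b \<odot>\<^bsub>L2\<^esub> g2) = (a * b) \<odot>\<^bsub>tensor_space L1 L2\<^esub> pure_tensor L1 L2 g1 g2"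
    unfolding pure_tensor_def rels
    using T.is_line_basis(2)[OF b1, of "?sg (a \<odot>\<^bsub>L1\<^esub> g1) (b \<odot>\<^bsub>L2\<^esub> g2) 1"]
      b(2)[of "(a \<odot>\<^bsub>L1\<^esub> g1, b \<odot>\<^bsub>L2\<^esub> g2)"] by (simp add: D1(2) D2(2) g i1 i2)
qed

section \<open>Exterior powers\<close>

definition mod_closed :: "('f::field, 'v) module \<Rightarrow> bool" where
  "mod_closed V \<longleftrightarrow> (\<forall>x\<in>carrier V. \<forall>y\<in>carrier V. x \<oplus>\<^bsub>V\<^esub> y \<in> carrier V) \<and>
    (\<forall>c. \<forall>x\<in>carrier V. c \<odot>\<^bsub>V\<^esub> x \<in> carrier V)"

lemma (in pres) mod_closed: "mod_closed V"
  unfolding mod_closed_def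
  by (auto elim!: carrierE simp: \<pi>_add \<pi>_smult intro!: \<pi>_in subspace_add[OF sK] subspace_scale[OF sK])

lemma vs_hom_iff:
  "f \<in> vs_hom V W \<longleftrightarrow> (\<forall>x\<in>carrier V. f x \<in> carrier W) \<and>
    (\<forall>x\<in>carrier V. \<forall>y\<in>carrier V. f (x \<oplus>\<^bsub>V\<^esub> y) = f x \<oplus>\<^bsub>W\<^esub> f y) \<and>
    (\<forall>c. \<forall>x\<in>carrier V. f (c \<odot>\<^bsub>V\<^esub> x) = c \<odot>\<^bsub>W\<^esub> f x)"
  unfolding vs_hom_def LinearCombinations.module_hom_def by (auto simp: class_ring_simps)

definition ext_gens :: "nat \<Rightarrow> ('f::field, 'v) module \<Rightarrow> ('v list \<Rightarrow>\<^sub>0 'f) set" where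
  "ext_gens k V =
    {Poly_Mapping.single (xs[i := x \<oplus>\<^bsub>V\<^esub> y]) 1
        - Poly_Mapping.single (xs[i := x]) 1 - Poly_Mapping.single (xs[i := y]) 1
      | xs i x y. xs \<in> ext_lists k V \<and> i < k \<and> x \<in> carrier V \<and> y \<in> carrier V} \<union>
    {Poly_Mapping.single (xs[i := c \<odot>\<^bsub>V\<^esub> x]) 1 - Poly_Mapping.single (xs[i := x]) c
      | xs i c x. xs \<in> ext_lists k V \<and> i < k \<and> x \<in> carrier V} \<union>
    {Poly_Mapping.single xs 1
      | xs i j. xs \<in> ext_lists k V \<and> i < j \<and> j < k \<and> xs ! i = xs ! j}"

lemma ext_relations_eq: "ext_relations k V = free.span (ext_gens k V)"
  unfolding ext_relations_def ext_gens_def free_span_eq ..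

lemma ext_gensE [consumes 1, case_names add smult repeat]:
  assumes "r \<in> ext_gens k V"
  obtains xs i x y where "xs \<in> ext_lists k V" "i < k" "x \<in> carrier V" "y \<in> carrier V"
      "r = Poly_Mapping.single (xs[i := x \<oplus>\<^bsub>V\<^esub> y]) 1
        - Poly_Mapping.single (xs[i := x]) 1 - Poly_Mapping.single (xs[i := y]) 1"
  | xs i c x where "xs \<in> ext_lists k V" "i < k" "x \<in> carrier V"
      "r = Poly_Mapping.single (xs[i := c \<odot>\<^bsub>V\<^esub> x]) 1 - Poly_Mapping.single (xs[i := x]) c"
  | xs i j where "xs \<in> ext_lists k V" "i < j" "j < k" "xs ! i = xs ! j" "r = Poly_Mapping.single xs 1"
  using assms unfolding ext_gens_def by (elim UnE CollectE exE conjE) blast+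

lemma ext_gensI:
  "xs \<in> ext_lists k V \<Longrightarrow> i < k \<Longrightarrow> x \<in> carrier V \<Longrightarrow> y \<in> carrier V \<Longrightarrow>
    Poly_Mapping.single (xs[i := x \<oplus>\<^bsub>V\<^esub> y]) 1
        - Poly_Mapping.single (xs[i := x]) 1 - Poly_Mapping.single (xs[i := y]) 1 \<in> ext_gens k V"
  "xs \<in> ext_lists k V \<Longrightarrow> i < k \<Longrightarrow> x \<in> carrier V \<Longrightarrow>
    Poly_Mapping.single (xs[i := c \<odot>\<^bsub>V\<^esub> x]) 1 - Poly_Mapping.single (xs[i := x]) c \<in> ext_gens k V"
  "xs \<in> ext_lists k V \<Longrightarrow> i < k \<Longrightarrow> j < k \<Longrightarrow> i \<noteq> j \<Longrightarrow> xs ! i = xs ! j \<Longrightarrow>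
    Poly_Mapping.single xs 1 \<in> ext_gens k V"
proof -
  assume *: "xs \<in> ext_lists k V" "i < k" "j < k" "i \<noteq> j" "xs ! i = xs ! j"
  then have "\<exists>a b. a < b \<and> b < k \<and> xs ! a = xs ! b" by (metis linorder_neqE_nat)
  then show "Poly_Mapping.single xs 1 \<in> ext_gens k V"
    unfolding ext_gens_def using *(1) by blast
qed (unfold ext_gens_def, blast+)

lemma ext_lists_update:
  "xs \<in> ext_lists k V \<Longrightarrow> x \<in> carrier V \<Longrightarrow> xs[i := x] \<in> ext_lists k V"
  unfolding ext_lists_def using set_update_subset_insert[of xs i x] by auto

lemma ext_gens_subset:
  assumes "mod_closed V"
  shows "ext_gens k V \<subseteq> {p. Poly_Mapping.keys p \<subseteq> ext_lists k V}" (is "_ \<subseteq> ?E")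
proof
  have d: "p - q \<in> ?E" if "p \<in> ?E" "q \<in> ?E" for p q
    using free.subspace_diff[OF keys_subspace] that by blast
  have s: "Poly_Mapping.single xs c \<in> ?E" if "xs \<in> ext_lists k V" for xs c using that by simp
  fix r assume "r \<in> ext_gens k V"
  then show "r \<in> ?E"
  proof (cases rule: ext_gensE)
    case (add xs i x y)
    have "x \<oplus>\<^bsub>V\<^esub> y \<in> carrier V" using assms add by (simp add: mod_closed_def)
    then show ?thesis unfolding add(5) using add by (intro d s ext_lists_update)
  next
    case (smult xs i c x)
    have "c \<odot>\<^bsub>V\<^esub> x \<in> carrier V" using assms smult by (simp add: mod_closed_def)
    then show ?thesis unfolding smult(4) using smult by (intro d s ext_lists_update)
  next
    case (repeat xs i j)
    then show ?thesis by (simp only: s)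
  qed
qed

definition ext_cls :: "nat \<Rightarrow> ('f::field, 'v) module \<Rightarrow> 'v list \<Rightarrow> ('v list \<Rightarrow>\<^sub>0 'f) set" where
  "ext_cls k V xs = vcoset (ext_relations k V) (Poly_Mapping.single xs 1)"

lemma ext_pres:
  assumes "mod_closed V"
  shows "pres free_scale (ext_relations k V) {p. Poly_Mapping.keys p \<subseteq> ext_lists k V} (ext_power k V)
    (vcoset (ext_relations k V))"
  unfolding ext_power_def ext_relations_eq
  by (intro free.pres_quotient free.subspace_span keys_subspace
      free.span_minimal[OF ext_gens_subset[OF assms] keys_subspace])

lemma smult_ext_cls:
  assumes "mod_closed V" "xs \<in> ext_lists k V"
  shows "c \<odot>\<^bsub>ext_power k V\<^esub> ext_cls k V xs = vcoset (ext_relations k V) (Poly_Mapping.single xs c)"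
proof -
  interpret pres free_scale "ext_relations k V" "{p. Poly_Mapping.keys p \<subseteq> ext_lists k V}"
    "ext_power k V" "vcoset (ext_relations k V)" by (rule ext_pres[OF assms(1)])
  show ?thesis unfolding ext_cls_def using assms(2) by (subst \<pi>_smult) (simp_all add: free_scale_single)
qed

lemma span_map_subset:
  assumes "lin_map s1 s2 h" "module.subspace s2 S" "\<And>g. g \<in> G \<Longrightarrow> h g \<in> S" "r \<in> module.span s1 G"
  shows "h r \<in> S"
proof -
  interpret h: lin_map s1 s2 h by fact
  have "h ` h.vs1.span G = h.vs2.span (h ` G)" by (simp add: h.span_image)
  also have "\<dots> \<subseteq> S" using assms by (intro h.vs2.span_minimal) auto
  finally show ?thesis using assms(4) by auto
qed

text \<open>Induced maps are defined as unions over all representatives of a coset; these collapse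
  to one coset as soon as \<open>h\<close> respects the relations.\<close>

lemma vcoset_UN_map:
  assumes h: "lin_map free_scale free_scale h" and R: "\<And>r. r \<in> R \<Longrightarrow> h r \<in> R'"
    and s: "free.subspace R" "free.subspace R'"
  shows "(\<Union>p\<in>vcoset R p0. vcoset R' (h p)) = vcoset R' (h p0)"
proof (rule UN_const_on[OF _ free.vcoset_nonempty[OF s(1)]])
  interpret h: lin_map free_scale free_scale h by fact
  fix p assume "p \<in> vcoset R p0"
  then have "h (p - p0) \<in> R'" using R by (simp add: free.mem_vcoset_iff)
  then show "vcoset R' (h p) = vcoset R' (h p0)" by (simp add: free.vcoset_eq_iff[OF s(2)] h.diff)
qed

section \<open>Induced maps and wedge products of classes of lists\<close>

definition list_map :: "('i \<Rightarrow> 'j) \<Rightarrow> ('i \<Rightarrow>\<^sub>0 'f::field) \<Rightarrow> ('j \<Rightarrow>\<^sub>0 'f)" where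
  "list_map f = free_ext free_scale (\<lambda>xs. Poly_Mapping.single (f xs) 1)"

lemma list_map_eq:
  "list_map f p = (\<Sum>xs\<in>Poly_Mapping.keys p. Poly_Mapping.single (f xs) (Poly_Mapping.lookup p xs))"
  by (simp add: list_map_def free_ext_def free_scale_single)

lemma list_map_linear: "lin_map free_scale free_scale (list_map f)"
  unfolding list_map_def by (rule free_ext_linear[OF free.vsp_axioms])

lemma list_map_single [simp]: "list_map f (Poly_Mapping.single xs c) = Poly_Mapping.single (f xs) c"
  by (simp add: list_map_def free_ext_single[OF free.vsp_axioms] free_scale_single)

text \<open>A map of lists that is compatible with the relations: at a position \<open>i\<close> it updates position
  \<open>h i\<close> by a linear map.\<close>

lemma list_map_relations:
  assumes F: "\<And>xs. xs \<in> ext_lists k V \<Longrightarrow> F xs \<in> ext_lists k' W"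
    and h: "inj_on h {..<k}" "\<And>i. i < k \<Longrightarrow> h i < k'"
    and upd: "\<And>xs i x. xs \<in> ext_lists k V \<Longrightarrow> i < k \<Longrightarrow> x \<in> carrier V \<Longrightarrow> F (xs[i := x]) = (F xs)[h i := f x]"
    and nth: "\<And>xs i. xs \<in> ext_lists k V \<Longrightarrow> i < k \<Longrightarrow> F xs ! h i = f (xs ! i)"
    and f: "f \<in> vs_hom V W" and V: "mod_closed V" and r: "r \<in> ext_relations k V"
  shows "list_map F r \<in> ext_relations k' W"
proof (rule span_map_subset[OF list_map_linear _ _ r[unfolded ext_relations_eq]])
  interpret m: lin_map free_scale free_scale "list_map F" by (rule list_map_linear)
  show "free.subspace (ext_relations k' W)" by (simp add: ext_relations_eq)
  have f': "f x \<in> carrier W" "f (x \<oplus>\<^bsub>V\<^esub> y) = f x \<oplus>\<^bsub>W\<^esub> f y" "f (c \<odot>\<^bsub>V\<^esub> x) = c \<odot>\<^bsub>W\<^esub> f x"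
    "x \<oplus>\<^bsub>V\<^esub> y \<in> carrier V" "c \<odot>\<^bsub>V\<^esub> x \<in> carrier V"
    if "x \<in> carrier V" "y \<in> carrier V" for x y c using f V that by (auto simp: vs_hom_iff mod_closed_def)
  fix g assume "g \<in> ext_gens k V"
  then have "list_map F g \<in> ext_gens k' W"
  proof (cases rule: ext_gensE)
    case (add xs i x y)
    have "list_map F g = Poly_Mapping.single ((F xs)[h i := f x \<oplus>\<^bsub>W\<^esub> f y]) 1
        - Poly_Mapping.single ((F xs)[h i := f x]) 1 - Poly_Mapping.single ((F xs)[h i := f y]) 1"
      using add f' by (simp add: m.diff upd)
    then show ?thesis using ext_gensI(1)[OF F h(2)] add f' by simp
  next
    case (smult xs i c x)
    have "list_map F g = Poly_Mapping.single ((F xs)[h i := c \<odot>\<^bsub>W\<^esub> f x]) 1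
        - Poly_Mapping.single ((F xs)[h i := f x]) c"
      using smult f' by (simp add: m.diff upd)
    then show ?thesis using ext_gensI(2)[OF F h(2)] smult f' by simp
  next
    case (repeat xs i j)
    have "h i \<noteq> h j" using h(1) repeat by (auto dest: inj_onD)
    then show ?thesis using repeat nth ext_gensI(3)[OF F h(2) h(2), of xs i j] by simp
  qed
  then show "list_map F g \<in> ext_relations k' W" unfolding ext_relations_eq by (rule free.span_base)
qed

lemma ext_map_cls:
  assumes f: "f \<in> vs_hom V W" and V: "mod_closed V" "mod_closed W" and xs: "xs \<in> ext_lists k V"
  shows "ext_map k W f (c \<odot>\<^bsub>ext_power k V\<^esub> ext_cls k V xs) =
    c \<odot>\<^bsub>ext_power k W\<^esub> ext_cls k W (map f xs)"
proof -
  have F: "map f ys \<in> ext_lists k W" if "ys \<in> ext_lists k V" for ys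
    using that f by (auto simp: ext_lists_def vs_hom_iff)
  have "list_map (map f) r \<in> ext_relations k W" if "r \<in> ext_relations k V" for r
    by (rule list_map_relations[OF F _ _ _ _ f V(1) that, of "\<lambda>i. i"])
       (auto simp: map_update ext_lists_def)
  then have "(\<Union>p\<in>vcoset (ext_relations k V) (Poly_Mapping.single xs c). vcoset (ext_relations k W) (list_map (map f) p))
      = vcoset (ext_relations k W) (list_map (map f) (Poly_Mapping.single xs c))"
    by (intro vcoset_UN_map list_map_linear) (simp_all add: ext_relations_eq)
  then show ?thesis
    unfolding smult_ext_cls[OF V(1) xs] smult_ext_cls[OF V(2) F[OF xs]] ext_map_def list_map_eq[symmetric]
    by simp
qed

text \<open>A relation in the left factor stays one after appending any list, a relation in the
  right factor after prefixing \<open>xs\<close>; so the product of representatives is determined up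
  to relations.\<close>

lemma ext_wedge_cls:
  assumes V: "mod_closed V" and xs: "xs \<in> ext_lists j V" and ys: "ys \<in> ext_lists k V"
  shows "ext_wedge j k V (c \<odot>\<^bsub>ext_power j V\<^esub> ext_cls j V xs) (d \<odot>\<^bsub>ext_power k V\<^esub> ext_cls k V ys) =
    (c * d) \<odot>\<^bsub>ext_power (j + k) V\<^esub> ext_cls (j + k) V (xs @ ys)"
proof -
  let ?R = "ext_relations (j + k) V"
  let ?wm = "\<lambda>p q. \<Sum>xs\<in>Poly_Mapping.keys p. \<Sum>ys\<in>Poly_Mapping.keys q.
      Poly_Mapping.single (xs @ ys) (Poly_Mapping.lookup p xs * Poly_Mapping.lookup q ys)"
  have wm: "?wm p q = free_ext free_scale (\<lambda>ys. list_map (\<lambda>xs. xs @ ys) p) q" for p q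
    unfolding list_map_eq free_ext_def
    by (subst sum.swap) (simp add: free.scale_sum_right free_scale_single mult.commute)
  have wm': "?wm p q = free_ext free_scale (\<lambda>xs. list_map (\<lambda>ys. xs @ ys) q) p" for p q
    unfolding list_map_eq free_ext_def by (simp add: free.scale_sum_right free_scale_single)
  have sR: "free.subspace ?R" by (simp add: ext_relations_eq)
  have id: "(\<lambda>x. x) \<in> vs_hom V V" by (simp add: vs_hom_iff)
  have left: "?wm r q \<in> ?R" if r: "r \<in> ext_relations j V" and q: "Poly_Mapping.keys q \<subseteq> ext_lists k V" for r q
    unfolding wm free_ext_def
  proof (intro free.subspace_sum[OF sR] free.subspace_scale[OF sR])
    fix ys assume "ys \<in> Poly_Mapping.keys q"
    then have ys: "ys \<in> ext_lists k V" using q by auto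
    show "list_map (\<lambda>xs. xs @ ys) r \<in> ?R"
      by (rule list_map_relations[OF _ _ _ _ _ id V r, of _ _ "\<lambda>i. i"])
         (use ys in \<open>auto simp: ext_lists_def list_update_append1 nth_append\<close>)
  qed
  have right: "list_map (\<lambda>ys. xs @ ys) r \<in> ?R" if r: "r \<in> ext_relations k V" for r
    by (rule list_map_relations[OF _ _ _ _ _ id V r, of _ _ "\<lambda>i. j + i"])
       (use xs in \<open>auto simp: ext_lists_def list_update_append nth_append\<close>)
  interpret E: pres free_scale "ext_relations k V" "{p. Poly_Mapping.keys p \<subseteq> ext_lists k V}"
    "ext_power k V" "vcoset (ext_relations k V)" by (rule ext_pres[OF V])
  have eq: "vcoset ?R (?wm p q) = vcoset ?R (Poly_Mapping.single (xs @ ys) (c * d))"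
    if p: "p \<in> vcoset (ext_relations j V) (Poly_Mapping.single xs c)"
      and q: "q \<in> vcoset (ext_relations k V) (Poly_Mapping.single ys d)" for p q
  proof -
    let ?p0 = "Poly_Mapping.single xs c" and ?q0 = "Poly_Mapping.single ys d"
    interpret A: lin_map free_scale free_scale "free_ext free_scale (\<lambda>xs. list_map (\<lambda>ys. xs @ ys) q)"
      by (rule free_ext_linear[OF free.vsp_axioms])
    interpret B: lin_map free_scale free_scale "list_map (\<lambda>ys. xs @ ys)" by (rule list_map_linear)
    have q': "q - ?q0 \<in> ext_relations k V" using q by (simp add: free.mem_vcoset_iff)
    have "q = (q - ?q0) + ?q0" by simp
    moreover have "\<dots> \<in> {p. Poly_Mapping.keys p \<subseteq> ext_lists k V}"
      by (rule free.subspace_add[OF keys_subspace]) (use q' E.UK ys in auto)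
    ultimately have kq: "Poly_Mapping.keys q \<subseteq> ext_lists k V" by simp
    \<comment> \<open>With \<open>p0\<close>, \<open>q0\<close> the two singletons:
      \<open>p q - p0 q0 = (p - p0) q + p0 (q - q0)\<close>, and both summands are
      relations.\<close>
    have "?wm (p - ?p0) q \<in> ?R" by (rule left[OF _ kq]) (use p in \<open>simp add: free.mem_vcoset_iff\<close>)
    moreover have "free_scale c (list_map (\<lambda>ys. xs @ ys) (q - ?q0)) \<in> ?R"
      by (intro free.subspace_scale[OF sR] right q')
    ultimately have "?wm (p - ?p0) q + free_scale c (list_map (\<lambda>ys. xs @ ys) (q - ?q0)) \<in> ?R"
      by (rule free.subspace_add[OF sR])
    also have "?wm (p - ?p0) q + free_scale c (list_map (\<lambda>ys. xs @ ys) (q - ?q0)) =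
        ?wm p q - Poly_Mapping.single (xs @ ys) (c * d)"
      unfolding wm' A.diff B.diff
      by (simp add: free_ext_single[OF free.vsp_axioms] free.scale_right_diff_distrib free_scale_single)
    finally show ?thesis by (simp add: free.vcoset_eq_iff[OF sR])
  qed
  have xys: "xs @ ys \<in> ext_lists (j + k) V" using xs ys by (auto simp: ext_lists_def)
  show ?thesis
    unfolding smult_ext_cls[OF V xs] smult_ext_cls[OF V ys] smult_ext_cls[OF V xys] ext_wedge_def
    by (intro UN_const_on[OF _ free.vcoset_nonempty] eq) (simp_all add: ext_relations_eq)
qed

section \<open>Determinant lines\<close>

text \<open>In the Leibniz formula every summand contains exactly one factor from column
  \<open>i\<close>.\<close>

lemma det_column_add:
  fixes a b :: "nat \<Rightarrow> 'f::comm_ring_1"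
  assumes "i < n"
  shows "Determinant.det (mat n n (\<lambda>(r, j). if j = i then a r + b r else C r j)) =
    Determinant.det (mat n n (\<lambda>(r, j). if j = i then a r else C r j)) +
    Determinant.det (mat n n (\<lambda>(r, j). if j = i then b r else C r j))"
    and "Determinant.det (mat n n (\<lambda>(r, j). if j = i then c * a r else C r j)) =
    c * Determinant.det (mat n n (\<lambda>(r, j). if j = i then a r else C r j))"
proof -
  have *: "Determinant.det (mat n n (\<lambda>(r, j). if j = i then f r else C r j)) =
      (\<Sum>p | p permutes {0..<n}. f (p i) * (signof p * (\<Prod>j\<in>{..<n} - {i}. C (p j) j)))" for f :: "nat \<Rightarrow> 'f"
  proof (subst det_col[of _ n], simp, rule sum.cong[OF refl])
    fix p assume "p \<in> {p. p permutes {0..<n}}"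
    then have p: "p j < n" if "j < n" for j using that permutes_in_image[of p "{0..<n}" j] by auto
    have "(\<Prod>j<n. mat n n (\<lambda>(r, j). if j = i then f r else C r j) $$ (p j, j)) =
        (\<Prod>j<n. if j = i then f (p j) else C (p j) j)"
      by (rule prod.cong) (auto simp: p)
    also have "\<dots> = f (p i) * (\<Prod>j\<in>{..<n} - {i}. C (p j) j)"
      using assms by (subst prod.remove[of _ i]) (auto intro!: arg_cong2[of _ _ _ _ "(*)"] prod.cong)
    finally show "signof p * (\<Prod>j<n. mat n n (\<lambda>(r, j). if j = i then f r else C r j) $$ (p j, j)) =
        f (p i) * (signof p * (\<Prod>j\<in>{..<n} - {i}. C (p j) j))" by (simp add: mult_ac)
  qed
  show "Determinant.det (mat n n (\<lambda>(r, j). if j = i then a r + b r else C r j)) =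
    Determinant.det (mat n n (\<lambda>(r, j). if j = i then a r else C r j)) +
    Determinant.det (mat n n (\<lambda>(r, j). if j = i then b r else C r j))"
    unfolding * by (simp add: distrib_right sum.distrib)
  show "Determinant.det (mat n n (\<lambda>(r, j). if j = i then c * a r else C r j)) =
    c * Determinant.det (mat n n (\<lambda>(r, j). if j = i then a r else C r j))"
    unfolding * by (simp add: sum_distrib_left mult.assoc)
qed

lemma det_equal_columns:
  fixes C :: "nat \<Rightarrow> nat \<Rightarrow> 'f::comm_ring_1"
  assumes "i < n" "j < n" "i \<noteq> j" "\<And>r. C r i = C r j"
  shows "Determinant.det (mat n n (\<lambda>(r, j). C r j)) = 0"
proof -
  let ?M = "mat n n (\<lambda>(r, j). C r j)"
  have "Determinant.det ?M = Determinant.det (?M\<^sup>T)" by (rule det_transpose[of _ n, symmetric]) simp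
  also have "\<dots> = 0"
    by (rule det_identical_rows[of _ n i j]) (use assms in \<open>auto intro!: eq_vecI\<close>)
  finally show ?thesis .
qed

text \<open>Expand the list with \<open>a \<oplus> b\<close> at both places and delete the lists
  with a repeated entry. The argument is valid in every characteristic.\<close>

lemma ext_swap:
  fixes V :: "('f::field, 'v) module"
  assumes V: "mod_closed V" and xs: "xs \<in> ext_lists k V" and i: "i < k" "j < k" "i \<noteq> j"
    and ab: "a \<in> carrier V" "b \<in> carrier V"
  shows "Poly_Mapping.single (xs[i := a, j := b]) 1 + Poly_Mapping.single (xs[i := b, j := a]) 1
    \<in> ext_relations k V"
proof -
  let ?R = "ext_relations k V" and ?s = "\<lambda>u v. Poly_Mapping.single (xs[i := u, j := v]) (1::'f)"
  let ?c = "a \<oplus>\<^bsub>V\<^esub> b"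
  have c: "?c \<in> carrier V" using V ab by (simp add: mod_closed_def)
  have sR: "free.subspace ?R" by (simp add: ext_relations_eq)
  have G: "g \<in> ?R" if "g \<in> ext_gens k V" for g
    unfolding ext_relations_eq using that by (rule free.span_base)
  have len: "length xs = k" using xs by (simp add: ext_lists_def)
  have diag: "?s u u \<in> ?R" if "u \<in> carrier V" for u
    by (rule G, rule ext_gensI(3)[of _ _ _ i j]) (use that i len xs in \<open>simp_all add: ext_lists_update\<close>)
  have 1: "?s ?c ?c - ?s a ?c - ?s b ?c \<in> ?R"
    using G[OF ext_gensI(1)[OF ext_lists_update[OF xs c] i(1) ab, of j]] i(3)
    by (simp add: list_update_swap)
  have 2: "?s u ?c - ?s u a - ?s u b \<in> ?R" if "u \<in> carrier V" for u
    using G[OF ext_gensI(1)[OF ext_lists_update[OF xs that] i(2) ab, of i]] by simp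
  have "(?s ?c ?c - (?s ?c ?c - ?s a ?c - ?s b ?c)) - (?s a ?c - ?s a a - ?s a b) - (?s b ?c - ?s b a - ?s b b)
      - ?s a a - ?s b b \<in> ?R"
    by (intro free.subspace_diff[OF sR] diag 1 2 ab c)
  then show ?thesis by (simp add: algebra_simps)
qed

section \<open>The top exterior power is a line\<close>

context pres
begin

text \<open>Multilinearity replaces entries by basis vectors; a list of basis vectors either repeats
  an entry and vanishes, or is a permutation of \<open>map \<pi> bs\<close> and is sorted by
  exchanges.\<close>

lemma ext_single_in_span:
  assumes b: "basis_mod U K bs" and ys: "ys \<in> ext_lists (length bs) V"
  shows "Poly_Mapping.single ys 1 \<in>
    free.span (ext_gens (length bs) V \<union> {Poly_Mapping.single (map \<pi> bs) (1 :: 'f)})"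
proof -
  let ?n = "length bs" and ?g = "map \<pi> bs"
  define S where "S = free.span (ext_gens ?n V \<union> {Poly_Mapping.single ?g (1 :: 'f)})"
  note B = basis_modD[OF b]
  have sS: "free.subspace S" by (simp add: S_def)
  have GS: "r \<in> S" if "r \<in> ext_gens ?n V" for r using that by (simp add: S_def free.span_base)
  have RS: "r \<in> S" if "r \<in> ext_relations ?n V" for r
    using that free.span_mono[of "ext_gens ?n V"] unfolding S_def ext_relations_eq by blast
  have gS: "Poly_Mapping.single ?g 1 \<in> S" by (simp add: S_def free.span_base)
  have S_add: "Poly_Mapping.single (xs[i := x \<oplus>\<^bsub>V\<^esub> y]) 1 \<in> S"
    if "xs \<in> ext_lists ?n V" "i < ?n" "x \<in> carrier V" "y \<in> carrier V"
      "Poly_Mapping.single (xs[i := x]) 1 \<in> S" "Poly_Mapping.single (xs[i := y]) 1 \<in> S" for xs i x y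
    using free.subspace_add[OF sS free.subspace_add[OF sS GS[OF ext_gensI(1)[OF that(1-4)]] that(5)] that(6)]
    by (simp add: algebra_simps)
  \<comment> \<open>The membership is demanded only for \<open>c \<noteq> 0\<close>, so that
    \<open>c = 0\<close> gives the zero vector unconditionally.\<close>
  have S_smult: "Poly_Mapping.single (xs[i := c \<odot>\<^bsub>V\<^esub> x]) 1 \<in> S"
    if "xs \<in> ext_lists ?n V" "i < ?n" "x \<in> carrier V"
      "c \<noteq> 0 \<Longrightarrow> Poly_Mapping.single (xs[i := x]) 1 \<in> S" for xs i c x
  proof (cases "c = 0")
    case True
    then show ?thesis using GS[OF ext_gensI(2)[OF that(1-3), of c]] by simp
  next
    case False
    show ?thesis
      using free.subspace_add[OF sS GS[OF ext_gensI(2)[OF that(1-3), of c]]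
          free.subspace_scale[OF sS that(4)[OF False], of c]]
      by (simp add: free_scale_single)
  qed
  have g: "?g \<in> ext_lists ?n V" using B(4) \<pi>_in by (auto simp: ext_lists_def)
  \<comment> \<open>Induction on the number of positions that differ from
    \<open>map \<pi> bs\<close>: exchanging an entry with the one that belongs in its place lowers
    this number.\<close>
  have basis_lists: "Poly_Mapping.single xs 1 \<in> S" if "xs \<in> ext_lists ?n V" "set xs \<subseteq> set ?g" for xs
    using that
  proof (induction "card {i. i < ?n \<and> xs ! i \<noteq> ?g ! i}" arbitrary: xs rule: less_induct)
    case less
    have len: "length xs = ?n" using less.prems by (simp add: ext_lists_def)
    show ?case
    proof (cases "distinct xs")
      case False
      then obtain i j where "i < ?n" "j < ?n" "i \<noteq> j" "xs ! i = xs ! j"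
        using len by (auto simp: distinct_conv_nth)
      then show ?thesis using ext_gensI(3)[OF less.prems(1)] GS by blast
    next
      case True
      show ?thesis
      proof (cases "xs = ?g")
        case True
        then show ?thesis using gS by simp
      next
        case False
        then obtain i where i: "i < ?n" "xs ! i \<noteq> ?g ! i" using len by (auto simp: list_eq_iff_nth_eq)
        \<comment> \<open>A distinct list of full length inside \<open>set ?g\<close> exhausts it,
          so \<open>xs\<close> is a permutation of \<open>?g\<close> and \<open>?g\<close> is
          distinct.\<close>
        have "card (set ?g) \<le> card (set xs)"
          using distinct_card[OF True] len card_length[of ?g] by simp
        then have "set xs = set ?g" by (intro card_seteq less.prems(2)) simp
        moreover have "distinct ?g"
          using calculation distinct_card[OF True] len by (intro card_distinct) simp
        ultimately obtain j where j: "j < ?n" "xs ! j = ?g ! i" "j \<noteq> i" and dg: "?g ! i \<noteq> ?g ! j"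
          using i len by (metis in_set_conv_nth length_map nth_eq_iff_index_eq nth_mem)
        let ?zs = "xs[i := xs ! j, j := xs ! i]"
        have zs: "?zs \<in> ext_lists ?n V" "set ?zs \<subseteq> set ?g"
        proof -
          have "set ?zs = set xs" by (rule set_swap) (simp_all add: i j len)
          then show "?zs \<in> ext_lists ?n V" "set ?zs \<subseteq> set ?g"
            using less.prems by (simp_all only: ext_lists_def mem_Collect_eq length_list_update simp_thms)
        qed
        have "{k. k < ?n \<and> ?zs ! k \<noteq> ?g ! k} \<subset> {k. k < ?n \<and> xs ! k \<noteq> ?g ! k}"
        proof
          show "{k. k < ?n \<and> ?zs ! k \<noteq> ?g ! k} \<subseteq> {k. k < ?n \<and> xs ! k \<noteq> ?g ! k}"
            using i j dg len by (auto simp: nth_list_update split: if_splits)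
          have "?zs ! i = ?g ! i" using i j len by simp
          then show "{k. k < ?n \<and> ?zs ! k \<noteq> ?g ! k} \<noteq> {k. k < ?n \<and> xs ! k \<noteq> ?g ! k}" using i by blast
        qed
        then have "Poly_Mapping.single ?zs 1 \<in> S"
          by (intro less.hyps[OF psubset_card_mono zs]) simp_all
        moreover have "Poly_Mapping.single (xs[i := xs ! i, j := xs ! j]) 1 + Poly_Mapping.single ?zs 1 \<in> S"
        proof (rule RS, rule ext_swap[OF mod_closed less.prems(1) i(1) j(1) j(3)[symmetric]])
          show "xs ! i \<in> carrier V" "xs ! j \<in> carrier V"
            using less.prems(1) nth_mem i(1) j(1) len unfolding ext_lists_def by (metis (no_types, lifting) mem_Collect_eq subsetD)+
        qed
        ultimately show ?thesis using free.subspace_diff[OF sS] by fastforce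
      qed
    qed
  qed
  \<comment> \<open>The first \<open>m\<close> entries are arbitrary, the others are classes of
    basis vectors.\<close>
  have "Poly_Mapping.single xs 1 \<in> S"
    if "m \<le> ?n" "xs \<in> ext_lists ?n V" "\<And>j. m \<le> j \<Longrightarrow> j < ?n \<Longrightarrow> xs ! j \<in> set ?g" for m xs
    using that
  proof (induction m arbitrary: xs)
    case 0
    have "set xs \<subseteq> set ?g" using 0 by (auto simp: in_set_conv_nth ext_lists_def)
    then show ?case using basis_lists 0 by blast
  next
    case (Suc m)
    have len: "length xs = ?n" using Suc.prems by (simp add: ext_lists_def)
    have m: "m < ?n" using Suc.prems by simp
    \<comment> \<open>The vectors admissible at position \<open>m\<close> form a subspace; it
      contains the basis by induction, hence all its combinations.\<close>
    define T where "T = {x \<in> K. Poly_Mapping.single (xs[m := \<pi> x]) 1 \<in> S}"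
    have sT: "subspace T"
    proof (rule subspaceI)
      have "\<pi> 0 = 0 \<odot>\<^bsub>V\<^esub> \<pi> 0" using subspace_0[OF sK] by (simp add: \<pi>_smult)
      then show "0 \<in> T" using S_smult[OF Suc.prems(2) m, of "\<pi> 0" 0] subspace_0[OF sK] \<pi>_in by (simp add: T_def)
      show "x + y \<in> T" if "x \<in> T" "y \<in> T" for x y
        using that S_add[OF Suc.prems(2) m, of "\<pi> x" "\<pi> y"] subspace_add[OF sK] \<pi>_in
        by (auto simp: T_def \<pi>_add)
      show "s c x \<in> T" if "x \<in> T" for c x
        using that S_smult[OF Suc.prems(2) m, of "\<pi> x" c] subspace_scale[OF sK] \<pi>_in
        by (auto simp: T_def \<pi>_smult)
    qed
    have "set bs \<subseteq> T"
    proof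
      fix x assume x: "x \<in> set bs"
      have "Poly_Mapping.single (xs[m := \<pi> x]) 1 \<in> S"
      proof (rule Suc.IH)
        show "xs[m := \<pi> x] \<in> ext_lists ?n V" using ext_lists_update[OF Suc.prems(2)] \<pi>_in x B(4) by blast
        show "xs[m := \<pi> x] ! j \<in> set ?g" if "m \<le> j" "j < ?n" for j
          using that x Suc.prems(3)[of j] len by (cases "j = m") auto
      qed (use m in simp)
      then show "x \<in> T" using x B(4) by (auto simp: T_def)
    qed
    then have T: "lcomb bs c \<in> T" for c by (rule lcomb_in[OF sT])
    have "xs ! m \<in> carrier V" using Suc.prems(2) m by (auto simp: ext_lists_def)
    then obtain x where x: "x \<in> K" "xs ! m = \<pi> x" by (rule carrierE)
    have "\<pi> x = \<pi> (lcomb bs (coord U bs x))"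
      using \<pi>_eq_iff[OF x(1) lcomb_in[OF sK B(4)]] coord_diff_in[OF b x(1)] by simp
    then have "xs[m := \<pi> (lcomb bs (coord U bs x))] = xs" using x(2) by (metis list_update_id)
    then show ?case using T[of "coord U bs x"] unfolding T_def by simp
  qed
  from this[of ?n ys] show ?thesis using ys unfolding S_def by simp
qed

text \<open>The determinant of the coordinates is multilinear and alternating, so it kills the
  relations, and it is 1 on the basis. This identifies coefficients in \<open>det_line\<close> with
  \<open>reldet\<close> and carries all later computations.\<close>

lemma det_line_basis:
  assumes b: "basis_mod U K bs"
  shows "is_line (det_line V) (ext_cls (length bs) V (map \<pi> bs))"
    and "set xs \<subseteq> K \<Longrightarrow> length xs = length bs \<Longrightarrow>
      ext_cls (length bs) V (map \<pi> xs) = reldet U bs xs \<odot>\<^bsub>det_line V\<^esub> ext_cls (length bs) V (map \<pi> bs)"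
proof -
  let ?n = "length bs" and ?g = "map \<pi> bs"
  note B = basis_modD[OF b]
  define co where "co v = coord U bs (inv_into K \<pi> v)" for v
  have co: "co (\<pi> x) i = coord U bs x i" if "x \<in> K" "i < ?n" for x i
    unfolding co_def
  proof (rule coord_cong_mod[OF b _ that(1) that(2)])
    have "inv_into K \<pi> (\<pi> x) \<in> K" "\<pi> (inv_into K \<pi> (\<pi> x)) = \<pi> x"
      using that by (simp_all add: inv_into_into f_inv_into_f)
    then show "inv_into K \<pi> (\<pi> x) - x \<in> U" using \<pi>_eq_iff that(1) by blast
  qed
  have co_lin: "co (x \<oplus>\<^bsub>V\<^esub> y) i = co x i + co y i" "co (c \<odot>\<^bsub>V\<^esub> x) i = c * co x i"
    if "x \<in> carrier V" "y \<in> carrier V" "i < ?n" for x y c i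
    using that subspace_add[OF sK] subspace_scale[OF sK]
    by (auto elim!: carrierE simp: \<pi>_add \<pi>_smult co coord_add[OF b] coord_scale[OF b])
  define \<phi> where "\<phi> xs = Determinant.det (mat ?n ?n (\<lambda>(i, j). co (xs ! j) i))" for xs
  have \<phi>: "\<phi> (map \<pi> xs) = reldet U bs xs" if "set xs \<subseteq> K" "length xs = ?n" for xs
    unfolding \<phi>_def reldet_def
    by (intro arg_cong[of _ _ Determinant.det] eq_matI) (use that in \<open>auto simp: co subset_iff\<close>)
  have \<phi>_upd: "\<phi> (xs[i := x]) = Determinant.det (mat ?n ?n (\<lambda>(r, j). if j = i then co x r else co (xs ! j) r))"
    if "length xs = ?n" for xs i x
    unfolding \<phi>_def by (intro arg_cong[of _ _ Determinant.det] eq_matI) (use that in auto)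
  interpret L: lin_map free_scale "(*)" "free_ext (*) \<phi>" by (rule free_ext_linear[OF vsp_mult])
  have \<phi>1: "free_ext (*) \<phi> (Poly_Mapping.single xs c) = c * \<phi> xs" for xs c by (rule free_ext_single[OF vsp_mult])
  have rel: "free_ext (*) \<phi> r = 0" if "r \<in> ext_gens ?n V" for r
    using that
  proof (cases rule: ext_gensE)
    case (add xs i x y)
    have "length xs = ?n" using add by (simp add: ext_lists_def)
    moreover have "mat ?n ?n (\<lambda>(r, j). if j = i then co (x \<oplus>\<^bsub>V\<^esub> y) r else co (xs ! j) r) =
        mat ?n ?n (\<lambda>(r, j). if j = i then co x r + co y r else co (xs ! j) r)"
      by (rule eq_matI) (use add co_lin in auto)
    ultimately show ?thesis
      using det_column_add(1)[OF add(2), of "co x" "co y"] by (simp add: add(5) L.diff \<phi>1 \<phi>_upd)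
  next
    case (smult xs i c x)
    have "length xs = ?n" using smult by (simp add: ext_lists_def)
    moreover have "mat ?n ?n (\<lambda>(r, j). if j = i then co (c \<odot>\<^bsub>V\<^esub> x) r else co (xs ! j) r) =
        mat ?n ?n (\<lambda>(r, j). if j = i then c * co x r else co (xs ! j) r)"
      by (rule eq_matI) (use smult co_lin in auto)
    ultimately show ?thesis
      using det_column_add(2)[OF smult(2), of c "co x"] by (simp add: smult(4) L.diff \<phi>1 \<phi>_upd)
  next
    case (repeat xs i j)
    then have "\<phi> xs = 0" unfolding \<phi>_def
      by (intro det_equal_columns[of i _ j "\<lambda>r j. co (xs ! j) r"]) auto
    then show ?thesis by (simp add: repeat(5) \<phi>1)
  qed
  have g: "?g \<in> ext_lists ?n V" using B(4) \<pi>_in by (auto simp: ext_lists_def)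
  have g1: "\<phi> ?g = 1" using \<phi>[OF B(4) refl] reldet_self[OF b] by simp
  have fl: "free.basis_mod (ext_relations ?n V) {p. Poly_Mapping.keys p \<subseteq> ext_lists ?n V} [Poly_Mapping.single ?g 1]"
    unfolding ext_relations_eq
    by (rule free_line_basis(1)[where \<phi> = \<phi> and g = ?g and A = "ext_lists ?n V", OF ext_gens_subset[OF mod_closed] g g1])
       (rule rel, assumption, rule ext_single_in_span[OF b])
  have fl2: "free.coord (ext_relations ?n V) [Poly_Mapping.single ?g 1] (Poly_Mapping.single xs 1) 0 = \<phi> xs"
    if "xs \<in> ext_lists ?n V" for xs
    unfolding ext_relations_eq
    by (rule free_line_basis(2)[where \<phi> = \<phi> and g = ?g and A = "ext_lists ?n V", OF ext_gens_subset[OF mod_closed] g g1 _ _ that])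
       (rule rel, assumption, rule ext_single_in_span[OF b])
  have d: "det_line V = ext_power ?n V" by (simp add: det_line_def vs_dim_eq[OF b])
  interpret E: pres free_scale "ext_relations ?n V" "{p. Poly_Mapping.keys p \<subseteq> ext_lists ?n V}"
    "ext_power ?n V" "vcoset (ext_relations ?n V)" by (rule ext_pres[OF mod_closed])
  show "is_line (det_line V) (ext_cls ?n V ?g)"
    unfolding d ext_cls_def by (rule E.is_line_basis(1)[OF fl])
  assume xs: "set xs \<subseteq> K" "length xs = ?n"
  then have xs': "map \<pi> xs \<in> ext_lists ?n V" using \<pi>_in by (auto simp: ext_lists_def)
  show "ext_cls ?n V (map \<pi> xs) = reldet U bs xs \<odot>\<^bsub>det_line V\<^esub> ext_cls ?n V ?g"
    unfolding d ext_cls_def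
    using E.is_line_basis(2)[OF fl, of "Poly_Mapping.single (map \<pi> xs) 1"] xs'
      fl2[OF xs'] \<phi>[OF xs] by simp
qed

end

section \<open>The determinant line of a complex\<close>

lemma (in vsp) op_det_nonzero:
  assumes T: "lin_map scale scale T" "bij T" "finite_rank scale (\<lambda>x. x - T x)"
  shows "op_det scale T \<noteq> 0"
proof -
  interpret T: lin_map scale scale T by fact
  have inv: "inv_into UNIV T (T x) = x" "T (inv_into UNIV T x) = x" for x
    using T(2) by (simp_all add: bij_is_inj bij_is_surj surj_f_inv_f)
  have I: "lin_map scale scale (inv_into UNIV T)" by (rule lin_map_inv[OF T(1,2)])
  interpret I: lin_map scale scale "inv_into UNIV T" by (rule I)
  \<comment> \<open>With \<open>I\<close> the inverse of \<open>T\<close>,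
    \<open>1 - I = - I (1 - T)\<close>; so \<open>I\<close> has a determinant, and it is inverse to
    that of \<open>T\<close>.\<close>
  have "finite_rank scale (\<lambda>x. 0 - inv_into UNIV T (x - T x))"
    by (rule finite_rank_add(2)[OF finite_rank_zero finite_rank_linear[OF I T(3)]])
  then have fI: "finite_rank scale (\<lambda>x. x - inv_into UNIV T x)" by (simp add: I.diff inv)
  have id: "lin_map scale scale (\<lambda>x. x)" by unfold_locales auto
  have "op_det scale (\<lambda>x. x) = reldet {0} [] (map (\<lambda>x. x) [])"
    by (rule op_det_eqI[OF id basis_mod_Nil]) auto
  then have "op_det scale (\<lambda>x. x) = 1" using reldet_self[OF basis_mod_Nil[OF subspace_single_0]] by simp
  then have "op_det scale T * op_det scale (inv_into UNIV T) = 1"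
    using op_det_mult[OF T(1,3) I fI] by (simp add: inv)
  then show ?thesis by auto
qed

lemma (in vsp) blockswap_det_0: "blockswap_det m 0 = 1"
proof -
  have "mat m m (\<lambda>(i, j). if i = j then 1 else 0) = (1\<^sub>m m :: 'a mat)" by (rule eq_matI) auto
  then show ?thesis by (simp add: blockswap_det_def)
qed

lemma vs_hom_pres:
  assumes V: "pres s U K V \<pi>" and W: "pres s U' K' W \<pi>'" and K: "K \<subseteq> K'"
    and f: "\<And>x. x \<in> K \<Longrightarrow> f (\<pi> x) = \<pi>' x"
  shows "f \<in> vs_hom V W"
proof -
  interpret V: pres s U K V \<pi> by fact
  interpret W: pres s U' K' W \<pi>' by fact
  have K': "x \<in> K'" if "x \<in> K" for x using K that by blast
  show ?thesis unfolding vs_hom_iff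
    by (auto elim!: V.carrierE simp: f K' V.\<pi>_add V.\<pi>_smult W.\<pi>_add W.\<pi>_smult W.\<pi>_in
        V.subspace_add[OF V.sK] V.subspace_scale[OF V.sK])
qed

lemma vs_hom_coset:
  assumes W: "pres s U UNIV W (vcoset U)" and L: "L \<in> vs_hom V (space_on s UNIV)"
  shows "(\<lambda>x. vcoset U (L x)) \<in> vs_hom V W"
proof -
  interpret W: pres s U UNIV W "vcoset U" by fact
  show ?thesis using L unfolding vs_hom_iff by (simp add: space_on_def W.\<pi>_add W.\<pi>_smult W.\<pi>_in)
qed

lemma vs_hom_subspace:
  assumes "f \<in> vs_hom (space_on s K) W" "K' \<subseteq> K"
  shows "f \<in> vs_hom (space_on s K') W"
  using assms unfolding vs_hom_iff by (simp add: space_on_def subset_iff)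

lemma det_map_cls:
  assumes V: "pres s U K V \<pi>" and W: "pres s' U' K' W \<pi>'" and f: "f \<in> vs_hom V W"
    and b: "vsp.basis_mod s U K bs" and xs: "set xs \<subseteq> K" "length xs = length bs"
    and F: "\<And>x. x \<in> K \<Longrightarrow> f (\<pi> x) = \<pi>' (F x)"
  shows "det_map V W f (c \<odot>\<^bsub>det_line V\<^esub> ext_cls (length bs) V (map \<pi> xs)) =
    c \<odot>\<^bsub>ext_power (length bs) W\<^esub> ext_cls (length bs) W (map \<pi>' (map F xs))"
proof -
  interpret V: pres s U K V \<pi> by fact
  interpret W: pres s' U' K' W \<pi>' by fact
  have "map \<pi> xs \<in> ext_lists (length bs) V" using xs V.\<pi>_in by (auto simp: ext_lists_def)
  moreover have "map f (map \<pi> xs) = map \<pi>' (map F xs)" using xs F by auto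
  ultimately show ?thesis
    unfolding det_map_def det_line_def V.vs_dim_eq[OF b]
    using ext_map_cls[OF f V.mod_closed W.mod_closed, of "map \<pi> xs" "length bs" c] by (simp only:)
qed

lemma coset_map_vcoset:
  assumes "module.subspace s U" "vsp s" "module.subspace s W" "U \<subseteq> W"
  shows "coset_map W (vcoset U x) = vcoset W x"
proof -
  interpret vsp s by fact
  show ?thesis unfolding coset_map_def
    by (rule UN_const_on[OF _ vcoset_nonempty[OF assms(1)]])
       (use assms(4) in \<open>auto simp: vcoset_eq_iff[OF assms(3)] mem_vcoset_iff\<close>)
qed

locale coh =
  fixes X :: "('f::field, 'a::ab_group_add, 'b::ab_group_add) graded_space"
    and d :: "('a, 'b) differential" and dd :: "('a, 'b) dagger" and gs :: "'a list" and hs :: "'b list"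
  assumes cx: "is_complex X d" and dg: "is_complex_pseudo_inverse X d dd"
    and bg: "vsp.basis_mod (scale_plus X) (range (d_minus d)) {x. d_plus d x = 0} gs"
    and bh: "vsp.basis_mod (scale_minus X) (range (d_plus d)) {y. d_minus d y = 0} hs"
begin

abbreviation "sp \<equiv> scale_plus X"
abbreviation "sm \<equiv> scale_minus X"
abbreviation "\<sigma> \<equiv> sigma_plus d dd"
abbreviation "\<sigma>' \<equiv> sigma_minus d dd"

sublocale C: cpx sp sm "d_plus d" "d_minus d" "dag_plus dd" "dag_minus dd"
  using cx dg unfolding is_complex_def is_complex_pseudo_inverse_def is_pseudo_inverse_def
  by (intro cpx.intro) (simp_all add: lin_map_def)

lemma cpx: "cpx sp sm (d_plus d) (d_minus d) (dag_plus dd) (dag_minus dd)"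
  by (rule C.cpx_axioms)

sublocale Cs: cpx sm sp "d_minus d" "d_plus d" "dag_minus dd" "dag_plus dd"
  by (rule C.swap)

lemma sg: "C.sg = \<sigma>" "C.sg' = \<sigma>'" "Cs.sg = \<sigma>'" "Cs.sg' = \<sigma>"
  by (simp_all add: fun_eq_iff sigma_plus_def sigma_minus_def C.sg_def C.sg'_def Cs.sg_def Cs.sg'_def)

lemma lin_\<sigma>: "lin_map sp sm \<sigma>" "lin_map sm sp \<sigma>'"
  using C.lin_sg by (simp_all add: sg)

sublocale S: lin_map sp sm \<sigma> by (rule lin_\<sigma>)
sublocale S': lin_map sm sp \<sigma>' by (rule lin_\<sigma>)

lemma bg': "C.V.basis_mod (range \<sigma>') UNIV gs"
  using C.basis_coker[OF bg] by (simp add: sg)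

lemma bh': "C.W.basis_mod (range \<sigma>) UNIV hs"
  using Cs.basis_coker[OF bh] by (simp add: sg)

lemma ker_\<sigma>: "{x. \<sigma> x = 0} \<subseteq> {x. d_plus d x = 0}" "{y. \<sigma>' y = 0} \<subseteq> {y. d_minus d y = 0}"
proof safe
  fix x assume "\<sigma> x = 0"
  then have "dag_plus dd (d_plus d x + dag_minus dd x) = 0" by (simp add: sigma_plus_def C.dp'.zero)
  then have "dag_plus dd (d_plus d x) = 0" by (simp add: C.expand)
  then show "d_plus d x = 0" using C.pinv(1)[of x] by (simp add: C.dp.zero)
next
  fix y assume "\<sigma>' y = 0"
  then have "dag_minus dd (d_minus d y + dag_plus dd y) = 0" by (simp add: sigma_minus_def C.dm'.zero)
  then have "dag_minus dd (d_minus d y) = 0" by (simp add: C.expand)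
  then show "d_minus d y = 0" using C.pinv(2)[of y] by (simp add: C.dm.zero)
qed

lemma range_\<sigma>: "range (d_minus d) \<subseteq> range \<sigma>'" "range (d_plus d) \<subseteq> range \<sigma>"
proof safe
  fix y
  have "d_minus d y = \<sigma>' (dag_minus dd (d_minus d y))" by (simp add: sigma_minus_def C.expand)
  then show "d_minus d y \<in> range \<sigma>'" by blast
next
  fix x
  have "d_plus d x = \<sigma> (dag_plus dd (d_plus d x))" by (simp add: sigma_plus_def C.expand)
  then show "d_plus d x \<in> range \<sigma>" by blast
qed

text \<open>On cocycles the projection onto the kernel of \<open>\<sigma>\<close> kills exactly the
  range of \<open>d_minus d\<close>, and it fixes that kernel, which consists of cocycles.\<close>

lemma harmonic_basis: "C.V.basis_mod {0} {x. \<sigma> x = 0} (map (\<lambda>x. x - \<sigma>' (\<sigma> x)) gs)"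
proof (rule basis_mod_map[OF _ bg])
  have id: "lin_map sp sp (\<lambda>x. x)" by unfold_locales auto
  show "lin_map sp sp (\<lambda>x. x - \<sigma>' (\<sigma> x))" by (rule lin_map_diff[OF id lin_map_comp[OF lin_\<sigma>]])
  show "module.subspace sp {x. \<sigma> x = 0}" by (rule S.subspace_kernel)
  show "(\<lambda>x. x - \<sigma>' (\<sigma> x)) ` range (d_minus d) \<subseteq> {0}"
    by (auto simp: sigma_plus_def sigma_minus_def C.expand)
  show "x \<in> range (d_minus d)" if "x \<in> {x. d_plus d x = 0}" "x - \<sigma>' (\<sigma> x) \<in> {0}" for x
  proof -
    have "x = d_minus d (dag_minus dd x)"
      using that by (simp add: sigma_plus_def sigma_minus_def C.expand)
    then show ?thesis by blast
  qed
  show "(\<lambda>x. x - \<sigma>' (\<sigma> x)) ` {x. d_plus d x = 0} \<subseteq> {x. \<sigma> x = 0}"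
    using C.sg_pinv(1) by (auto simp: sg S.diff)
  show "\<exists>x\<in>{x. d_plus d x = 0}. y - (x - \<sigma>' (\<sigma> x)) \<in> {0}" if "y \<in> {x. \<sigma> x = 0}" for y
    by (rule bexI[of _ y]) (use that ker_\<sigma> in \<open>auto simp: S'.zero\<close>)
qed (use S.zero in auto)

lemma ker_basis_length: "C.V.basis_mod {0} {x. \<sigma> x = 0} xs \<Longrightarrow> length xs = length gs"
  using C.V.basis_mod_length[OF harmonic_basis] by simp

lemma coker_basis_length: "C.W.basis_mod (range \<sigma>) UNIV ws \<Longrightarrow> length ws = length hs"
  using C.W.basis_mod_length[OF bh'] .

text \<open>A congruence modulo the range of \<open>d_minus d\<close> is one modulo the larger range
  of \<open>\<sigma>'\<close>, with the same coefficients. Determinants on cohomology thus take the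
  form that occurs in \<open>pert_scalar\<close>.\<close>

lemma reldet_gs:
  assumes "set xs \<subseteq> {x. d_plus d x = 0}" "length xs = length gs"
  shows "C.V.reldet (range (d_minus d)) gs xs = C.V.reldet (range \<sigma>') gs xs"
proof (rule C.V.reldet_cong)
  fix i j assume i: "i < length gs" and j: "j < length gs"
  have "xs ! j \<in> {x. d_plus d x = 0}" using assms(1) nth_mem[of j xs] assms(2) j by (simp only: subset_iff)
  then show "C.V.coord (range (d_minus d)) gs (xs ! j) i = C.V.coord (range \<sigma>') gs (xs ! j) i"
    using C.V.coord_diff_in[OF bg] range_\<sigma>(1) by (intro C.V.coord_eqI[OF bg' _ i, symmetric]) blast
qed simp

sublocale Hp: pres sp "range (d_minus d)" "{x. d_plus d x = 0}" "H_plus X d" "vcoset (range (d_minus d))"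
  unfolding H_plus_def by (rule C.V.pres_quotient) (rule C.V.basis_modD[OF bg])+

sublocale Hm: pres sm "range (d_plus d)" "{y. d_minus d y = 0}" "H_minus X d" "vcoset (range (d_plus d))"
  unfolding H_minus_def by (rule C.W.pres_quotient) (rule C.W.basis_modD[OF bh])+

sublocale K: pres sp "{0}" "{x. \<sigma> x = 0}" "ker_space sp \<sigma>" "\<lambda>x. x"
  unfolding ker_space_def by (rule C.V.pres_space[OF S.subspace_kernel])

sublocale K': pres sm "{0}" "{y. \<sigma>' y = 0}" "ker_space sm \<sigma>'" "\<lambda>x. x"
  unfolding ker_space_def by (rule C.W.pres_space[OF S'.subspace_kernel])

sublocale Q: pres sm "range \<sigma>" UNIV "coker_space sm \<sigma>" "vcoset (range \<sigma>)"
  unfolding coker_space_def by (rule C.W.pres_quotient) (use C.W.basis_modD[OF bh'] in auto)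

sublocale Q': pres sp "range \<sigma>'" UNIV "coker_space sp \<sigma>'" "vcoset (range \<sigma>')"
  unfolding coker_space_def by (rule C.V.pres_quotient) (use C.V.basis_modD[OF bg'] in auto)

abbreviation "Lp \<equiv> ext_cls (length gs) (H_plus X d) (map (vcoset (range (d_minus d))) gs)"
abbreviation "Lm \<equiv> ext_cls (length hs) (H_minus X d) (map (vcoset (range (d_plus d))) hs)"

text \<open>Built from the representatives alone, without the pseudo-inverse, so that all choices
  are compared in the same generator.\<close>

definition gen :: "('f, 'a, 'b) det_vector" where
  "gen = pure_tensor (det_line (H_plus X d)) (dual_space (det_line (H_minus X d)))
    Lp (dual_vector (det_line (H_minus X d)) Lm)"

lemma lines: "is_line (det_line (H_plus X d)) Lp" "is_line (det_line (H_minus X d)) Lm"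
  by (rule Hp.det_line_basis(1)[OF bg] Hm.det_line_basis(1)[OF bh])+

lemma line_gen: "is_line (complex_line X d) gen"
  unfolding complex_line_def gen_def by (rule tensor_line(1)[OF lines(1) dual_line(1)[OF lines(2)]])

lemma pure_gen:
  "pure_tensor (det_line (H_plus X d)) (dual_space (det_line (H_minus X d)))
    (a \<odot>\<^bsub>det_line (H_plus X d)\<^esub> Lp)
    (b \<odot>\<^bsub>dual_space (det_line (H_minus X d))\<^esub> dual_vector (det_line (H_minus X d)) Lm) =
    (a * b) \<odot>\<^bsub>complex_line X d\<^esub> gen"
  unfolding complex_line_def gen_def by (rule tensor_line(2)[OF lines(1) dual_line(1)[OF lines(2)]])

lemma coset_maps: "coset_map (range \<sigma>) (vcoset (range (d_plus d)) y) = vcoset (range \<sigma>) y"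
  "coset_map (range \<sigma>') (vcoset (range (d_minus d)) x) = vcoset (range \<sigma>') x"
  by (rule coset_map_vcoset[OF Hm.sU C.W.vsp_axioms Q.sU range_\<sigma>(2)]
      coset_map_vcoset[OF Hp.sU C.V.vsp_axioms Q'.sU range_\<sigma>(1)])+

lemma det_map_coset:
  "det_map (H_minus X d) (coker_space sm \<sigma>) (coset_map (range \<sigma>)) (c \<odot>\<^bsub>det_line (H_minus X d)\<^esub> Lm) =
    c \<odot>\<^bsub>det_line (coker_space sm \<sigma>)\<^esub> ext_cls (length hs) (coker_space sm \<sigma>) (map (vcoset (range \<sigma>)) hs)"
  "det_map (H_plus X d) (coker_space sp \<sigma>') (coset_map (range \<sigma>')) (c \<odot>\<^bsub>det_line (H_plus X d)\<^esub> Lp) =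
    c \<odot>\<^bsub>det_line (coker_space sp \<sigma>')\<^esub> ext_cls (length gs) (coker_space sp \<sigma>') (map (vcoset (range \<sigma>')) gs)"
proof -
  have f: "coset_map (range \<sigma>) \<in> vs_hom (H_minus X d) (coker_space sm \<sigma>)"
    by (rule vs_hom_pres[OF Hm.pres_axioms Q.pres_axioms]) (auto simp: coset_maps)
  have f': "coset_map (range \<sigma>') \<in> vs_hom (H_plus X d) (coker_space sp \<sigma>')"
    by (rule vs_hom_pres[OF Hp.pres_axioms Q'.pres_axioms]) (auto simp: coset_maps)
  show "det_map (H_minus X d) (coker_space sm \<sigma>) (coset_map (range \<sigma>)) (c \<odot>\<^bsub>det_line (H_minus X d)\<^esub> Lm) =
    c \<odot>\<^bsub>det_line (coker_space sm \<sigma>)\<^esub> ext_cls (length hs) (coker_space sm \<sigma>) (map (vcoset (range \<sigma>)) hs)"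
    using det_map_cls[OF Hm.pres_axioms Q.pres_axioms f bh C.W.basis_modD(4)[OF bh] refl, of "\<lambda>x. x"]
    by (simp add: coset_maps det_line_def Q.vs_dim_eq[OF bh'])
  show "det_map (H_plus X d) (coker_space sp \<sigma>') (coset_map (range \<sigma>')) (c \<odot>\<^bsub>det_line (H_plus X d)\<^esub> Lp) =
    c \<odot>\<^bsub>det_line (coker_space sp \<sigma>')\<^esub> ext_cls (length gs) (coker_space sp \<sigma>') (map (vcoset (range \<sigma>')) gs)"
    using det_map_cls[OF Hp.pres_axioms Q'.pres_axioms f' bg C.V.basis_modD(4)[OF bg] refl, of "\<lambda>x. x"]
    by (simp add: coset_maps det_line_def Q'.vs_dim_eq[OF bg'])
qed

lemma det_map_ker:
  assumes bx: "C.V.basis_mod {0} {x. \<sigma> x = 0} xs"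
  shows "det_map (ker_space sp \<sigma>) (H_plus X d) (vcoset (range (d_minus d)))
      (c \<odot>\<^bsub>det_line (ker_space sp \<sigma>)\<^esub> ext_cls (length gs) (ker_space sp \<sigma>) xs) =
    (c * C.V.reldet (range \<sigma>') gs xs) \<odot>\<^bsub>det_line (H_plus X d)\<^esub> Lp"
proof -
  have l: "length xs = length gs" by (rule ker_basis_length[OF bx])
  have xs: "set xs \<subseteq> {x. d_plus d x = 0}" using C.V.basis_modD(4)[OF bx] ker_\<sigma>(1) by blast
  have f: "vcoset (range (d_minus d)) \<in> vs_hom (ker_space sp \<sigma>) (H_plus X d)"
    by (rule vs_hom_pres[OF K.pres_axioms Hp.pres_axioms ker_\<sigma>(1)]) simp
  have "det_map (ker_space sp \<sigma>) (H_plus X d) (vcoset (range (d_minus d)))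
      (c \<odot>\<^bsub>det_line (ker_space sp \<sigma>)\<^esub> ext_cls (length gs) (ker_space sp \<sigma>) xs) =
    c \<odot>\<^bsub>det_line (H_plus X d)\<^esub> ext_cls (length gs) (H_plus X d) (map (vcoset (range (d_minus d))) xs)"
    using det_map_cls[OF K.pres_axioms Hp.pres_axioms f bx C.V.basis_modD(4)[OF bx] refl, of "\<lambda>x. x"]
    by (simp add: l det_line_def Hp.vs_dim_eq[OF bg])
  also have "\<dots> = (c * C.V.reldet (range \<sigma>') gs xs) \<odot>\<^bsub>det_line (H_plus X d)\<^esub> Lp"
    unfolding Hp.det_line_basis(2)[OF bg xs l] reldet_gs[OF xs l] by (rule is_lineD(5)[OF lines(1)])
  finally show ?thesis .
qed

text \<open>The kernel basis contributes its base change directly, the cokernel basis through the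
  dual vector and hence inverted.\<close>

lemma source_vector_eq:
  assumes bx: "C.V.basis_mod {0} {x. \<sigma> x = 0} xs" and bw: "C.W.basis_mod (range \<sigma>) UNIV ws"
    and b: "b \<noteq> 0"
  shows "source_vector X d dd
      (c \<odot>\<^bsub>det_line (ker_space sp \<sigma>)\<^esub> ext_cls (length gs) (ker_space sp \<sigma>) xs)
      (b \<odot>\<^bsub>det_line (coker_space sm \<sigma>)\<^esub> ext_cls (length hs) (coker_space sm \<sigma>) (map (vcoset (range \<sigma>)) ws)) =
    (c * C.V.reldet (range \<sigma>') gs xs * inverse (b * C.W.reldet (range \<sigma>) hs ws)) \<odot>\<^bsub>complex_line X d\<^esub> gen"
proof -
  let ?C = "coker_space sm \<sigma>" and ?\<beta> = "b * C.W.reldet (range \<sigma>) hs ws"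
  let ?g = "ext_cls (length hs) ?C (map (vcoset (range \<sigma>)) hs)"
  have l: "is_line (det_line ?C) ?g" by (rule Q.det_line_basis(1)[OF bh'])
  have v: "b \<odot>\<^bsub>det_line ?C\<^esub> ext_cls (length hs) ?C (map (vcoset (range \<sigma>)) ws) = ?\<beta> \<odot>\<^bsub>det_line ?C\<^esub> ?g"
    unfolding Q.det_line_basis(2)[OF bh' subset_UNIV coker_basis_length[OF bw]] by (rule is_lineD(5)[OF l])
  have \<beta>: "?\<beta> \<noteq> 0" using b C.W.reldet_nonzero[OF bh' bw] by simp
  have "(\<lambda>y\<in>carrier (det_line (H_minus X d)). dual_vector (det_line ?C) (?\<beta> \<odot>\<^bsub>det_line ?C\<^esub> ?g)
      (det_map (H_minus X d) ?C (coset_map (range \<sigma>)) y)) =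
    inverse ?\<beta> \<odot>\<^bsub>dual_space (det_line (H_minus X d))\<^esub> dual_vector (det_line (H_minus X d)) Lm"
    by (rule dual_line(4)[OF lines(2)])
       (simp_all add: is_lineD(2)[OF lines(2)] det_map_coset dual_line(2)[OF l \<beta>] dual_line(3)[OF l])
  then show ?thesis unfolding source_vector_def Let_def v det_map_ker[OF bx] by (simp only: pure_gen)
qed

end

text \<open>Exchanging the parities gives a complex in which \<open>\<sigma>\<close> and
  \<open>\<sigma>'\<close> are interchanged, so facts about the kernel of \<open>\<sigma>\<close>
  become facts about that of \<open>\<sigma>'\<close>.\<close>

lemma coh_swap_reldet:
  assumes c: "coh X d dd gs hs"
  shows "vsp.basis_mod (scale_minus X) {0} {y. sigma_minus d dd y = 0} ys \<Longrightarrow> length ys = length hs"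
    and "vsp.basis_mod (scale_minus X) {0} {y. sigma_minus d dd y = 0} ys \<Longrightarrow>
      vsp.reldet (scale_minus X) (range (d_plus d)) hs ys =
      vsp.reldet (scale_minus X) (range (sigma_plus d dd)) hs ys"
    and "vsp.basis_mod (scale_minus X) {0} {y. sigma_minus d dd y = 0} ys \<Longrightarrow> set ys \<subseteq> {y. d_minus d y = 0}"
    and "vsp.basis_mod (scale_minus X) {0} {y. sigma_minus d dd y = 0}
      (map (\<lambda>y. y - sigma_plus d dd (sigma_minus d dd y)) hs)"
proof -
  interpret coh X d dd gs hs by fact
  let ?X = "\<lparr>scale_plus = sm, scale_minus = sp\<rparr>" and ?d = "\<lparr>d_plus = d_minus d, d_minus = d_plus d\<rparr>"
  let ?dd = "\<lparr>dag_plus = dag_minus dd, dag_minus = dag_plus dd\<rparr>"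
  interpret s: coh ?X ?d ?dd hs gs
    by unfold_locales (use cx dg bg bh in \<open>simp_all add: is_complex_def is_graded_space_def
        is_complex_pseudo_inverse_def is_pseudo_inverse_def\<close>)
  have eq: "s.\<sigma> = \<sigma>'" "s.\<sigma>' = \<sigma>" by (simp_all add: sigma_plus_def sigma_minus_def)
  show l: "C.W.basis_mod {0} {y. \<sigma>' y = 0} ys \<Longrightarrow> length ys = length hs"
    using s.ker_basis_length[of ys] eq by simp
  show sub: "C.W.basis_mod {0} {y. \<sigma>' y = 0} ys \<Longrightarrow> set ys \<subseteq> {y. d_minus d y = 0}"
    using C.W.basis_modD(4) ker_\<sigma>(2) by blast
  show "C.W.basis_mod {0} {y. \<sigma>' y = 0} ys \<Longrightarrow> C.W.reldet (range (d_plus d)) hs ys = C.W.reldet (range \<sigma>) hs ys"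
    using s.reldet_gs[of ys] sub l eq by simp
  show "C.W.basis_mod {0} {y. \<sigma>' y = 0} (map (\<lambda>y. y - \<sigma> (\<sigma>' y)) hs)"
    using s.harmonic_basis eq by simp
qed

context coh
begin

lemma target_vector_eq:
  assumes bys: "C.W.basis_mod {0} {y. \<sigma>' y = 0} ys" and bw: "C.V.basis_mod (range \<sigma>') UNIV ws"
    and c: "c \<noteq> 0"
  shows "target_vector X d dd
      (b \<odot>\<^bsub>det_line (coker_space sp \<sigma>')\<^esub> ext_cls (length gs) (coker_space sp \<sigma>') (map (vcoset (range \<sigma>')) ws))
      (c \<odot>\<^bsub>det_line (ker_space sm \<sigma>')\<^esub> ext_cls (length hs) (ker_space sm \<sigma>') ys) =
    (b * C.V.reldet (range \<sigma>') gs ws * inverse (c * C.W.reldet (range \<sigma>) hs ys)) \<odot>\<^bsub>complex_line X d\<^esub> gen"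
proof -
  let ?C = "coker_space sp \<sigma>'" and ?\<beta> = "b * C.V.reldet (range \<sigma>') gs ws"
  let ?g = "ext_cls (length gs) ?C (map (vcoset (range \<sigma>')) gs)"
  note sw = coh_swap_reldet(1-3)[OF coh_axioms bys]
  have l: "is_line (det_line ?C) ?g" by (rule Q'.det_line_basis(1)[OF bg'])
  have lw: "length ws = length gs" by (rule C.V.basis_mod_length[OF bg' bw])
  have v: "b \<odot>\<^bsub>det_line ?C\<^esub> ext_cls (length gs) ?C (map (vcoset (range \<sigma>')) ws) = ?\<beta> \<odot>\<^bsub>det_line ?C\<^esub> ?g"
    unfolding Q'.det_line_basis(2)[OF bg' subset_UNIV lw] by (rule is_lineD(5)[OF l])
  \<comment> \<open>In terms of generators the map of lines keeps the coefficient; this makes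
    \<open>inv_into\<close> in the target vector a true inverse.\<close>
  have "inj_on (det_map (H_plus X d) ?C (coset_map (range \<sigma>'))) (carrier (det_line (H_plus X d)))"
    by (rule inj_onI) (auto elim!: is_line_carrierE[OF lines(1)] simp: det_map_coset is_lineD(3)[OF l])
  then have inv: "inv_into (carrier (det_line (H_plus X d))) (det_map (H_plus X d) ?C (coset_map (range \<sigma>')))
      (?\<beta> \<odot>\<^bsub>det_line ?C\<^esub> ?g) = ?\<beta> \<odot>\<^bsub>det_line (H_plus X d)\<^esub> Lp"
    unfolding det_map_coset(2)[symmetric] by (rule inv_into_f_f[OF _ is_lineD(2)[OF lines(1)]])
  have f: "vcoset (range (d_plus d)) \<in> vs_hom (ker_space sm \<sigma>') (H_minus X d)"
    by (rule vs_hom_pres[OF K'.pres_axioms Hm.pres_axioms ker_\<sigma>(2)]) simp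
  have "det_map (ker_space sm \<sigma>') (H_minus X d) (vcoset (range (d_plus d)))
      (c \<odot>\<^bsub>det_line (ker_space sm \<sigma>')\<^esub> ext_cls (length hs) (ker_space sm \<sigma>') ys) =
    c \<odot>\<^bsub>det_line (H_minus X d)\<^esub> ext_cls (length hs) (H_minus X d) (map (vcoset (range (d_plus d))) ys)"
    using det_map_cls[OF K'.pres_axioms Hm.pres_axioms f bys C.W.basis_modD(4)[OF bys] refl, of "\<lambda>x. x"]
    by (simp add: sw(1) det_line_def Hm.vs_dim_eq[OF bh])
  also have "\<dots> = (c * C.W.reldet (range \<sigma>) hs ys) \<odot>\<^bsub>det_line (H_minus X d)\<^esub> Lm"
    unfolding Hm.det_line_basis(2)[OF bh sw(3,1)] sw(2) by (rule is_lineD(5)[OF lines(2)])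
  finally have t: "det_map (ker_space sm \<sigma>') (H_minus X d) (vcoset (range (d_plus d)))
      (c \<odot>\<^bsub>det_line (ker_space sm \<sigma>')\<^esub> ext_cls (length hs) (ker_space sm \<sigma>') ys) =
    (c * C.W.reldet (range \<sigma>) hs ys) \<odot>\<^bsub>det_line (H_minus X d)\<^esub> Lm" .
  have id: "lin_map sm sm (\<lambda>x. x)" by unfold_locales auto
  \<comment> \<open>For the dual vector the scalar has to be nonzero, that is, \<open>ys\<close> has
    to represent a basis of the cohomology.\<close>
  have "C.W.reldet (range (d_plus d)) hs ys \<noteq> 0"
  proof (rule C.W.reldet_nonzero[OF bh])
    have "C.W.basis_mod (range (d_plus d)) {y. d_minus d y = 0} (map (\<lambda>x. x) ys)"
    proof (rule basis_mod_map[OF id bys])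
      show "x \<in> {0}" if x: "x \<in> {y. \<sigma>' y = 0}" "x \<in> range (d_plus d)" for x
      proof -
        obtain z where "x = d_plus d z" using x(2) by blast
        \<comment> \<open>An exact vector is recovered from its image under the pseudo-inverse, and
          this image is zero on the kernel of \<open>\<sigma>'\<close>.\<close>
        then have "x = d_plus d (dag_plus dd x)" using C.pinv(1) by simp
        moreover have "dag_plus dd x = 0"
          using x(1) ker_\<sigma>(2) by (auto simp: sigma_minus_def)
        ultimately show ?thesis by (simp add: C.dp.zero)
      qed
      show "\<exists>x\<in>{y. \<sigma>' y = 0}. y - x \<in> range (d_plus d)" if "y \<in> {y. d_minus d y = 0}" for y
      proof (rule bexI)
        show "y - (y - \<sigma> (\<sigma>' y)) \<in> range (d_plus d)"
          using that by (simp add: sigma_plus_def sigma_minus_def C.expand)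
        show "y - \<sigma> (\<sigma>' y) \<in> {y. \<sigma>' y = 0}" using C.sg_pinv(2) by (simp add: sg S'.diff)
      qed
    qed (use Hm.sU Hm.sK Hm.UK ker_\<sigma>(2) C.W.subspace_0[OF Hm.sU] in auto)
    then show "C.W.basis_mod (range (d_plus d)) {y. d_minus d y = 0} ys" by simp
  qed
  then have nz: "c * C.W.reldet (range \<sigma>) hs ys \<noteq> 0" using c sw(2) by simp
  show ?thesis
    unfolding target_vector_def Let_def v inv t by (simp only: dual_line(2)[OF lines(2) nz] pure_gen)
qed

end

section \<open>Perturbation triples as perturbation data\<close>

text \<open>Of the complexes only \<open>\<sigma>\<close> and \<open>\<tau>\<close> enter, so both
  kinds of triples are instances of this one notion.\<close>

definition trip where
  "trip s1 s2 \<sigma> \<tau> L M N \<longleftrightarrow>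
    (let kers = {x. \<sigma> x = 0}; kert = {y. \<tau> y = 0}; kerM = {t \<in> kert. M t = 0};
         W = set_sum (range \<sigma>) (L ` kers)
     in L \<in> vs_hom (ker_space s1 \<sigma>) (space_on s2 UNIV) \<and>
        inj_on (\<lambda>x. vcoset (range \<sigma>) (L x)) kers \<and>
        M \<in> vs_hom (ker_space s2 \<tau>) (space_on s1 UNIV) \<and>
        (\<lambda>t. vcoset (range \<tau>) (M t)) ` kert = carrier (coker_space s1 \<tau>) \<and>
        M ` kert \<inter> range \<tau> = {0} \<and>
        N \<in> vs_hom (ker_space s2 \<tau>) (space_on s2 UNIV) \<and>
        bij_betw (\<lambda>t. vcoset W (N t)) kerM (carrier (quotient_space s2 UNIV W)) \<and>
        vanishes_on_complement s2 kert kerM N)"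

lemma triple_nonpos_trip:
  "is_triple_nonpos X d dd e ee L M N \<longleftrightarrow>
    trip (scale_plus X) (scale_minus X) (sigma_plus d dd) (sigma_minus e ee) L M N"
  unfolding is_triple_nonpos_def trip_def Let_def ..

lemma set_sum_commute: "set_sum A B = set_sum B A"
  unfolding set_sum_def by (rule Collect_cong) (metis add.commute)

text \<open>A triple for index \<open>\<ge> 0\<close> is one for index \<open>\<le> 0\<close> with the parities and the two complexes
  exchanged.\<close>

lemma triple_nonneg_trip:
  "is_triple_nonneg X d dd e ee L M N \<longleftrightarrow>
    trip (scale_minus X) (scale_plus X) (sigma_minus e ee) (sigma_plus d dd) M L N"
  unfolding is_triple_nonneg_def trip_def Let_def set_sum_commute[of "range (sigma_minus e ee)"]
  by (rule iffI; elim conjE; intro conjI; assumption)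

lemma vs_hom_space_iff:
  "f \<in> vs_hom (space_on s K) (space_on s' UNIV) \<longleftrightarrow>
    (\<forall>x\<in>K. \<forall>y\<in>K. f (x + y) = f x + f y) \<and> (\<forall>c. \<forall>x\<in>K. f (s c x) = s' c (f x))"
  unfolding vs_hom_iff by (simp add: space_on_def)

lemma hom_proj_linear:
  assumes "lin_map s s (\<lambda>x. p x)" "\<And>x. p x \<in> K" "f \<in> vs_hom (space_on s K) (space_on s' UNIV)" "vsp s'"
  shows "lin_map s s' (\<lambda>x. f (p x))"
proof -
  interpret p: lin_map s s p using assms(1) by simp
  interpret t: vsp s' by fact
  show ?thesis
    by unfold_locales (use assms(2,3) in \<open>simp_all add: vs_hom_space_iff p.add p.scale
      t.scale_right_distrib t.scale_left_distrib\<close>)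
qed

context fred_pair
begin

lemma ker_proj_fix: "\<sigma> x = 0 \<Longrightarrow> x - \<sigma>' (\<sigma> x) = x" "\<tau> y = 0 \<Longrightarrow> y - \<tau>' (\<tau> y) = y"
  by (simp_all add: \<sigma>'.zero \<tau>'.zero)

lemma proj_linear: "lin_map s1 s1 (\<lambda>x. x - \<sigma>' (\<sigma> x))" "lin_map s2 s2 (\<lambda>y. y - \<tau>' (\<tau> y))"
proof -
  have id: "lin_map s1 s1 (\<lambda>x. x)" "lin_map s2 s2 (\<lambda>x. x)" by unfold_locales auto
  show "lin_map s1 s1 (\<lambda>x. x - \<sigma>' (\<sigma> x))" by (rule lin_map_diff[OF id(1) lin_map_comp[OF lin(1,2)]])
  show "lin_map s2 s2 (\<lambda>y. y - \<tau>' (\<tau> y))" by (rule lin_map_diff[OF id(2) lin_map_comp[OF lin(3,4)]])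
qed

text \<open>The kernel of \<open>\<tau>\<close> is the direct sum of the kernels of \<open>N\<close>
  and \<open>M\<close> in it: \<open>N\<close> is injective on the kernel of \<open>M\<close> and
  vanishes on a complement. Bases \<open>us\<close> and \<open>ts\<close> of the summands give the
  data, with the maps extended by zero along the projections.\<close>

lemma trip_pert:
  assumes bx: "V.basis_mod {0} {x. \<sigma> x = 0} xs"
    and bys: "W.basis_mod {0} {y. \<tau> y = 0} ys"
    and t: "trip s1 s2 \<sigma> \<tau> L M N"
  obtains us ts where
    "pert s1 s2 \<sigma> \<sigma>' \<tau> \<tau>' (\<lambda>x. L (x - \<sigma>' (\<sigma> x))) (\<lambda>y. M (y - \<tau>' (\<tau> y))) (\<lambda>y. N (y - \<tau>' (\<tau> y))) xs us ts"
    "W.basis_mod {0} {t. \<tau> t = 0 \<and> N t = 0} us" "W.basis_mod {0} {t. \<tau> t = 0 \<and> M t = 0} ts"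
proof -
  define KS where "KS = {x. \<sigma> x = 0}"
  define KT where "KT = {y. \<tau> y = 0}"
  define KM where "KM = {t. \<tau> t = 0 \<and> M t = 0}"
  define KN where "KN = {t. \<tau> t = 0 \<and> N t = 0}"
  define W1 where "W1 = set_sum (range \<sigma>) (L ` KS)"
  have KM: "{t \<in> KT. M t = 0} = KM" by (auto simp: KM_def KT_def)
  have hL: "L \<in> vs_hom (space_on s1 KS) (space_on s2 UNIV)"
    and iL: "inj_on (\<lambda>x. vcoset (range \<sigma>) (L x)) KS"
    and hM: "M \<in> vs_hom (space_on s2 KT) (space_on s1 UNIV)"
    and sM: "(\<lambda>t. vcoset (range \<tau>) (M t)) ` KT = vcoset (range \<tau>) ` UNIV"
    and M0: "M ` KT \<inter> range \<tau> = {0}"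
    and hN: "N \<in> vs_hom (space_on s2 KT) (space_on s2 UNIV)"
    and bN: "bij_betw (\<lambda>t. vcoset W1 (N t)) KM (vcoset W1 ` UNIV)"
    and van: "vanishes_on_complement s2 KT KM N"
    using t unfolding trip_def Let_def KS_def[symmetric] KT_def[symmetric] KM W1_def[symmetric]
      ker_space_def coker_space_def quotient_space_def by simp_all
  have sKS: "V.subspace KS" and sKT: "W.subspace KT"
    unfolding KS_def KT_def by (rule \<sigma>.subspace_kernel \<tau>.subspace_kernel)+
  define P where "P = (\<lambda>x. x - \<sigma>' (\<sigma> x))"
  define Q where "Q = (\<lambda>y. y - \<tau>' (\<tau> y))"
  have PK: "P x \<in> KS" and QK: "Q y \<in> KT" for x y unfolding P_def Q_def KS_def KT_def using ker_proj by auto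
  have Pfix: "P x = x" if "x \<in> KS" for x using that ker_proj_fix unfolding P_def KS_def by simp
  have Qfix: "Q x = x" if "x \<in> KT" for x using that ker_proj_fix unfolding Q_def KT_def by simp
  have linP: "lin_map s1 s1 P" and linQ: "lin_map s2 s2 Q" unfolding P_def Q_def by (rule proj_linear)+
  define L' where "L' = (\<lambda>x. L (P x))"
  define M' where "M' = (\<lambda>y. M (Q y))"
  define N' where "N' = (\<lambda>y. N (Q y))"
  have linL: "lin_map s1 s2 L'" and linM: "lin_map s2 s1 M'" and linN: "lin_map s2 s2 N'"
    unfolding L'_def M'_def N'_def
    by (rule hom_proj_linear[OF linP PK hL W.vsp_axioms] hom_proj_linear[OF linQ QK hM V.vsp_axioms]
        hom_proj_linear[OF linQ QK hN W.vsp_axioms])+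
  interpret L: lin_map s1 s2 L' by (rule linL)
  interpret M: lin_map s2 s1 M' by (rule linM)
  interpret N: lin_map s2 s2 N' by (rule linN)
  have L': "L' x = L x" if "x \<in> KS" for x using Pfix[OF that] by (simp add: L'_def)
  have M': "M' x = M x" and N': "N' x = N x" if "x \<in> KT" for x using Qfix[OF that] by (simp_all add: M'_def N'_def)
  have KM': "KM = KT \<inter> {t. M' t = 0}" and KN': "KN = KT \<inter> {t. N' t = 0}"
    using M' N' by (auto simp: KM_def KN_def KT_def)
  have sKM: "W.subspace KM" and sKN: "W.subspace KN"
    unfolding KM' KN' by (intro W.subspace_inter sKT M.subspace_kernel N.subspace_kernel)+
  have sW1: "W.subspace W1"
  proof -
    have "W1 = {x + y |x y. x \<in> range \<sigma> \<and> y \<in> L' ` KS}"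
      unfolding W1_def set_sum_def using L' by (auto simp: image_iff)
    then show ?thesis
      using W.subspace_sums[OF \<sigma>.subspace_image[OF V.subspace_UNIV] L.subspace_image[OF sKS]] by simp
  qed
  have \<sigma>W1: "range \<sigma> \<subseteq> W1" and LW1: "L x \<in> W1" if "x \<in> KS" for x
  proof -
    show "L x \<in> W1"
    proof -
      have "L x = \<sigma> 0 + L x" by (simp add: \<sigma>.zero)
      then show ?thesis unfolding W1_def set_sum_def using that by blast
    qed
    show "range \<sigma> \<subseteq> W1"
    proof safe
      fix v
      have "L 0 = 0" using L'[of 0] V.subspace_0[OF sKS] L.zero by simp
      then show "\<sigma> v \<in> W1" unfolding W1_def set_sum_def using V.subspace_0[OF sKS] by force
    qed
  qed
  have \<sigma>W1: "range \<sigma> \<subseteq> W1" using \<sigma>W1[OF V.subspace_0[OF sKS]] .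
  have cos\<sigma>: "vcoset (range \<sigma>) x = vcoset (range \<sigma>) y \<longleftrightarrow> x - y \<in> range \<sigma>" for x y
    by (rule W.vcoset_eq_iff[OF \<sigma>.subspace_image[OF V.subspace_UNIV]])
  have cos\<tau>: "vcoset (range \<tau>) x = vcoset (range \<tau>) y \<longleftrightarrow> x - y \<in> range \<tau>" for x y
    by (rule V.vcoset_eq_iff[OF \<tau>.subspace_image[OF W.subspace_UNIV]])
  have cosW: "vcoset W1 x = vcoset W1 y \<longleftrightarrow> x - y \<in> W1" for x y by (rule W.vcoset_eq_iff[OF sW1])
  have zKM: "0 \<in> KM" "0 \<in> KT" "0 \<in> KS" "0 \<in> KN"
    using W.subspace_0 V.subspace_0 sKM sKT sKS sKN by blast+
  have KMT: "KM \<subseteq> KT" "KN \<subseteq> KT" by (auto simp: KM_def KN_def KT_def)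
  have KMN: "x = 0" if "x \<in> KM" "N' x \<in> W1" for x
  proof -
    have "N x - N 0 \<in> W1" using that N' KMT zKM N.zero by (metis diff_zero subsetD)
    then show ?thesis using bij_betw_imp_inj_on[OF bN] that zKM unfolding cosW[symmetric] by (auto dest: inj_onD)
  qed
  \<comment> \<open>The complement provided by the triple lies in the kernel of
    \<open>N\<close>.\<close>
  have split: "\<exists>u\<in>KN. \<exists>m\<in>KM. t = u + m" if t: "t \<in> KT" for t
  proof -
    obtain C where C: "set_sum C KM = KT" "\<forall>x\<in>C. N x = 0" "W.subspace C"
      using van unfolding vanishes_on_complement_def by blast
    then obtain u m where um: "u \<in> C" "m \<in> KM" "t = u + m" using t by (auto simp: set_sum_def)
    have "u + 0 \<in> KT" using um zKM C(1) unfolding set_sum_def by blast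
    then have "u \<in> KN" using um C by (simp add: KN_def KT_def)
    then show ?thesis using um by blast
  qed
  have ysp: "K \<subseteq> W.span ({0} \<union> set ys)" if "K \<subseteq> KT" for K
    using that W.basis_mod_zero_subset[OF bys] W.span_mono[of "set ys" "{0} \<union> set ys"] unfolding KT_def by blast
  obtain us where us: "W.basis_mod {0} KN us"
    using W.basis_mod_exists[OF _ W.subspace_single_0 sKN _ ysp[OF KMT(2)]] zKM by auto
  obtain ts where ts: "W.basis_mod {0} KM ts"
    using W.basis_mod_exists[OF _ W.subspace_single_0 sKM _ ysp[OF KMT(1)]] zKM by auto
  have "lin_map s2 s2 (\<lambda>x. x)" by unfold_locales auto
  then have "W.basis_mod KN KT (map (\<lambda>x. x) ts)"
  proof (rule basis_mod_map[OF _ ts sKN _ _ sKT])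
    show "x \<in> {0}" if "x \<in> KM" "x \<in> KN" for x
      using that KMN[of x] W.subspace_0[OF sW1] by (simp add: KN')
    show "\<exists>x\<in>KM. y - x \<in> KN" if "y \<in> KT" for y
      using split[OF that] by force
  qed (use zKM KMT in auto)
  then have bt: "W.basis_mod {0} KT (us @ ts)" using W.basis_mod_append[OF us] by simp
  have bL: "W.basis_mod (range \<sigma>) W1 (map L' xs)"
  proof (rule basis_mod_map[OF linL bx[folded KS_def] _ _ _ sW1 \<sigma>W1])
    show "W.subspace (range \<sigma>)" by (rule \<sigma>.subspace_image[OF V.subspace_UNIV])
    show "L' ` {0} \<subseteq> range \<sigma>" using L.zero \<sigma>.zero by (auto intro!: range_eqI[of _ _ 0])
    show "x \<in> {0}" if "x \<in> KS" "L' x \<in> range \<sigma>" for x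
    proof -
      have "L x - L 0 \<in> range \<sigma>" using that L'[of 0] L'[of x] zKM L.zero by simp
      then show ?thesis using iL that zKM unfolding cos\<sigma>[symmetric] by (auto dest: inj_onD)
    qed
    show "L' ` KS \<subseteq> W1" using LW1 L' by auto
    show "\<exists>x\<in>KS. y - L' x \<in> range \<sigma>" if "y \<in> W1" for y
    proof -
      obtain v x where "y = \<sigma> v + L x" "x \<in> KS" using \<open>y \<in> W1\<close> by (auto simp: W1_def set_sum_def)
      then show ?thesis using L' by (intro bexI[of _ x]) simp_all
    qed
  qed
  have bN': "W.basis_mod W1 UNIV (map N' ts)"
  proof (rule basis_mod_map[OF linN ts sW1 _ _ W.subspace_UNIV])
    show "N' ` {0} \<subseteq> W1" using N.zero W.subspace_0[OF sW1] by simp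
    show "\<exists>x\<in>KM. y - N' x \<in> W1" for y
    proof -
      obtain x where "x \<in> KM" "vcoset W1 (N x) = vcoset W1 y"
        using bij_betw_imp_surj_on[OF bN] by (metis (no_types, lifting) UNIV_I image_iff)
      then have "x \<in> KM" "y - N' x \<in> W1" using cosW[of y "N x"] N' KMT by (auto simp: subset_iff)
      then show ?thesis by blast
    qed
  qed (use KMN in auto)
  \<comment> \<open>On the kernel of \<open>N\<close> the map \<open>M\<close> is injective modulo
    the range of \<open>\<tau>\<close>: a value in that range is zero, which puts the vector into
    both kernels.\<close>
  have bM: "V.basis_mod (range \<tau>) UNIV (map M' us)"
  proof (rule basis_mod_map[OF linM us _ _ _ V.subspace_UNIV])
    show "V.subspace (range \<tau>)" by (rule \<tau>.subspace_image[OF W.subspace_UNIV])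
    show "M' ` {0} \<subseteq> range \<tau>" using M.zero \<tau>.zero by (auto intro!: range_eqI[of _ _ 0])
    show "x \<in> {0}" if "x \<in> KN" "M' x \<in> range \<tau>" for x
    proof -
      have xT: "x \<in> KT" using that KMT by blast
      then have "M x = 0" using that M0 M' by auto
      then have "x \<in> KM" using xT by (simp add: KM_def KT_def)
      then show ?thesis using KMN that W.subspace_0[OF sW1] by (simp add: KN')
    qed
    show "\<exists>x\<in>KN. y - M' x \<in> range \<tau>" for y
    proof -
      obtain t where t: "t \<in> KT" "vcoset (range \<tau>) (M t) = vcoset (range \<tau>) y"
        using sM by (metis (no_types, lifting) UNIV_I image_iff)
      obtain u m where um: "u \<in> KN" "m \<in> KM" "t = u + m" using split[OF t(1)] by blast
      have "M' t = M' u" using um by (simp add: M.add KM')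
      then have "y - M' u \<in> range \<tau>" using t M'[OF t(1)] cos\<tau>[of y "M t"] by simp
      then show ?thesis using um by blast
    qed
  qed auto
  have z: "P (\<sigma>' y) = 0" "Q (\<tau>' x) = 0" for x y by (simp_all add: P_def Q_def pinv)
  have P0: "P 0 = 0" and Q0: "Q 0 = 0" using Pfix Qfix zKM by blast+
  have "pert s1 s2 \<sigma> \<sigma>' \<tau> \<tau>' L' M' N' xs us ts"
  proof (intro pert.intro fred_pair_axioms pert_axioms.intro linL linM linN bx bM)
    show "L' (\<sigma>' y) = 0" for y using L.zero by (simp add: L'_def z P0)
    show "M' (\<tau>' x) = 0" "N' (\<tau>' x) = 0" for x using M.zero N.zero by (simp_all add: M'_def N'_def z Q0)
    show "M' t = 0" if "t \<in> set ts" for t using W.basis_modD(4)[OF ts] that by (auto simp: KM')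
    show "N' t = 0" if "t \<in> set us" for t using W.basis_modD(4)[OF us] that by (auto simp: KN')
    show "W.basis_mod {0} {y. \<tau> y = 0} (us @ ts)" using bt by (simp only: KT_def)
    show "W.basis_mod (range \<sigma>) UNIV (map L' xs @ map N' ts)" by (rule W.basis_mod_append[OF bL bN'])
  qed
  from that[OF this[unfolded L'_def M'_def N'_def P_def Q_def] us[unfolded KN_def] ts[unfolded KM_def]]
  show ?thesis .
qed

end

section \<open>The scalar of the perturbation isomorphism\<close>

definition line_iso where
  "line_iso A g B h \<kappa> P \<longleftrightarrow> P \<in> vs_hom A B \<and> P \<in> extensional (carrier A) \<and>
    bij_betw P (carrier A) (carrier B) \<and> P g = \<kappa> \<odot>\<^bsub>B\<^esub> h"

lemma line_iso_ex1:
  assumes A: "is_line A g" and B: "is_line B h" and \<kappa>: "\<kappa> \<noteq> 0"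
  shows "\<exists>!P. line_iso A g B h \<kappa> P"
proof
  define P where "P = (\<lambda>v\<in>carrier A. (\<kappa> * lcoef A g v) \<odot>\<^bsub>B\<^esub> h)"
  have P: "P (c \<odot>\<^bsub>A\<^esub> g) = (\<kappa> * c) \<odot>\<^bsub>B\<^esub> h" for c
    by (simp add: P_def is_lineD(2)[OF A] lcoef_smult[OF A])
  have "bij_betw P (carrier A) (carrier B)"
  proof (rule bij_betw_imageI)
    show "inj_on P (carrier A)"
      by (rule inj_onI) (use \<kappa> in \<open>auto elim!: is_line_carrierE[OF A] simp: P is_lineD(3)[OF B]\<close>)
    have "c \<odot>\<^bsub>B\<^esub> h = P ((c / \<kappa>) \<odot>\<^bsub>A\<^esub> g)" for c using \<kappa> by (simp add: P)
    then show "P ` carrier A = carrier B"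
      unfolding is_lineD(1)[OF A] is_lineD(1)[OF B] using P by blast
  qed
  moreover have "P \<in> vs_hom A B"
    unfolding vs_hom_iff
    by (auto elim!: is_line_carrierE[OF A] simp: P is_lineD(2,4,5)[OF A] is_lineD(2,4,5)[OF B] distrib_left mult.left_commute)
  moreover have "P g = \<kappa> \<odot>\<^bsub>B\<^esub> h" using P[of 1] is_lineD(7)[OF A] by simp
  ultimately show "line_iso A g B h \<kappa> P" by (simp add: line_iso_def P_def)
  fix P' assume P': "line_iso A g B h \<kappa> P'"
  show "P' = P"
  proof (rule extensionalityI)
    show "P' \<in> extensional (carrier A)" using P' by (simp add: line_iso_def)
    show "P \<in> extensional (carrier A)" by (simp add: P_def)
    fix v assume "v \<in> carrier A"
    then obtain c where c: "v = c \<odot>\<^bsub>A\<^esub> g" by (rule is_line_carrierE[OF A])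
    have "g \<in> carrier A" using is_lineD(2,7)[OF A] by metis
    then have "P' v = c \<odot>\<^bsub>B\<^esub> (\<kappa> \<odot>\<^bsub>B\<^esub> h)" using P' by (simp add: line_iso_def vs_hom_iff c)
    then show "P' v = P v" by (simp add: c P is_lineD(5)[OF B] mult.commute)
  qed
qed

text \<open>Turns an equation at an arbitrary nonzero vector of a line into one at the
  generator.\<close>

lemma line_hom_eq_iff:
  assumes A: "is_line A g" and B: "is_line B h" and P: "P \<in> vs_hom A B" and "\<alpha> \<noteq> 0"
  shows "P (\<alpha> \<odot>\<^bsub>A\<^esub> g) = \<gamma> \<odot>\<^bsub>B\<^esub> (\<beta> \<odot>\<^bsub>B\<^esub> h) \<longleftrightarrow> P g = (\<gamma> * \<beta> / \<alpha>) \<odot>\<^bsub>B\<^esub> h"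
proof -
  have g: "g \<in> carrier A" using is_lineD(2,7)[OF A] by metis
  then obtain q where q: "P g = q \<odot>\<^bsub>B\<^esub> h" using P is_line_carrierE[OF B] by (metis vs_hom_iff)
  have "P (\<alpha> \<odot>\<^bsub>A\<^esub> g) = (\<alpha> * q) \<odot>\<^bsub>B\<^esub> h" using P g by (simp add: vs_hom_iff q is_lineD(5)[OF B])
  then show ?thesis using assms(4) by (simp add: q is_lineD(3,5)[OF B] eq_divide_eq mult.commute)
qed

lemma wedge_det_map:
  assumes V1: "pres s1 U1 K1 V1 \<pi>1" and b1: "vsp.basis_mod s1 U1 K1 bs1"
    and V2: "pres s2 U2 K2 V2 \<pi>2" and b2: "vsp.basis_mod s2 U2 K2 bs2"
    and W: "pres s' U' K' W \<pi>'" and f: "f1 \<in> vs_hom V1 W" "f2 \<in> vs_hom V2 W"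
    and F: "\<And>x. x \<in> K1 \<Longrightarrow> f1 (\<pi>1 x) = \<pi>' (F1 x)" "\<And>x. x \<in> K2 \<Longrightarrow> f2 (\<pi>2 x) = \<pi>' (F2 x)"
  shows "ext_wedge (vs_dim V1) (vs_dim V2) W
      (det_map V1 W f1 (c \<odot>\<^bsub>det_line V1\<^esub> ext_cls (length bs1) V1 (map \<pi>1 bs1)))
      (det_map V2 W f2 (b \<odot>\<^bsub>det_line V2\<^esub> ext_cls (length bs2) V2 (map \<pi>2 bs2))) =
    (c * b) \<odot>\<^bsub>ext_power (length bs1 + length bs2) W\<^esub>
      ext_cls (length bs1 + length bs2) W (map \<pi>' (map F1 bs1 @ map F2 bs2))"
proof -
  interpret V1: pres s1 U1 K1 V1 \<pi>1 by fact
  interpret V2: pres s2 U2 K2 V2 \<pi>2 by fact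
  interpret W: pres s' U' K' W \<pi>' by fact
  note sub = V1.basis_modD(4)[OF b1] V2.basis_modD(4)[OF b2]
  have "map \<pi>' (map F1 bs1) = map f1 (map \<pi>1 bs1)" "map \<pi>' (map F2 bs2) = map f2 (map \<pi>2 bs2)"
    using sub F by auto
  then have l: "map \<pi>' (map F1 bs1) \<in> ext_lists (length bs1) W" "map \<pi>' (map F2 bs2) \<in> ext_lists (length bs2) W"
    using f sub V1.\<pi>_in V2.\<pi>_in by (auto simp: ext_lists_def vs_hom_iff subset_iff)
  have m1: "det_map V1 W f1 (c \<odot>\<^bsub>det_line V1\<^esub> ext_cls (length bs1) V1 (map \<pi>1 bs1)) =
      c \<odot>\<^bsub>ext_power (length bs1) W\<^esub> ext_cls (length bs1) W (map \<pi>' (map F1 bs1))"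
    by (rule det_map_cls[OF V1 W f(1) b1 sub(1) refl F(1)])
  have m2: "det_map V2 W f2 (b \<odot>\<^bsub>det_line V2\<^esub> ext_cls (length bs2) V2 (map \<pi>2 bs2)) =
      b \<odot>\<^bsub>ext_power (length bs2) W\<^esub> ext_cls (length bs2) W (map \<pi>' (map F2 bs2))"
    by (rule det_map_cls[OF V2 W f(2) b2 sub(2) refl F(2)])
  show ?thesis
    unfolding m1 m2 V1.vs_dim_eq[OF b1] V2.vs_dim_eq[OF b2] map_append
    by (rule ext_wedge_cls[OF W.mod_closed l])
qed

lemma ball_nonzero: "(\<forall>s\<in>{f c |c. c \<noteq> (0 :: 'f::field)}. Q s) \<longleftrightarrow> (\<forall>c. c \<noteq> 0 \<longrightarrow> Q (f c))"
  by auto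

lemma all_nonzero_const: "(\<forall>c. c \<noteq> (0 :: 'f::field) \<longrightarrow> R) \<longleftrightarrow> R"
  by (metis zero_neq_one)

section \<open>The defining formulas as one equation for a scalar\<close>

locale pert_setting = D: coh X d dd gs hs + E: coh X e ee gs' hs'
  for X :: "('f::field, 'a::ab_group_add, 'b::ab_group_add) graded_space"
    and d dd gs hs e ee gs' hs' +
  assumes fr_d: "finite_rank_perturbation_diff X d e" and fr_dag: "finite_rank_perturbation_dag X dd ee"
begin

abbreviation "sp \<equiv> scale_plus X"
abbreviation "sm \<equiv> scale_minus X"
abbreviation "\<sigma> \<equiv> sigma_plus d dd"
abbreviation "\<sigma>' \<equiv> sigma_minus d dd"
abbreviation "\<tau> \<equiv> sigma_minus e ee"
abbreviation "\<tau>' \<equiv> sigma_plus e ee"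

lemma fr: "fr_eq sm (d_plus d) (d_plus e)" "fr_eq sp (d_minus d) (d_minus e)"
  "fr_eq sp (dag_plus dd) (dag_plus ee)" "fr_eq sm (dag_minus dd) (dag_minus ee)"
  using fr_d fr_dag unfolding fr_eq_def finite_rank_perturbation_diff_def finite_rank_perturbation_dag_def by simp_all

lemma fr_sym: "fr_eq sm (d_plus e) (d_plus d)" "fr_eq sp (d_minus e) (d_minus d)"
  "fr_eq sp (dag_plus ee) (dag_plus dd)" "fr_eq sm (dag_minus ee) (dag_minus dd)"
proof -
  have V: "fr_eq sp g f" if "fr_eq sp f g" for f g :: "'x \<Rightarrow> 'a"
    using D.C.V.finite_rank_add(2)[OF D.C.V.finite_rank_zero that[unfolded fr_eq_def]]
    unfolding fr_eq_def by simp
  have W: "fr_eq sm g f" if "fr_eq sm f g" for f g :: "'x \<Rightarrow> 'b"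
    using D.C.W.finite_rank_add(2)[OF D.C.W.finite_rank_zero that[unfolded fr_eq_def]]
    unfolding fr_eq_def by simp
  show "fr_eq sm (d_plus e) (d_plus d)" "fr_eq sp (d_minus e) (d_minus d)"
    "fr_eq sp (dag_plus ee) (dag_plus dd)" "fr_eq sm (dag_minus ee) (dag_minus dd)"
    by (rule V W, rule fr)+
qed

lemma fred: "fred_pair sp sm \<sigma> \<sigma>' \<tau> \<tau>'"
  using cpx_fred_pair[OF D.cpx E.cpx fr(2,3) D.bh] by (simp only: D.sg E.sg)

text \<open>The finite cokernel used here is that of \<open>\<tau>\<close>, represented by
  \<open>gs'\<close>; the exchanged pair serves index \<open>\<ge> 0\<close>.\<close>

lemma fred': "fred_pair sm sp \<tau> \<tau>' \<sigma> \<sigma>'"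
  using cpx_fred_pair[OF E.C.swap D.C.swap fr_sym(1,4) E.bg] by (simp only: D.sg E.sg)


lemma kernel_basis: "D.C.W.basis_mod {0} {y. \<tau> y = 0} (map (\<lambda>y. y - \<tau>' (\<tau> y)) hs')"
  by (rule coh_swap_reldet(4)[OF E.coh_axioms])

text \<open>Both sides of the formula scale alike in \<open>s\<close>, \<open>t1\<close> and
  \<open>t0\<close>, so its instances for all nonzero vectors amount to one equation at the
  generators. Existence and uniqueness of the isomorphism then rest on the scalar being
  nonzero.\<close>

lemma nonpos_iso:
  assumes t: "is_triple_nonpos X d dd e ee L M N"
  obtains xs us ts where
    "pert sp sm \<sigma> \<sigma>' \<tau> \<tau>' (\<lambda>x. L (x - \<sigma>' (\<sigma> x))) (\<lambda>y. M (y - \<tau>' (\<tau> y))) (\<lambda>y. N (y - \<tau>' (\<tau> y))) xs us ts"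
    "pert_scalar sp sm \<sigma> \<sigma>' \<tau> \<tau>' (\<lambda>x. L (x - \<sigma>' (\<sigma> x))) (\<lambda>y. M (y - \<tau>' (\<tau> y))) (\<lambda>y. N (y - \<tau>' (\<tau> y)))
        xs us ts gs hs gs' hs' \<noteq> 0"
    "\<And>P. is_perturbation_iso X d e dd ee (Triple_Nonpos L M N) P \<longleftrightarrow>
      line_iso (complex_line X d) D.gen (complex_line X e) E.gen
        (pert_scalar sp sm \<sigma> \<sigma>' \<tau> \<tau>' (\<lambda>x. L (x - \<sigma>' (\<sigma> x))) (\<lambda>y. M (y - \<tau>' (\<tau> y))) (\<lambda>y. N (y - \<tau>' (\<tau> y)))
          xs us ts gs hs gs' hs') P"
proof -
  let ?L = "\<lambda>x. L (x - \<sigma>' (\<sigma> x))" and ?M = "\<lambda>y. M (y - \<tau>' (\<tau> y))" and ?N = "\<lambda>y. N (y - \<tau>' (\<tau> y))"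
  let ?KM = "{t. \<tau> t = 0 \<and> M t = 0}" and ?KN = "{t. \<tau> t = 0 \<and> N t = 0}"
  let ?xs = "map (\<lambda>x. x - \<sigma>' (\<sigma> x)) gs"
  interpret F: fred_pair sp sm \<sigma> \<sigma>' \<tau> \<tau>' by (rule fred)
  note tr = t[unfolded triple_nonpos_trip]
  obtain us ts where p: "pert sp sm \<sigma> \<sigma>' \<tau> \<tau>' ?L ?M ?N ?xs us ts"
    and us: "D.C.W.basis_mod {0} ?KN us" and ts: "D.C.W.basis_mod {0} ?KM ts"
    by (rule F.trip_pert[OF D.harmonic_basis kernel_basis tr])
  define xs where "xs = ?xs"
  interpret p: pert sp sm \<sigma> \<sigma>' \<tau> \<tau>' ?L ?M ?N xs us ts using p by (simp only: xs_def)
  let ?kers = "ker_space sp \<sigma>" and ?kert = "ker_space sm \<tau>" and ?cokers = "coker_space sm \<sigma>" and ?cokert = "coker_space sp \<tau>"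
  let ?kM = "space_on sm ?KM" and ?kN = "space_on sm ?KN"
  interpret kM: pres sm "{0}" ?KM ?kM "\<lambda>x. x" by (rule D.C.W.pres_space[OF D.C.W.basis_modD(2)[OF ts]])
  interpret kN: pres sm "{0}" ?KN ?kN "\<lambda>x. x" by (rule D.C.W.pres_space[OF D.C.W.basis_modD(2)[OF us]])
  have hom: "L \<in> vs_hom ?kers (space_on sm UNIV)" "M \<in> vs_hom ?kert (space_on sp UNIV)" "N \<in> vs_hom ?kert (space_on sm UNIV)"
    using tr unfolding trip_def Let_def by blast+
  have fL: "(\<lambda>x. vcoset (range \<sigma>) (L x)) \<in> vs_hom ?kers ?cokers"
    by (rule vs_hom_coset[OF D.Q.pres_axioms hom(1)])
  have fN: "(\<lambda>x. vcoset (range \<sigma>) (N x)) \<in> vs_hom ?kM ?cokers"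
    by (rule vs_hom_coset[OF D.Q.pres_axioms vs_hom_subspace[OF hom(3)[unfolded ker_space_def]]]) auto
  have fM: "(\<lambda>x. vcoset (range \<tau>) (M x)) \<in> vs_hom ?kN ?cokert"
    by (rule vs_hom_coset[OF E.Q'.pres_axioms vs_hom_subspace[OF hom(2)[unfolded ker_space_def]]]) auto
  have idM: "id \<in> vs_hom ?kM ?kert" and idN: "id \<in> vs_hom ?kN ?kert"
    by (rule vs_hom_pres[OF kM.pres_axioms E.K'.pres_axioms] vs_hom_pres[OF kN.pres_axioms E.K'.pres_axioms]; auto)+
  have lx: "length xs = length gs" by (rule D.ker_basis_length[OF p.bx])
  have lt: "length us + length ts = length hs'"
    using coh_swap_reldet(1)[OF E.coh_axioms p.bt] by simp
  have lw: "length xs + length ts = length hs" using D.coker_basis_length[OF p.bW] by simp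
  have lu: "length us = length gs'" using D.C.V.basis_mod_length[OF E.bg' p.bV] by simp
  let ?S = "\<lambda>c. c \<odot>\<^bsub>det_line ?kers\<^esub> ext_cls (length xs) ?kers xs"
  let ?T1 = "\<lambda>b. b \<odot>\<^bsub>det_line ?kM\<^esub> ext_cls (length ts) ?kM ts"
  let ?T0 = "\<lambda>a. a \<odot>\<^bsub>det_line ?kN\<^esub> ext_cls (length us) ?kN us"
  have nz: "nonzero (det_line ?kers) = {?S c |c. c \<noteq> 0}" "nonzero (det_line ?kM) = {?T1 b |b. b \<noteq> 0}"
    "nonzero (det_line ?kN) = {?T0 a |a. a \<noteq> 0}"
    using nonzero_line_iff[OF D.K.det_line_basis(1)[OF p.bx]] nonzero_line_iff[OF kM.det_line_basis(1)[OF ts]]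
      nonzero_line_iff[OF kN.det_line_basis(1)[OF us]] by simp_all
  have v: "ext_wedge (vs_dim ?kers) (vs_dim ?kM) ?cokers
      (det_map ?kers ?cokers (\<lambda>x. vcoset (range \<sigma>) (L x)) (?S c))
      (det_map ?kM ?cokers (\<lambda>t. vcoset (range \<sigma>) (N t)) (?T1 b)) =
    (c * b) \<odot>\<^bsub>det_line ?cokers\<^esub> ext_cls (length hs) ?cokers (map (vcoset (range \<sigma>)) (map ?L xs @ map ?N ts))" for b c
    using wedge_det_map[OF D.K.pres_axioms p.bx kM.pres_axioms ts D.Q.pres_axioms fL fN, of ?L ?N c b]
    by (simp add: F.ker_proj_fix lw det_line_def D.Q.vs_dim_eq[OF D.bh'] del: map_map)
  have w: "ext_wedge (vs_dim ?kN) (vs_dim ?kM) ?kert (det_map ?kN ?kert id (?T0 a)) (det_map ?kM ?kert id (?T1 b)) =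
    (a * b) \<odot>\<^bsub>det_line ?kert\<^esub> ext_cls (length hs') ?kert (us @ ts)" for a b
    using wedge_det_map[OF kN.pres_axioms us kM.pres_axioms ts E.K'.pres_axioms idN idM, of id id a b]
    by (simp add: lt det_line_def E.K'.vs_dim_eq[OF p.bt])
  have m: "det_map ?kN ?cokert (\<lambda>t. vcoset (range \<tau>) (M t)) (?T0 a) =
    a \<odot>\<^bsub>det_line ?cokert\<^esub> ext_cls (length gs') ?cokert (map (vcoset (range \<tau>)) (map ?M us))" for a
    using det_map_cls[OF kN.pres_axioms E.Q'.pres_axioms fM us D.C.W.basis_modD(4)[OF us] refl, of ?M a]
    by (simp add: F.ker_proj_fix lu det_line_def E.Q'.vs_dim_eq[OF E.bg'] del: map_map)
  let ?dt = "op_det sm p.Sig"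
  let ?x = "D.C.V.reldet (range \<tau>) gs' (map ?M us)" and ?w = "D.C.W.reldet (range \<sigma>) hs (map ?L xs @ map ?N ts)"
    and ?y = "D.C.W.reldet (range \<tau>') hs' (us @ ts)" and ?z = "D.C.V.reldet (range \<sigma>') gs xs"
  have nz': "?x \<noteq> 0" "?w \<noteq> 0" "?y \<noteq> 0" "?z \<noteq> 0" "?dt \<noteq> 0"
    using D.C.V.reldet_nonzero[OF E.bg' p.bV] D.C.W.reldet_nonzero[OF D.bh' p.bW]
      D.C.W.reldet_nonzero[OF E.bh' p.bt'] D.C.V.reldet_nonzero[OF D.bg' p.bx']
      D.C.W.op_det_nonzero[OF p.linSig p.bij_Sig p.finite_rank_Sig] by simp_all
  let ?\<kappa> = "pert_scalar sp sm \<sigma> \<sigma>' \<tau> \<tau>' ?L ?M ?N xs us ts gs hs gs' hs'"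
  have \<kappa>: "?\<kappa> = ?x * ?w / (?y * ?z * ?dt)" by (simp add: pert_scalar_def)
  have key: "P (source_vector X d dd (?S c)
      ((c * b) \<odot>\<^bsub>det_line ?cokers\<^esub> ext_cls (length hs) ?cokers (map (vcoset (range \<sigma>)) (map ?L xs @ map ?N ts)))) =
    inverse ?dt \<odot>\<^bsub>complex_line X e\<^esub> target_vector X e ee
      (a \<odot>\<^bsub>det_line ?cokert\<^esub> ext_cls (length gs') ?cokert (map (vcoset (range \<tau>)) (map ?M us)))
      ((a * b) \<odot>\<^bsub>det_line ?kert\<^esub> ext_cls (length hs') ?kert (us @ ts)) \<longleftrightarrow>
    P D.gen = ?\<kappa> \<odot>\<^bsub>complex_line X e\<^esub> E.gen"
    if P: "P \<in> vs_hom (complex_line X d) (complex_line X e)" and abc: "a \<noteq> 0" "b \<noteq> 0" "c \<noteq> 0" for P a b c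
  proof -
    have cb: "c * b \<noteq> 0" "a * b \<noteq> 0" using abc by simp_all
    \<comment> \<open>\<open>c\<close> cancels within the source vector, \<open>a\<close> within the
      target vector, and the remaining factor \<open>1 / b\<close> is common to both.\<close>
    have "inverse ?dt * (a * ?x * inverse (a * b * ?y)) / (c * ?z * inverse (c * b * ?w)) = ?\<kappa>"
      using abc nz' unfolding \<kappa> by (simp add: field_simps)
    moreover have "c * ?z * inverse (c * b * ?w) \<noteq> 0" using abc nz' by simp
    ultimately show ?thesis
      using line_hom_eq_iff[OF D.line_gen E.line_gen P, of "c * ?z * inverse (c * b * ?w)" "inverse ?dt"
          "a * ?x * inverse (a * b * ?y)"]
      unfolding D.source_vector_eq[OF p.bx p.bW cb(1), folded lx] lx[symmetric]
        E.target_vector_eq[OF p.bt p.bV cb(2)] by simp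
  qed
  have carr: "{t \<in> carrier ?kert. M t = 0} = ?KM" "{t \<in> carrier ?kert. N t = 0} = ?KN"
    by (auto simp: ker_space_def space_on_def)
  have Sig: "(\<lambda>y. \<sigma> (\<tau> y + ?M y) + ?L (\<tau> y + ?M y) + ?N y) = p.Sig"
    by (simp add: fun_eq_iff p.Sig_def p.A_def p.B_def)
  have formula: "formula_nonpos X d dd e ee L M N P \<longleftrightarrow> P D.gen = ?\<kappa> \<odot>\<^bsub>complex_line X e\<^esub> E.gen"
    if P: "P \<in> vs_hom (complex_line X d) (complex_line X e)" for P
    unfolding formula_nonpos_def Let_def carr Sig nz ball_nonzero v w m
    by (simp only: key[OF P] p.det_class_Sig all_nonzero_const simp_thms cong: imp_cong)
  have "is_perturbation_iso X d e dd ee (Triple_Nonpos L M N) P \<longleftrightarrow>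
      line_iso (complex_line X d) D.gen (complex_line X e) E.gen ?\<kappa> P" for P
    unfolding is_perturbation_iso_def line_iso_def using formula[of P] by auto
  moreover have "?\<kappa> \<noteq> 0" unfolding \<kappa> using nz' by simp
  ultimately show ?thesis using that[of xs us ts] p.pert_axioms p unfolding xs_def by blast
qed

end

context pert_setting
begin

text \<open>The exchanged data list the blocks as \<open>us @ ts\<close> and
  \<open>map M ys @ map N ts\<close>, while the formula puts the \<open>ts\<close> blocks first. The
  two block exchanges have sizes fixed by the cohomology, so their factor is the same for every
  choice.\<close>

lemma nonneg_iso:
  assumes t: "is_triple_nonneg X d dd e ee L M N"
  obtains ys us ts \<kappa> where
    "pert sm sp \<tau> \<tau>' \<sigma> \<sigma>' (\<lambda>y. M (y - \<tau>' (\<tau> y))) (\<lambda>x. L (x - \<sigma>' (\<sigma> x))) (\<lambda>x. N (x - \<sigma>' (\<sigma> x))) ys us ts"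
    "\<kappa> = pert_scalar sm sp \<tau> \<tau>' \<sigma> \<sigma>' (\<lambda>y. M (y - \<tau>' (\<tau> y))) (\<lambda>x. L (x - \<sigma>' (\<sigma> x)))
        (\<lambda>x. N (x - \<sigma>' (\<sigma> x))) ys us ts hs' gs' hs gs *
      D.C.V.blockswap_det (length hs') (length gs - length hs) /
      D.C.V.blockswap_det (length hs) (length gs - length hs)"
    "\<kappa> \<noteq> 0"
    "\<And>P. is_perturbation_iso X d e dd ee (Triple_Nonneg L M N) P \<longleftrightarrow>
      line_iso (complex_line X d) D.gen (complex_line X e) E.gen \<kappa> P"
proof -
  let ?L = "\<lambda>x. L (x - \<sigma>' (\<sigma> x))" and ?M = "\<lambda>y. M (y - \<tau>' (\<tau> y))" and ?N = "\<lambda>x. N (x - \<sigma>' (\<sigma> x))"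
  let ?KL = "{t. \<sigma> t = 0 \<and> L t = 0}" and ?KN = "{t. \<sigma> t = 0 \<and> N t = 0}"
  define ys where "ys = map (\<lambda>y. y - \<tau>' (\<tau> y)) hs'"
  interpret F: fred_pair sm sp \<tau> \<tau>' \<sigma> \<sigma>' by (rule fred')
  note tr = t[unfolded triple_nonneg_trip]
  obtain us ts where p: "pert sm sp \<tau> \<tau>' \<sigma> \<sigma>' ?M ?L ?N ys us ts"
    and us: "D.C.V.basis_mod {0} ?KN us" and ts: "D.C.V.basis_mod {0} ?KL ts"
    by (rule F.trip_pert[OF kernel_basis D.harmonic_basis tr, folded ys_def])
  interpret p: pert sm sp \<tau> \<tau>' \<sigma> \<sigma>' ?M ?L ?N ys us ts by (rule p)
  let ?kers = "ker_space sp \<sigma>" and ?kert = "ker_space sm \<tau>" and ?cokers = "coker_space sm \<sigma>" and ?cokert = "coker_space sp \<tau>"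
  let ?kL = "space_on sp ?KL" and ?kN = "space_on sp ?KN"
  interpret kL: pres sp "{0}" ?KL ?kL "\<lambda>x. x" by (rule D.C.V.pres_space[OF D.C.V.basis_modD(2)[OF ts]])
  interpret kN: pres sp "{0}" ?KN ?kN "\<lambda>x. x" by (rule D.C.V.pres_space[OF D.C.V.basis_modD(2)[OF us]])
  have hom: "L \<in> vs_hom ?kers (space_on sm UNIV)" "M \<in> vs_hom ?kert (space_on sp UNIV)" "N \<in> vs_hom ?kers (space_on sp UNIV)"
    using tr unfolding trip_def Let_def by blast+
  have fM: "(\<lambda>x. vcoset (range \<tau>) (M x)) \<in> vs_hom ?kert ?cokert"
    by (rule vs_hom_coset[OF E.Q'.pres_axioms hom(2)])
  have fN: "(\<lambda>x. vcoset (range \<tau>) (N x)) \<in> vs_hom ?kL ?cokert"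
    by (rule vs_hom_coset[OF E.Q'.pres_axioms vs_hom_subspace[OF hom(3)[unfolded ker_space_def]]]) auto
  have fL: "(\<lambda>x. vcoset (range \<sigma>) (L x)) \<in> vs_hom ?kN ?cokers"
    by (rule vs_hom_coset[OF D.Q.pres_axioms vs_hom_subspace[OF hom(1)[unfolded ker_space_def]]]) auto
  have idL: "id \<in> vs_hom ?kL ?kers" and idN: "id \<in> vs_hom ?kN ?kers"
    by (rule vs_hom_pres[OF kL.pres_axioms D.K.pres_axioms] vs_hom_pres[OF kN.pres_axioms D.K.pres_axioms]; auto)+
  have bx: "D.C.V.basis_mod {0} {x. \<sigma> x = 0} (ts @ us)" by (rule D.C.V.basis_mod_append_commute[OF p.bt])
  have bx': "D.C.V.basis_mod (range \<sigma>') UNIV (ts @ us)" by (rule D.C.V.basis_mod_append_commute[OF p.bt'])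
  have bw: "D.C.V.basis_mod (range \<tau>) UNIV (map ?N ts @ map ?M ys)" by (rule D.C.V.basis_mod_append_commute[OF p.bW])
  have ly: "length ys = length hs'" by (simp add: ys_def)
  have lx: "length ts + length us = length gs" using D.ker_basis_length[OF bx] by simp
  have lu: "length us = length hs" using D.coker_basis_length[OF p.bV] by simp
  have lw: "length ts + length ys = length gs'" using D.C.V.basis_mod_length[OF E.bg' bw] by simp
  let ?S0 = "\<lambda>c. c \<odot>\<^bsub>det_line ?kL\<^esub> ext_cls (length ts) ?kL ts"
  let ?S1 = "\<lambda>b. b \<odot>\<^bsub>det_line ?kN\<^esub> ext_cls (length us) ?kN us"
  let ?T = "\<lambda>a. a \<odot>\<^bsub>det_line ?kert\<^esub> ext_cls (length ys) ?kert ys"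
  have nz: "nonzero (det_line ?kL) = {?S0 c |c. c \<noteq> 0}" "nonzero (det_line ?kN) = {?S1 b |b. b \<noteq> 0}"
    "nonzero (det_line ?kert) = {?T a |a. a \<noteq> 0}"
    using nonzero_line_iff[OF kL.det_line_basis(1)[OF ts]] nonzero_line_iff[OF kN.det_line_basis(1)[OF us]]
      nonzero_line_iff[OF E.K'.det_line_basis(1)[OF p.bx]] by simp_all
  have v: "ext_wedge (vs_dim ?kL) (vs_dim ?kert) ?cokert
      (det_map ?kL ?cokert (\<lambda>x. vcoset (range \<tau>) (N x)) (?S0 c))
      (det_map ?kert ?cokert (\<lambda>y. vcoset (range \<tau>) (M y)) (?T a)) =
    (c * a) \<odot>\<^bsub>det_line ?cokert\<^esub> ext_cls (length gs') ?cokert (map (vcoset (range \<tau>)) (map ?N ts @ map ?M ys))" for c a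
    using wedge_det_map[OF kL.pres_axioms ts E.K'.pres_axioms p.bx E.Q'.pres_axioms fN fM, of ?N ?M c a]
    by (simp add: F.ker_proj_fix lw det_line_def E.Q'.vs_dim_eq[OF E.bg'] del: map_map)
  have w: "ext_wedge (vs_dim ?kL) (vs_dim ?kN) ?kers (det_map ?kL ?kers id (?S0 c)) (det_map ?kN ?kers id (?S1 b)) =
    (c * b) \<odot>\<^bsub>det_line ?kers\<^esub> ext_cls (length gs) ?kers (ts @ us)" for c b
    using wedge_det_map[OF kL.pres_axioms ts kN.pres_axioms us D.K.pres_axioms idL idN, of id id c b]
    by (simp add: lx det_line_def D.K.vs_dim_eq[OF bx])
  have m: "det_map ?kN ?cokers (\<lambda>x. vcoset (range \<sigma>) (L x)) (?S1 b) =
    b \<odot>\<^bsub>det_line ?cokers\<^esub> ext_cls (length hs) ?cokers (map (vcoset (range \<sigma>)) (map ?L us))" for b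
    using det_map_cls[OF kN.pres_axioms D.Q.pres_axioms fL us D.C.V.basis_modD(4)[OF us] refl, of ?L b]
    by (simp add: F.ker_proj_fix lu det_line_def D.Q.vs_dim_eq[OF D.bh'] del: map_map)
  let ?dt = "op_det sp p.Sig"
  let ?x = "D.C.V.reldet (range \<tau>) gs' (map ?N ts @ map ?M ys)" and ?w = "D.C.W.reldet (range \<sigma>) hs (map ?L us)"
    and ?y = "D.C.W.reldet (range \<tau>') hs' ys" and ?z = "D.C.V.reldet (range \<sigma>') gs (ts @ us)"
  have nz': "?x \<noteq> 0" "?w \<noteq> 0" "?y \<noteq> 0" "?z \<noteq> 0" "?dt \<noteq> 0"
    using D.C.V.reldet_nonzero[OF E.bg' bw] D.C.W.reldet_nonzero[OF D.bh' p.bV]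
      D.C.W.reldet_nonzero[OF E.bh' p.bx'] D.C.V.reldet_nonzero[OF D.bg' bx']
      D.C.V.op_det_nonzero[OF p.linSig p.bij_Sig p.finite_rank_Sig] by simp_all
  define \<kappa> where "\<kappa> = ?x * ?w / (?y * ?z * ?dt)"
  have \<kappa>: "\<kappa> = pert_scalar sm sp \<tau> \<tau>' \<sigma> \<sigma>' ?M ?L ?N ys us ts hs' gs' hs gs *
      D.C.V.blockswap_det (length hs') (length gs - length hs) /
      D.C.V.blockswap_det (length hs) (length gs - length hs)"
  proof -
    \<comment> \<open>The block that is moved past the others has the index as its length.\<close>
    have l: "length gs - length us = length ts" using lx by simp
    have "?x = D.C.V.reldet (range \<tau>) gs' (map ?M ys @ map ?N ts) * D.C.V.blockswap_det (length ys) (length ts)"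
      using D.C.V.reldet_append_commute[OF E.bg' p.bW] by simp
    moreover have "?z = D.C.V.reldet (range \<sigma>') gs (us @ ts) * D.C.V.blockswap_det (length us) (length ts)"
      by (rule D.C.V.reldet_append_commute[OF D.bg' p.bt'])
    ultimately show ?thesis unfolding \<kappa>_def pert_scalar_def ly[symmetric] lu[symmetric] l
      by (simp add: mult_ac)
  qed
  have key: "P (source_vector X d dd
      ((c * b) \<odot>\<^bsub>det_line ?kers\<^esub> ext_cls (length gs) ?kers (ts @ us))
      (b \<odot>\<^bsub>det_line ?cokers\<^esub> ext_cls (length hs) ?cokers (map (vcoset (range \<sigma>)) (map ?L us)))) =
    inverse ?dt \<odot>\<^bsub>complex_line X e\<^esub> target_vector X e ee
      ((c * a) \<odot>\<^bsub>det_line ?cokert\<^esub> ext_cls (length gs') ?cokert (map (vcoset (range \<tau>)) (map ?N ts @ map ?M ys)))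
      (?T a) \<longleftrightarrow>
    P D.gen = \<kappa> \<odot>\<^bsub>complex_line X e\<^esub> E.gen"
    if P: "P \<in> vs_hom (complex_line X d) (complex_line X e)" and abc: "a \<noteq> 0" "b \<noteq> 0" "c \<noteq> 0" for P a b c
  proof -
    \<comment> \<open>Here \<open>b\<close> cancels within the source vector, \<open>a\<close>
      within the target vector, and \<open>c\<close> is common to both.\<close>
    have "inverse ?dt * (c * a * ?x * inverse (a * ?y)) / (c * b * ?z * inverse (b * ?w)) = \<kappa>"
      using abc nz' unfolding \<kappa>_def by (simp add: field_simps)
    moreover have "c * b * ?z * inverse (b * ?w) \<noteq> 0" using abc nz' by simp
    ultimately show ?thesis
      using line_hom_eq_iff[OF D.line_gen E.line_gen P, of "c * b * ?z * inverse (b * ?w)" "inverse ?dt"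
          "c * a * ?x * inverse (a * ?y)"]
      unfolding D.source_vector_eq[OF bx p.bV abc(2)] ly E.target_vector_eq[OF p.bx bw abc(1)] by simp
  qed
  have carr: "{x \<in> carrier ?kers. L x = 0} = ?KL" "{x \<in> carrier ?kers. N x = 0} = ?KN"
    by (auto simp: ker_space_def space_on_def)
  have Sig: "(\<lambda>x. \<tau> (\<sigma> x + ?L x) + ?M (\<sigma> x + ?L x) + ?N x) = p.Sig"
    by (simp add: fun_eq_iff p.Sig_def p.A_def p.B_def)
  have formula: "formula_nonneg X d dd e ee L M N P \<longleftrightarrow> P D.gen = \<kappa> \<odot>\<^bsub>complex_line X e\<^esub> E.gen"
    if P: "P \<in> vs_hom (complex_line X d) (complex_line X e)" for P
    unfolding formula_nonneg_def Let_def carr Sig nz ball_nonzero v w m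
    by (simp only: key[OF P] p.det_class_Sig all_nonzero_const simp_thms cong: imp_cong)
  have "is_perturbation_iso X d e dd ee (Triple_Nonneg L M N) P \<longleftrightarrow>
      line_iso (complex_line X d) D.gen (complex_line X e) E.gen \<kappa> P" for P
    unfolding is_perturbation_iso_def line_iso_def using formula[of P] by auto
  moreover have "\<kappa> \<noteq> 0" unfolding \<kappa>_def using nz' by simp
  ultimately show ?thesis using that[OF p \<kappa>] by blast
qed

end

section \<open>Independence of the choices\<close>

lemma nonpos_scalar_unique:
  assumes S1: "pert_setting X d dd1 gs hs e ee1 gs' hs'" and S2: "pert_setting X d dd2 gs hs e ee2 gs' hs'"
  defines "sp \<equiv> scale_plus X" and "sm \<equiv> scale_minus X"
  assumes p: "pert sp sm (sigma_plus d dd1) (sigma_minus d dd1) (sigma_minus e ee1) (sigma_plus e ee1) L1 M1 N1 xs1 us1 ts1"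
    "pert sp sm (sigma_plus d dd2) (sigma_minus d dd2) (sigma_minus e ee2) (sigma_plus e ee2) L2 M2 N2 xs2 us2 ts2"
  shows "pert_scalar sp sm (sigma_plus d dd1) (sigma_minus d dd1) (sigma_minus e ee1) (sigma_plus e ee1)
      L1 M1 N1 xs1 us1 ts1 gs hs gs' hs' =
    pert_scalar sp sm (sigma_plus d dd2) (sigma_minus d dd2) (sigma_minus e ee2) (sigma_plus e ee2)
      L2 M2 N2 xs2 us2 ts2 gs hs gs' hs'"
proof -
  interpret S1: pert_setting X d dd1 gs hs e ee1 gs' hs' by fact
  interpret S2: pert_setting X d dd2 gs hs e ee2 gs' hs' by fact
  note u = pert_scalar_unique[OF S1.D.cpx S2.D.cpx S1.E.cpx S2.E.cpx S1.fr S2.fr(3,4)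
      S1.D.bg S1.D.bh S1.E.bg S1.E.bh, unfolded S1.D.sg S2.D.sg S1.E.sg S2.E.sg]
  show ?thesis by (rule u[OF p[unfolded sp_def sm_def], folded sp_def sm_def])
qed

lemma nonneg_scalar_unique:
  assumes S1: "pert_setting X d dd1 gs hs e ee1 gs' hs'" and S2: "pert_setting X d dd2 gs hs e ee2 gs' hs'"
  defines "sp \<equiv> scale_plus X" and "sm \<equiv> scale_minus X"
  assumes p: "pert sm sp (sigma_minus e ee1) (sigma_plus e ee1) (sigma_plus d dd1) (sigma_minus d dd1) M1 L1 N1 ys1 us1 ts1"
    "pert sm sp (sigma_minus e ee2) (sigma_plus e ee2) (sigma_plus d dd2) (sigma_minus d dd2) M2 L2 N2 ys2 us2 ts2"
  shows "pert_scalar sm sp (sigma_minus e ee1) (sigma_plus e ee1) (sigma_plus d dd1) (sigma_minus d dd1)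
      M1 L1 N1 ys1 us1 ts1 hs' gs' hs gs =
    pert_scalar sm sp (sigma_minus e ee2) (sigma_plus e ee2) (sigma_plus d dd2) (sigma_minus d dd2)
      M2 L2 N2 ys2 us2 ts2 hs' gs' hs gs"
proof -
  interpret S1: pert_setting X d dd1 gs hs e ee1 gs' hs' by fact
  interpret S2: pert_setting X d dd2 gs hs e ee2 gs' hs' by fact
  note u = pert_scalar_unique[OF S1.E.C.swap S2.E.C.swap S1.D.C.swap S2.D.C.swap S1.fr_sym(2,1,4,3) S2.fr_sym(4,3)
      S1.E.bh S1.E.bg S1.D.bh S1.D.bg, unfolded S1.D.sg S2.D.sg S1.E.sg S2.E.sg]
  show ?thesis by (rule u[OF p[unfolded sp_def sm_def], folded sp_def sm_def])
qed

lemma fredholm_bases: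
  assumes "is_complex X d" "is_fredholm X d"
  obtains gs hs where
    "vsp.basis_mod (scale_plus X) (range (d_minus d)) {x. d_plus d x = 0} gs"
    "vsp.basis_mod (scale_minus X) (range (d_plus d)) {y. d_minus d y = 0} hs"
    "fredholm_index X d = int (length gs) - int (length hs)"
proof -
  interpret p: lin_map "scale_plus X" "scale_minus X" "d_plus d"
    using assms(1) by (simp add: is_complex_def lin_map_def)
  interpret m: lin_map "scale_minus X" "scale_plus X" "d_minus d"
    using assms(1) by (simp add: is_complex_def lin_map_def)
  have c: "d_minus d (d_plus d x) = 0" "d_plus d (d_minus d y) = 0" for x y
    using assms(1) by (auto simp: is_complex_def)
  interpret Hp: pres "scale_plus X" "range (d_minus d)" "{x. d_plus d x = 0}" "H_plus X d" "vcoset (range (d_minus d))"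
    unfolding H_plus_def
    by (rule p.S.pres_quotient[OF m.subspace_image[OF p.vs2.subspace_UNIV] p.subspace_kernel]) (auto simp: c)
  interpret Hm: pres "scale_minus X" "range (d_plus d)" "{y. d_minus d y = 0}" "H_minus X d" "vcoset (range (d_plus d))"
    unfolding H_minus_def
    by (rule p.T.pres_quotient[OF p.subspace_image[OF p.vs1.subspace_UNIV] m.subspace_kernel]) (auto simp: c)
  obtain gs where gs: "p.S.basis_mod (range (d_minus d)) {x. d_plus d x = 0} gs"
    using Hp.basis_of_fin_dim assms(2) unfolding is_fredholm_def by blast
  obtain hs where hs: "p.T.basis_mod (range (d_plus d)) {y. d_minus d y = 0} hs"
    using Hm.basis_of_fin_dim assms(2) unfolding is_fredholm_def by blast
  show ?thesis
    by (rule that[OF gs hs]) (simp add: fredholm_index_def Hp.vs_dim_eq[OF gs] Hm.vs_dim_eq[OF hs])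
qed

text \<open>In index \<open>0\<close> a pair of triples of different kinds is compared through the triple \<open>(L, M, 0)\<close>, which
  is of both kinds.\<close>

lemma mixed_iso:
  assumes S1: "pert_setting X d dd1 gs hs e ee1 gs' hs'" and S2: "pert_setting X d dd2 gs hs e ee2 gs' hs'"
    and i: "length gs = length hs"
    and t1: "is_triple_nonpos X d dd1 e ee1 L1 M1 N1" and t2: "is_triple_nonneg X d dd2 e ee2 L2 M2 N2"
  obtains \<kappa> where "\<kappa> \<noteq> 0"
    "\<And>P. is_perturbation_iso X d e dd1 ee1 (Triple_Nonpos L1 M1 N1) P \<longleftrightarrow>
      line_iso (complex_line X d) (coh.gen X d gs hs) (complex_line X e) (coh.gen X e gs' hs') \<kappa> P"
    "\<And>P. is_perturbation_iso X d e dd2 ee2 (Triple_Nonneg L2 M2 N2) P \<longleftrightarrow>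
      line_iso (complex_line X d) (coh.gen X d gs hs) (complex_line X e) (coh.gen X e gs' hs') \<kappa> P"
proof -
  interpret S1: pert_setting X d dd1 gs hs e ee1 gs' hs' by fact
  interpret S2: pert_setting X d dd2 gs hs e ee2 gs' hs' by fact
  let ?L = "\<lambda>x. L1 (x - S1.\<sigma>' (S1.\<sigma> x))" and ?M = "\<lambda>y. M1 (y - S1.\<tau>' (S1.\<tau> y))" and ?N = "\<lambda>y. N1 (y - S1.\<tau>' (S1.\<tau> y))"
  obtain xs us ts where p: "pert S1.sp S1.sm S1.\<sigma> S1.\<sigma>' S1.\<tau> S1.\<tau>' ?L ?M ?N xs us ts"
    and nz: "pert_scalar S1.sp S1.sm S1.\<sigma> S1.\<sigma>' S1.\<tau> S1.\<tau>' ?L ?M ?N xs us ts gs hs gs' hs' \<noteq> 0"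
    and iso1: "\<And>P. is_perturbation_iso X d e dd1 ee1 (Triple_Nonpos L1 M1 N1) P \<longleftrightarrow>
      line_iso (complex_line X d) S1.D.gen (complex_line X e) S1.E.gen
        (pert_scalar S1.sp S1.sm S1.\<sigma> S1.\<sigma>' S1.\<tau> S1.\<tau>' ?L ?M ?N xs us ts gs hs gs' hs') P"
    by (rule S1.nonpos_iso[OF t1]) (rule that)
  interpret p: pert S1.sp S1.sm S1.\<sigma> S1.\<sigma>' S1.\<tau> S1.\<tau>' ?L ?M ?N xs us ts by (rule p)
  have "length xs = length gs" by (rule S1.D.ker_basis_length[OF p.bx])
  moreover have "length xs + length ts = length hs" using S1.D.coker_basis_length[OF p.bW] by simp
  \<comment> \<open>\<open>xs\<close> alone fills the cokernel of \<open>\<sigma>\<close> in index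
    0, which leaves no room for \<open>map N ts\<close>.\<close>
  ultimately have ts: "ts = []" using i by simp
  note z = pert_scalar_index_zero[OF p[unfolded ts] S1.fred']
  let ?L2 = "\<lambda>x. L2 (x - S2.\<sigma>' (S2.\<sigma> x))" and ?M2 = "\<lambda>y. M2 (y - S2.\<tau>' (S2.\<tau> y))" and ?N2 = "\<lambda>x. N2 (x - S2.\<sigma>' (S2.\<sigma> x))"
  obtain ys2 us2 ts2 \<kappa> where q: "pert S2.sm S2.sp S2.\<tau> S2.\<tau>' S2.\<sigma> S2.\<sigma>' ?M2 ?L2 ?N2 ys2 us2 ts2"
    and \<kappa>: "\<kappa> = pert_scalar S2.sm S2.sp S2.\<tau> S2.\<tau>' S2.\<sigma> S2.\<sigma>' ?M2 ?L2 ?N2 ys2 us2 ts2 hs' gs' hs gs *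
      S1.D.C.V.blockswap_det (length hs') (length gs - length hs) /
      S1.D.C.V.blockswap_det (length hs) (length gs - length hs)"
    and "\<kappa> \<noteq> 0" and iso2: "\<And>P. is_perturbation_iso X d e dd2 ee2 (Triple_Nonneg L2 M2 N2) P \<longleftrightarrow>
      line_iso (complex_line X d) S2.D.gen (complex_line X e) S2.E.gen \<kappa> P"
    by (rule S2.nonneg_iso[OF t2]) (rule that)
  \<comment> \<open>The triple \<open>(L, M, 0)\<close> links the two scalars; in index 0 the moved
    block is empty and both exchange factors are 1.\<close>
  have "\<kappa> = pert_scalar S1.sp S1.sm S1.\<sigma> S1.\<sigma>' S1.\<tau> S1.\<tau>' ?L ?M ?N xs us ts gs hs gs' hs'"
    unfolding \<kappa> ts z(2)[symmetric] nonneg_scalar_unique[OF S1 S2 z(1) q] i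
    by (simp add: S1.D.C.V.blockswap_det_0)
  then show ?thesis using that[of \<kappa>] \<open>\<kappa> \<noteq> 0\<close> iso1 iso2 by simp
qed

theorem theorem3p2:
  fixes X :: "('f::field, 'a::ab_group_add, 'b::ab_group_add) graded_space"
    and d \<delta> :: "('a, 'b) differential"
    and d\<^sub>1 d\<^sub>2 \<delta>\<^sub>1 \<delta>\<^sub>2 :: "('a, 'b) dagger"
    and T\<^sub>1 T\<^sub>2 :: "('a, 'b) triple"
  assumes "is_complex X d" and "is_complex X \<delta>"
    and "is_fredholm X d" and "is_fredholm X \<delta>"
    and "finite_rank_perturbation_diff X d \<delta>"
    and "is_perturbation_choice X d \<delta> d\<^sub>1 \<delta>\<^sub>1 T\<^sub>1"
    and "is_perturbation_choice X d \<delta> d\<^sub>2 \<delta>\<^sub>2 T\<^sub>2"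
  shows "(\<exists>!P. is_perturbation_iso X d \<delta> d\<^sub>1 \<delta>\<^sub>1 T\<^sub>1 P) \<and>
    (\<exists>!P. is_perturbation_iso X d \<delta> d\<^sub>2 \<delta>\<^sub>2 T\<^sub>2 P) \<and>
    perturbation_iso X d \<delta> d\<^sub>1 \<delta>\<^sub>1 T\<^sub>1 = perturbation_iso X d \<delta> d\<^sub>2 \<delta>\<^sub>2 T\<^sub>2"
proof -
  \<comment> \<open>The representatives of the cohomology are fixed once, before either choice of
    pseudo-inverses is considered.\<close>
  obtain gs hs where b: "vsp.basis_mod (scale_plus X) (range (d_minus d)) {x. d_plus d x = 0} gs"
      "vsp.basis_mod (scale_minus X) (range (d_plus d)) {y. d_minus d y = 0} hs"
    and ind: "fredholm_index X d = int (length gs) - int (length hs)"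
    by (rule fredholm_bases[OF assms(1,3)])
  obtain gs' hs' where b': "vsp.basis_mod (scale_plus X) (range (d_minus \<delta>)) {x. d_plus \<delta> x = 0} gs'"
      "vsp.basis_mod (scale_minus X) (range (d_plus \<delta>)) {y. d_minus \<delta> y = 0} hs'"
    by (rule fredholm_bases[OF assms(2,4)])
  have S: "pert_setting X d dd gs hs \<delta> ee gs' hs'" if "is_perturbation_choice X d \<delta> dd ee T" for dd ee T
    using that b b' assms(1,2,5) unfolding is_perturbation_choice_def
    by (intro pert_setting.intro coh.intro pert_setting_axioms.intro) simp_all
  note S1 = S[OF assms(6)] and S2 = S[OF assms(7)]
  interpret S1: pert_setting X d d\<^sub>1 gs hs \<delta> \<delta>\<^sub>1 gs' hs' by (rule S1)
  interpret S2: pert_setting X d d\<^sub>2 gs hs \<delta> \<delta>\<^sub>2 gs' hs' by (rule S2)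
  \<comment> \<open>The generators do not depend on the pseudo-inverses, so this one predicate
    describes both isomorphisms.\<close>
  define iso where "iso = line_iso (complex_line X d) S1.D.gen (complex_line X \<delta>) S1.E.gen"
  have T: "is_triple X d d\<^sub>1 \<delta> \<delta>\<^sub>1 T\<^sub>1" "is_triple X d d\<^sub>2 \<delta> \<delta>\<^sub>2 T\<^sub>2"
    using assms(6,7) by (simp_all add: is_perturbation_choice_def)
  \<comment> \<open>A single nonzero scalar for both choices gives existence, uniqueness and
    equality at once. Triples of different kinds occur together only in index 0.\<close>
  have "\<exists>\<kappa>. \<kappa> \<noteq> 0 \<and> (\<forall>P. is_perturbation_iso X d \<delta> d\<^sub>1 \<delta>\<^sub>1 T\<^sub>1 P \<longleftrightarrow> iso \<kappa> P) \<and>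
      (\<forall>P. is_perturbation_iso X d \<delta> d\<^sub>2 \<delta>\<^sub>2 T\<^sub>2 P \<longleftrightarrow> iso \<kappa> P)"
  proof (cases T\<^sub>1)
    case T1: (Triple_Nonpos L1 M1 N1)
    then have t1: "is_triple_nonpos X d d\<^sub>1 \<delta> \<delta>\<^sub>1 L1 M1 N1" "fredholm_index X d \<le> 0"
      using T(1) by (simp_all add: is_triple_def)
    show ?thesis
    proof (cases T\<^sub>2)
      case T2: (Triple_Nonpos L2 M2 N2)
      then have t2: "is_triple_nonpos X d d\<^sub>2 \<delta> \<delta>\<^sub>2 L2 M2 N2" using T(2) by (simp add: is_triple_def)
      show ?thesis
        apply (rule S1.nonpos_iso[OF t1(1)], rule S2.nonpos_iso[OF t2])
        subgoal premises prems
          by (intro exI conjI allI, rule prems(2))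
            (simp_all only: T1 T2 iso_def prems(3,6) nonpos_scalar_unique[OF S1 S2 prems(1,4)])
        done
    next
      case T2: (Triple_Nonneg L2 M2 N2)
      then have t2: "is_triple_nonneg X d d\<^sub>2 \<delta> \<delta>\<^sub>2 L2 M2 N2" "fredholm_index X d \<ge> 0"
        using T(2) by (simp_all add: is_triple_def)
      have "length gs = length hs" using ind t1(2) t2(2) by simp
      then show ?thesis
        apply (rule mixed_iso[OF S1 S2 _ t1(1) t2(1)])
        subgoal premises prems
          by (intro exI conjI allI, rule prems(1)) (simp_all only: T1 T2 iso_def prems(2,3))
        done
    qed
  next
    case T1: (Triple_Nonneg L1 M1 N1)
    then have t1: "is_triple_nonneg X d d\<^sub>1 \<delta> \<delta>\<^sub>1 L1 M1 N1" "fredholm_index X d \<ge> 0"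
      using T(1) by (simp_all add: is_triple_def)
    show ?thesis
    proof (cases T\<^sub>2)
      case T2: (Triple_Nonpos L2 M2 N2)
      then have t2: "is_triple_nonpos X d d\<^sub>2 \<delta> \<delta>\<^sub>2 L2 M2 N2" "fredholm_index X d \<le> 0"
        using T(2) by (simp_all add: is_triple_def)
      have "length gs = length hs" using ind t1(2) t2(2) by simp
      then show ?thesis
        apply (rule mixed_iso[OF S2 S1 _ t2(1) t1(1)])
        subgoal premises prems
          by (intro exI conjI allI, rule prems(1)) (simp_all only: T1 T2 iso_def prems(2,3))
        done
    next
      case T2: (Triple_Nonneg L2 M2 N2)
      then have t2: "is_triple_nonneg X d d\<^sub>2 \<delta> \<delta>\<^sub>2 L2 M2 N2" using T(2) by (simp add: is_triple_def)
      show ?thesis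
        apply (rule S1.nonneg_iso[OF t1(1)], rule S2.nonneg_iso[OF t2])
        subgoal premises prems
          by (intro exI conjI allI, rule prems(3))
            (simp_all only: T1 T2 iso_def prems(4,8)
              prems(2)[unfolded nonneg_scalar_unique[OF S1 S2 prems(1,5)], folded prems(6)])
        done
    qed
  qed
  then obtain \<kappa> where \<kappa>: "\<kappa> \<noteq> 0"
    and "is_perturbation_iso X d \<delta> d\<^sub>1 \<delta>\<^sub>1 T\<^sub>1 = iso \<kappa>" "is_perturbation_iso X d \<delta> d\<^sub>2 \<delta>\<^sub>2 T\<^sub>2 = iso \<kappa>"
    by (auto simp: fun_eq_iff)
  moreover have "\<exists>!P. iso \<kappa> P"
    unfolding iso_def by (rule line_iso_ex1[OF S1.D.line_gen S1.E.line_gen \<kappa>])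
  ultimately show ?thesis unfolding perturbation_iso_def by simp
qed

end
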